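(* There is $k_0\in\mathbb{N}$ such that the following holds for every $k\ge k_0$. Let $\mathbf{A},\tilde{\mathbf{A}}\in C^k(\mathbb{R}^3;\mathbb{C}^3)$ and $V,\tilde V\in C^k(\mathbb{R}^3;\mathbb{C})$ be compactly supported, and let $a(\omega,\theta,\lambda)$ and $\tilde a(\omega,\theta,\lambda)$ be the scattering amplitudes of the biharmonic equation corresponding to the pairs $(\mathbf{A},V)$ and $(\tilde{\mathbf{A}},\tilde V)$ respectively. Then the high-frequency asymptotic expansion of the scattering amplitude up to $\mathcal{O}(\lambda^{-3})$ uniquely determines $\operatorname{curl}\mathbf{A}$ and $V-\frac12\nabla\cdot\mathbf{A}$; that is, if $$a(\omega,\theta,\lambda)=\tilde a(\omega,\theta,\lambda)+\mathcal{O}(\lambda^{-3})\quad\text{as }\lambda\to\infty,$$ uniformly in $(\omega,\theta)\in S^2\times S^2$, then $$\operatorname{curl}\mathbf{A}=\operatorname{curl}\tilde{\mathbf{A}}\quad\text{and}\quad V-\tfrac12\nabla\cdot\mathbf{A}=\tilde V-\tfrac12\nabla\cdot\tilde{\mathbf{A}}\quad\text{on }\mathbb{R}^3.$$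
   Context: For compactly supported $\mathbf{A}$ (vector-valued) and $V$ (scalar-valued) on $\mathbb{R}^3$, the biharmonic equation is $$(\Delta^2+\mathbf{A}\cdot\nabla+V-\lambda^4)u=0 ,\qquad \lambda>0,$$ where $\mathbf{A}\cdot\nabla=\sum_j A_j\partial_j$ (no complex conjugation). The outgoing free resolvent $R_0(\lambda)=(\Delta^2-\lambda^4-\mathrm{i}0)^{-1}$ is the integral operator $$[R_0(\lambda)f](x)=\int_{\mathbb{R}^3}G_0(x,y,\lambda)f(y)\,dy,\qquad G_0(x,y,\lambda)=\frac{e^{\mathrm{i}\lambda|x-y|}-e^{-\lambda|x-y|}}{8\pi\lambda^2|x-y|}.$$ For $\theta\in S^2$ and all sufficiently large $\lambda$, the scattering solution is the unique solution of the form $u(x,\theta,\lambda)=e^{\mathrm{i}\lambda x\cdot\theta}+u_{sc}(x,\theta,\lambda)$, where the scattered wave $u_{sc}$ is outgoing, i.e. $u_{sc}=-R_0(\lambda)\big[(\mathbf{A}\cdot\nabla+V)u\big]$, with $u_{sc}$ and $\nabla u_{sc}$ in $L^2(\mathbb{R}^3;(1+|x|)^{-2\delta}dx)$ for some $\delta>1/2$. The scattering amplitude is, for $\omega,\theta\in S^2$ and $\lambda$ sufficiently large, $$a(\omega,\theta,\lambda)=\int_{\mathbb{R}^3}e^{-\mathrm{i}\lambda\omega\cdot y}\big(\mathbf{A}(y)\cdot\nabla+V(y)\big)u(y,\theta,\lambda)\,dy .$$ *)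

theory Defs
  imports "HOL-Analysis.Analysis"
begin

section \<open>Calculus on three-dimensional space\<close>

text \<open>Meaningful only where \<open>f\<close> is (real) differentiable at \<open>x\<close>.\<close>

definition partial :: "'n::finite \<Rightarrow> (real^'n \<Rightarrow> 'b::real_normed_vector) \<Rightarrow> real^'n \<Rightarrow> 'b"
  where "partial j f x = frechet_derivative f (at x) (axis j 1)"

primrec Ck :: "nat \<Rightarrow> (real^'n \<Rightarrow> 'b::real_normed_vector) \<Rightarrow> bool" where
  "Ck 0 f \<longleftrightarrow> continuous_on UNIV f"
| "Ck (Suc k) f \<longleftrightarrow> (\<forall>x. f differentiable (at x)) \<and> (\<forall>j. Ck k (partial j f))"

definition compactly_supported :: "(real^'n \<Rightarrow> 'b::real_normed_vector) \<Rightarrow> bool"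
  where "compactly_supported f \<longleftrightarrow> compact (closure (support_on UNIV f))"

definition grad :: "(real^3 \<Rightarrow> complex) \<Rightarrow> real^3 \<Rightarrow> complex^3"
  where "grad u x = (\<chi> j. partial j u x)"

definition divergence :: "(real^3 \<Rightarrow> complex^3) \<Rightarrow> real^3 \<Rightarrow> complex"
  where "divergence A x = (\<Sum>j\<in>UNIV. partial j (\<lambda>y. A y $ j) x)"

definition curl :: "(real^3 \<Rightarrow> complex^3) \<Rightarrow> real^3 \<Rightarrow> complex^3"
  where "curl A x = vector
    [partial 2 (\<lambda>y. A y $ 3) x - partial 3 (\<lambda>y. A y $ 2) x,
     partial 3 (\<lambda>y. A y $ 1) x - partial 1 (\<lambda>y. A y $ 3) x,
     partial 1 (\<lambda>y. A y $ 2) x - partial 2 (\<lambda>y. A y $ 1) x]"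

definition laplacian :: "(real^3 \<Rightarrow> complex) \<Rightarrow> real^3 \<Rightarrow> complex"
  where "laplacian u x = (\<Sum>j\<in>UNIV. partial j (partial j u) x)"

section \<open>The biharmonic equation\<close>

text \<open>The first-order perturbation \<open>(A \<cdot> \<nabla> + V) u\<close>. The product is bilinear (no complex
  conjugation), hence it is not written with an inner product.\<close>

definition lower_order ::
    "(real^3 \<Rightarrow> complex^3) \<Rightarrow> (real^3 \<Rightarrow> complex) \<Rightarrow> (real^3 \<Rightarrow> complex) \<Rightarrow> real^3 \<Rightarrow> complex"
  where "lower_order A V u x = (\<Sum>j\<in>UNIV. A x $ j * partial j u x) + V x * u x"

text \<open>The spectral parameter, usually called lambda, is written \<open>\<kappa>\<close> throughout, \<open>\<lambda>\<close> being
  reserved for abstraction.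

  The equation \<open>(\<Delta>\<^sup>2 + A \<cdot> \<nabla> + V - \<kappa>\<^sup>4) u = 0\<close>. The bilaplacian is taken in the sense of
  distributions (tested against smooth compactly supported functions), since a scattering
  solution is a priori controlled only together with its first derivatives. The first-order term
  uses the classical gradient: a scattered wave is of the form \<open>R\<^sub>0(\<kappa>) f\<close> with \<open>f\<close> square
  integrable and compactly supported, and so is continuously differentiable.\<close>

definition biharmonic_solution ::
    "(real^3 \<Rightarrow> complex^3) \<Rightarrow> (real^3 \<Rightarrow> complex) \<Rightarrow> real \<Rightarrow> (real^3 \<Rightarrow> complex) \<Rightarrow> bool"
  where "biharmonic_solution A V \<kappa> u \<longleftrightarrow>
    (\<forall>x. u differentiable (at x)) \<and>
    (\<forall>\<phi>. (\<forall>m. Ck m \<phi>) \<and> compactly_supported \<phi> \<longrightarrow>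
      (LINT x|lborel. u x * (laplacian (laplacian \<phi>) x - of_real (\<kappa>^4) * \<phi> x)
                        + lower_order A V u x * \<phi> x) = 0)"

section \<open>Scattering\<close>

text \<open>On the diagonal \<open>x = y\<close>, a null set, the kernel takes the value \<open>0\<close>.\<close>

definition G0 :: "real^3 \<Rightarrow> real^3 \<Rightarrow> real \<Rightarrow> complex"
  where "G0 x y \<kappa> = (exp (\<i> * of_real (\<kappa> * norm (x - y))) - of_real (exp (- \<kappa> * norm (x - y))))
                     / of_real (8 * pi * \<kappa>^2 * norm (x - y))"

definition R0 :: "real \<Rightarrow> (real^3 \<Rightarrow> complex) \<Rightarrow> real^3 \<Rightarrow> complex"
  where "R0 \<kappa> f x = (LINT y|lborel. G0 x y \<kappa> * f y)"

text \<open>Membership in \<open>L\<^sup>2(\<real>\<^sup>3; (1 + |x|)\<^sup>-\<^sup>2\<^sup>\<delta> dx)\<close>.\<close>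

definition weighted_L2 :: "real \<Rightarrow> (real^3 \<Rightarrow> 'b::real_normed_vector) \<Rightarrow> bool"
  where "weighted_L2 \<delta> f \<longleftrightarrow> f \<in> borel_measurable lborel \<and>
    integrable lborel (\<lambda>x. (1 + norm x) powr (- 2 * \<delta>) * (norm (f x))^2)"

definition plane_wave :: "real^3 \<Rightarrow> real \<Rightarrow> real^3 \<Rightarrow> complex"
  where "plane_wave \<theta> \<kappa> x = exp (\<i> * of_real (\<kappa> * (x \<bullet> \<theta>)))"

text \<open>The outgoing condition is required at every point, i.e. the solution is identified with its
  continuously differentiable representative, so that it is unique as a function.\<close>

definition is_scattering_solution ::
    "(real^3 \<Rightarrow> complex^3) \<Rightarrow> (real^3 \<Rightarrow> complex) \<Rightarrow> real^3 \<Rightarrow> real \<Rightarrow> (real^3 \<Rightarrow> complex) \<Rightarrow> bool"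
  where "is_scattering_solution A V \<theta> \<kappa> u \<longleftrightarrow>
    biharmonic_solution A V \<kappa> u \<and>
    (\<exists>usc. (\<forall>x. u x = plane_wave \<theta> \<kappa> x + usc x) \<and>
           (\<forall>x. usc x = - R0 \<kappa> (lower_order A V u) x) \<and>
           (\<exists>\<delta>>1/2. weighted_L2 \<delta> usc \<and> weighted_L2 \<delta> (grad usc)))"

text \<open>The definite description is meaningful for all sufficiently large \<open>\<kappa>\<close>.\<close>

definition scattering_solution ::
    "(real^3 \<Rightarrow> complex^3) \<Rightarrow> (real^3 \<Rightarrow> complex) \<Rightarrow> real^3 \<Rightarrow> real \<Rightarrow> real^3 \<Rightarrow> complex"
  where "scattering_solution A V \<theta> \<kappa> = (THE u. is_scattering_solution A V \<theta> \<kappa> u)"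

definition scattering_amplitude ::
    "(real^3 \<Rightarrow> complex^3) \<Rightarrow> (real^3 \<Rightarrow> complex) \<Rightarrow> real^3 \<Rightarrow> real^3 \<Rightarrow> real \<Rightarrow> complex"
  where "scattering_amplitude A V \<omega> \<theta> \<kappa> =
    (LINT y|lborel. exp (- \<i> * of_real (\<kappa> * (\<omega> \<bullet> y)))
                      * lower_order A V (scattering_solution A V \<theta> \<kappa>) y)"

end

theory Submission
  imports Defs
begin

text \<open>
  For \<open>f = (A \<cdot> \<nabla> + V) u\<close> the scattering problem is equivalent to \<open>f = f\<^sub>0 - (A \<cdot> \<nabla> + V) R\<^sub>0 f\<close>, where
  \<open>f\<^sub>0\<close> comes from the plane wave. The kernel of \<open>\<nabla> R\<^sub>0\<close> is bounded by \<open>1 / (\<kappa> |x - y|)\<close>, so this is a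
  contraction on continuous functions for large \<open>\<kappa>\<close>, which gives existence and uniqueness of \<open>u\<close>, and
  the second Born approximation of the amplitude is accurate up to \<open>O(1 / \<kappa>)\<close>.

  Fix \<open>\<xi>\<close> and a unit vector \<open>\<eta> \<bottom> \<xi>\<close>, and choose directions close to \<open>\<eta>\<close> with \<open>\<kappa> (\<omega> - \<theta>) = \<xi>\<close>. The first Born
  term is then \<open>\<i> \<kappa> (1 + o(1)) \<eta> \<cdot> FT A(\<xi>)\<close> plus the Fourier transform of \<open>V - 1/2 div A\<close> at \<open>\<xi>\<close>. The second
  one is, up to \<open>o(1)\<close>, an integral of \<open>e\<^sup>i\<^sup>\<kappa>\<^sup>\<phi>\<close> with the phase \<open>\<phi>(x, y) = |x - y| - \<eta> \<cdot> (x - y)\<close>, which is nonzero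
  almost everywhere; if such an integral converges as \<open>\<kappa> \<rightarrow> \<infinity>\<close>, then its limit is \<open>0\<close>. Hence both Fourier
  quantities are determined, and only errors of size \<open>o(1)\<close> in the amplitude matter.
\<close>

section \<open>Compactly supported functions\<close>

text \<open>The obstacle is the size of the second Born term. The source is
  \<open>O(\<kappa>)\<close> and applying \<open>(A \<cdot> \<nabla> + V) R0\<close> gains only
  \<open>1 / \<kappa>\<close>, so this term is \<open>O(1)\<close>, the same order as the transform
  of \<open>V - 1/2 div A\<close>; no size estimate separates them. The analysis of the amplitude
  assumes only continuous coefficients, so it does not integrate by parts in \<open>x\<close> and
  \<open>y\<close>. Instead, once the terms linear in \<open>\<kappa>\<close> are matched, the
  hypothesis itself forces the difference of the two oscillatory integrals to converge. The
  divergence comes from geometry: keeping \<open>\<kappa> (\<omega> - \<theta>) = \<xi>\<close>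
  exactly tilts \<open>\<theta>\<close> by \<open>- \<xi> / (2 \<kappa>)\<close>, and the factor
  \<open>\<kappa>\<close> from the gradient of the plane wave turns this tilt into
  \<open>- (\<i> / 2) \<xi> \<cdot> FT A(\<xi>)\<close>, the transform of
  \<open>- 1/2 div A\<close>. Derivatives of the coefficients appear only when Fourier data are
  translated back, which is why \<open>k0 = 1\<close> works.\<close>

definition supported_in_ball :: "real \<Rightarrow> ('a::real_normed_vector \<Rightarrow> 'b::zero) \<Rightarrow> bool"
  where "supported_in_ball R f \<longleftrightarrow> (\<forall>x. R < norm x \<longrightarrow> f x = 0)"

lemma compactly_supported_iff:
  fixes f :: "real^'n \<Rightarrow> 'b::real_normed_vector"
  shows "compactly_supported f \<longleftrightarrow> (\<exists>R. supported_in_ball R f)"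
proof
  assume "compactly_supported f"
  then have "bounded (closure (support_on UNIV f))"
    unfolding compactly_supported_def by (rule compact_imp_bounded)
  then have "bounded (support_on UNIV f)"
    using bounded_subset closure_subset by blast
  then obtain R where R: "\<forall>x\<in>support_on UNIV f. norm x \<le> R"
    unfolding bounded_iff by blast
  then show "\<exists>R. supported_in_ball R f"
    unfolding supported_in_ball_def support_on_def by (intro exI[of _ R]) force
next
  assume "\<exists>R. supported_in_ball R f"
  then obtain R where "supported_in_ball R f" by blast
  then have "\<forall>x\<in>support_on UNIV f. norm x \<le> R"
    unfolding supported_in_ball_def support_on_def by force
  then have "bounded (support_on UNIV f)"
    unfolding bounded_iff by blast
  then show "compactly_supported f"
    unfolding compactly_supported_def by (simp add: compact_closure)
qed

lemma supported_in_ball_mono: "supported_in_ball R f \<Longrightarrow> R \<le> S \<Longrightarrow> supported_in_ball S f"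
  by (simp add: supported_in_ball_def)

lemma supported_in_ball_mult:
  fixes f g :: "'a::real_normed_vector \<Rightarrow> 'b::mult_zero"
  shows "supported_in_ball R f \<Longrightarrow> supported_in_ball R (\<lambda>x. g x * f x)"
    "supported_in_ball R f \<Longrightarrow> supported_in_ball R (\<lambda>x. f x * g x)"
  by (simp_all add: supported_in_ball_def)

lemma supported_in_ball_add:
  fixes f g :: "'a::real_normed_vector \<Rightarrow> 'b::monoid_add"
  shows "supported_in_ball R f \<Longrightarrow> supported_in_ball R g \<Longrightarrow> supported_in_ball R (\<lambda>x. f x + g x)"
  by (simp add: supported_in_ball_def)

lemma supported_in_ball_eq_indicator:
  fixes f :: "'a::real_normed_vector \<Rightarrow> 'b::real_normed_vector"
  assumes "supported_in_ball R f"
  shows "f = (\<lambda>x. indicator (cball 0 R) x *\<^sub>R f x)"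
  using assms by (auto simp: supported_in_ball_def indicator_def fun_eq_iff)

lemma integrable_supported_in_ball:
  fixes f :: "'a::euclidean_space \<Rightarrow> 'b::{banach, second_countable_topology}"
  assumes "continuous_on UNIV f" "supported_in_ball R f"
  shows "integrable lborel f"
  by (subst supported_in_ball_eq_indicator[OF assms(2)], rule borel_integrable_compact)
     (use assms(1) continuous_on_subset in auto)

text \<open>The indicator on the right makes the bound directly usable as a majorant in dominated
  convergence.\<close>

lemma bounded_supported_in_ball:
  fixes f :: "'a::euclidean_space \<Rightarrow> 'b::real_normed_vector"
  assumes "continuous_on UNIV f" "supported_in_ball R f"
  obtains B where "B > 0" "\<And>x. norm (f x) \<le> B * indicator (cball 0 R) x"
proof -
  have "compact (f ` cball 0 R)"
    using assms(1) by (intro compact_continuous_image compact_cball continuous_on_subset[OF assms(1)]) auto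
  then have "bounded (f ` cball 0 R)" by (rule compact_imp_bounded)
  then obtain B where "B > 0" "\<forall>y\<in>f ` cball 0 R. norm y \<le> B"
    unfolding bounded_pos by blast
  then have "norm (f x) \<le> B * indicator (cball 0 R) x" for x
    using assms(2) by (auto simp: supported_in_ball_def indicator_def)
  with \<open>B > 0\<close> that show thesis by blast
qed

section \<open>Directional derivatives and integration by parts\<close>

text \<open>Carrying the derivative as a second function lets explicit formulas, such as those for
  the regularised kernels, enter integration by parts without computing a Frechet
  derivative.\<close>

definition dir_deriv :: "'n::finite \<Rightarrow> (real^'n \<Rightarrow> complex) \<Rightarrow> (real^'n \<Rightarrow> complex) \<Rightarrow> bool"
  where "dir_deriv j F F' \<longleftrightarrow>
    (\<forall>x. ((\<lambda>t. F (x + t *\<^sub>R axis j 1)) has_vector_derivative F' x) (at 0))"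

lemma has_derivative_imp_partial:
  "(f has_derivative f') (at x) \<Longrightarrow> partial j f x = f' (axis j 1)"
  by (simp add: partial_def frechet_derivative_at[symmetric])

lemma has_vector_derivative_line:
  assumes "(f has_derivative f') (at x)"
  shows "((\<lambda>t. f (x + t *\<^sub>R v)) has_vector_derivative f' v) (at 0)"
proof -
  have *: "((\<lambda>t. x + t *\<^sub>R v) has_derivative (\<lambda>t. t *\<^sub>R v)) (at 0)"
    by (auto intro!: derivative_eq_intros)
  have "((\<lambda>t. f (x + t *\<^sub>R v)) has_derivative (\<lambda>t. f' (t *\<^sub>R v))) (at 0)"
    using has_derivative_compose[OF *, of f f'] assms by simp
  moreover have "f' (t *\<^sub>R v) = t *\<^sub>R f' v" for t
    using has_derivative_linear[OF assms] by (simp add: linear_scale)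
  ultimately show ?thesis by (simp add: has_vector_derivative_def)
qed

lemma dir_deriv_partial:
  assumes "\<And>x. f differentiable (at x)"
  shows "dir_deriv j f (partial j f)"
  unfolding dir_deriv_def partial_def
  using assms frechet_derivative_works has_vector_derivative_line by blast

lemma dir_deriv_at:
  assumes "dir_deriv j F F'"
  shows "((\<lambda>t. F (x + t *\<^sub>R axis j 1)) has_vector_derivative F' (x + s *\<^sub>R axis j 1)) (at s)"
proof -
  have "((\<lambda>t. F ((x + s *\<^sub>R axis j 1) + t *\<^sub>R axis j 1)) has_vector_derivative F' (x + s *\<^sub>R axis j 1)) (at 0)"
    using assms unfolding dir_deriv_def by blast
  then have *: "((\<lambda>t. F (x + (s + t) *\<^sub>R axis j 1)) has_derivative (\<lambda>t. t *\<^sub>R F' (x + s *\<^sub>R axis j 1))) (at 0)"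
    by (simp add: algebra_simps has_vector_derivative_def)
  have "((\<lambda>t. t - s) has_derivative (\<lambda>t. t)) (at s)"
    by (auto intro!: derivative_eq_intros)
  from has_derivative_compose[OF this, of "\<lambda>t. F (x + (s + t) *\<^sub>R axis j 1)"] *
  show ?thesis by (simp add: has_vector_derivative_def)
qed

lemma dir_deriv_mult:
  assumes "dir_deriv j u u'" "dir_deriv j v v'"
  shows "dir_deriv j (\<lambda>x. u x * v x) (\<lambda>x. u x * v' x + u' x * v x)"
  using assms unfolding dir_deriv_def
  by (auto intro!: derivative_eq_intros has_vector_derivative_mult)

lemma dir_deriv_bound:
  assumes "dir_deriv j F F'" "\<And>x. norm (F' x) \<le> B"
  shows "norm (F (x + t *\<^sub>R axis j 1) - F x) \<le> B * \<bar>t\<bar>"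
proof -
  have "norm (F (x + t *\<^sub>R axis j 1) - F (x + 0 *\<^sub>R axis j 1)) \<le> B * norm (t - 0)"
  proof (rule differentiable_bound[where S=UNIV and f'="\<lambda>s h. h *\<^sub>R F' (x + s *\<^sub>R axis j 1)"])
    fix s :: real
    show "((\<lambda>t. F (x + t *\<^sub>R axis j 1)) has_derivative (\<lambda>h. h *\<^sub>R F' (x + s *\<^sub>R axis j 1))) (at s within UNIV)"
      using dir_deriv_at[OF assms(1), of x s] by (simp add: has_vector_derivative_def)
    show "onorm (\<lambda>h. h *\<^sub>R F' (x + s *\<^sub>R axis j 1)) \<le> B"
      by (rule onorm_le) (simp add: mult.commute[of B] mult_left_mono assms(2))
  qed auto
  then show ?thesis by simp
qed

lemma dir_deriv_supported:
  assumes "dir_deriv j F F'" "supported_in_ball R F"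
  shows "supported_in_ball R F'"
  unfolding supported_in_ball_def
proof (intro allI impI)
  fix x :: "real^'a" assume x: "R < norm x"
  have "((\<lambda>t. F (x + t *\<^sub>R axis j 1)) has_vector_derivative 0) (at 0)"
  proof (rule has_vector_derivative_transform_within[of "\<lambda>_. 0"])
    show "0 < norm x - R" using x by simp
    fix t :: real assume "dist t 0 < norm x - R"
    moreover have "norm x \<le> norm (x + t *\<^sub>R axis j 1) + norm (t *\<^sub>R (axis j 1 :: real^'a))"
      using norm_triangle_ineq4[of "x + t *\<^sub>R axis j 1" "t *\<^sub>R axis j 1"] by simp
    ultimately have "R < norm (x + t *\<^sub>R axis j 1)" by simp
    then show "0 = F (x + t *\<^sub>R axis j 1)" using assms(2) by (simp add: supported_in_ball_def)
  qed auto
  moreover have "((\<lambda>t. F (x + t *\<^sub>R axis j 1)) has_vector_derivative F' x) (at 0)"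
    using assms(1) by (simp add: dir_deriv_def)
  ultimately show "F' x = 0" using vector_derivative_unique_at by blast
qed

section \<open>Translation invariance and integration by parts\<close>

lemma integral_lborel_translation:
  fixes f :: "'a::euclidean_space \<Rightarrow> 'b::{banach, second_countable_topology}"
  assumes "f \<in> borel_measurable borel"
  shows "(LINT x|lborel. f (x + a)) = integral\<^sup>L lborel f"
proof -
  have "integral\<^sup>L lborel f = integral\<^sup>L (distr lborel borel ((+) a)) f"
    by (simp add: lborel_distr_plus)
  also have "\<dots> = (LINT x|lborel. f (x + a))"
    using assms by (subst integral_distr) (auto simp: add.commute[of a])
  finally show ?thesis by simp
qed

lemma integrable_lborel_translation:
  fixes f :: "'a::euclidean_space \<Rightarrow> 'b::{banach, second_countable_topology}"
  assumes "integrable lborel f"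
  shows "integrable lborel (\<lambda>x. f (x + a))"
proof -
  have "integrable (distr lborel borel ((+) a)) f"
    using assms by (simp add: lborel_distr_plus)
  then show ?thesis unfolding add.commute[of _ a]
    by (subst (asm) integrable_distr_eq) (use borel_measurable_integrable[OF assms] in auto)
qed

lemma has_vector_derivative_at_0_imp_tendsto:
  fixes g :: "real \<Rightarrow> 'a::real_normed_vector"
  assumes "(g has_vector_derivative D) (at 0)"
  shows "((\<lambda>t. (g t - g 0) /\<^sub>R t) \<longlongrightarrow> D) (at 0)"
proof -
  have "((\<lambda>t. norm (g t - g 0 - t *\<^sub>R D) / norm t) \<longlongrightarrow> 0) (at 0)"
    using assms by (simp add: has_vector_derivative_def has_derivative_iff_norm)
  moreover have "\<forall>\<^sub>F t in at (0::real). norm (g t - g 0 - t *\<^sub>R D) / norm t = norm ((g t - g 0) /\<^sub>R t - D)"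
  proof (rule eventually_at_filter[THEN iffD2], rule always_eventually, intro allI impI)
    fix t :: real assume "t \<noteq> 0"
    then have "(g t - g 0) /\<^sub>R t - D = (g t - g 0 - t *\<^sub>R D) /\<^sub>R t"
      by (simp add: scaleR_right_diff_distrib)
    then show "norm (g t - g 0 - t *\<^sub>R D) / norm t = norm ((g t - g 0) /\<^sub>R t - D)"
      by (simp add: divide_inverse mult.commute)
  qed
  ultimately have "((\<lambda>t. norm ((g t - g 0) /\<^sub>R t - D)) \<longlongrightarrow> 0) (at 0)"
    using tendsto_cong by fast
  then show ?thesis by (simp add: tendsto_norm_zero_iff LIM_zero_iff)
qed
text \<open>By translation invariance every difference quotient of \<open>F\<close> has integral 0.
  The quotients converge to \<open>F'\<close>, and the mean value bound supplies a majorant.\<close>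

lemma integral_dir_deriv_eq_0:
  assumes d: "dir_deriv j F F'" and F: "continuous_on UNIV F" and F': "continuous_on UNIV F'"
    and supp: "supported_in_ball R F"
  shows "(LINT x|lborel. F' x) = 0"
proof -
  have [measurable]: "F \<in> borel_measurable borel" "F' \<in> borel_measurable borel"
    using F F' by (auto intro: borel_measurable_continuous_onI)
  obtain B where B: "B > 0" "\<And>x. norm (F' x) \<le> B * indicator (cball 0 R) x"
    using bounded_supported_in_ball[OF F' dir_deriv_supported[OF d supp]] by blast
  have B': "norm (F' x) \<le> B" for x
    using B(2)[of x] B(1) by (cases "x \<in> cball 0 R") (auto simp: indicator_def)
  define s where "s = (\<lambda>(n::nat) x. real (Suc n) *\<^sub>R (F (x + (1 / real (Suc n)) *\<^sub>R axis j 1) - F x))"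
  have int: "integrable lborel F" by (rule integrable_supported_in_ball[OF F supp])
  have zero: "integral\<^sup>L lborel (s n) = 0" for n
  proof -
    define a :: "real^'a" where "a = (1 / real (Suc n)) *\<^sub>R axis j 1"
    have "integrable lborel (\<lambda>x. F (x + a))"
      by (rule integrable_lborel_translation[OF int])
    moreover have "(LINT x|lborel. F (x + a)) = integral\<^sup>L lborel F"
      by (rule integral_lborel_translation) simp
    ultimately show ?thesis
      using int unfolding s_def a_def[symmetric] by (simp del: of_nat_Suc)
  qed
  have "(\<lambda>n. integral\<^sup>L lborel (s n)) \<longlonglongrightarrow> integral\<^sup>L lborel F'"
  \<comment> \<open>The shifts have length at most 1, so every quotient vanishes outside the ball of
    radius \<open>R + 1\<close>.\<close>
  proof (rule integral_dominated_convergence[where w="\<lambda>x. B * indicator (cball 0 (R + 1)) x"])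
    show "F' \<in> borel_measurable lborel" by simp
    show "s n \<in> borel_measurable lborel" for n unfolding s_def by simp
    have "integrable lborel (\<lambda>x. indicator (cball 0 (R + 1)) x *\<^sub>R B :: real)"
      by (intro borel_integrable_compact) auto
    then show "integrable lborel (\<lambda>x. B * indicator (cball 0 (R + 1)) x :: real)"
      by (simp add: mult.commute)
    show "AE x in lborel. (\<lambda>n. s n x) \<longlonglongrightarrow> F' x"
    proof (rule AE_I2)
      fix x :: "real^'a"
      have "((\<lambda>t. F (x + t *\<^sub>R axis j 1)) has_vector_derivative F' x) (at 0)"
        using d by (simp add: dir_deriv_def)
      then have "((\<lambda>t. (F (x + t *\<^sub>R axis j 1) - F x) /\<^sub>R t) \<longlongrightarrow> F' x) (at 0)"
        using has_vector_derivative_at_0_imp_tendsto by fastforce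
      moreover have "filterlim (\<lambda>n. 1 / real (Suc n)) (at 0) sequentially"
        unfolding filterlim_at using LIMSEQ_inverse_real_of_nat by (simp add: inverse_eq_divide)
      ultimately have "(\<lambda>n. (F (x + (1 / real (Suc n)) *\<^sub>R axis j 1) - F x) /\<^sub>R (1 / real (Suc n))) \<longlonglongrightarrow> F' x"
        by (rule filterlim_compose)
      then show "(\<lambda>n. s n x) \<longlonglongrightarrow> F' x"
        by (simp only: s_def inverse_eq_divide divide_divide_eq_right div_by_1 mult_1)
    qed
    show "AE x in lborel. norm (s n x) \<le> B * indicator (cball 0 (R + 1)) x" for n
    proof (rule AE_I2)
      fix x :: "real^'a"
      let ?t = "1 / real (Suc n)"
      show "norm (s n x) \<le> B * indicator (cball 0 (R + 1)) x"
      proof (cases "norm x \<le> R + 1")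
        case True
        have "norm (F (x + ?t *\<^sub>R axis j 1) - F x) \<le> B * \<bar>?t\<bar>"
          by (rule dir_deriv_bound[OF d B'])
        then have "norm (s n x) \<le> real (Suc n) * (B * ?t)"
          unfolding s_def norm_scaleR by (intro mult_mono) auto
        also have "\<dots> = B" by (simp del: of_nat_Suc)
        finally show ?thesis using True by simp
      next
        case False
        have "norm x \<le> norm (x + ?t *\<^sub>R axis j 1) + norm (?t *\<^sub>R (axis j 1 :: real^'a))"
          using norm_triangle_ineq4[of "x + ?t *\<^sub>R axis j 1" "?t *\<^sub>R axis j 1"] by simp
        moreover have "norm (?t *\<^sub>R (axis j 1 :: real^'a)) \<le> 1" by (simp add: divide_simps)
        ultimately have "R < norm (x + ?t *\<^sub>R axis j 1)" "R < norm x" using False by linarith+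
        then show ?thesis using supp B(1) by (simp add: s_def supported_in_ball_def)
      qed
    qed
  qed
  then show ?thesis using zero by (simp add: LIMSEQ_const_iff)
qed

lemma integral_by_parts:
  assumes u: "dir_deriv j u u'" "continuous_on UNIV u" "continuous_on UNIV u'"
    and v: "dir_deriv j v v'" "continuous_on UNIV v" "continuous_on UNIV v'"
    and supp: "supported_in_ball R v"
  shows "(LINT x|lborel. u x * v' x) = - (LINT x|lborel. u' x * v x)"
proof -
  note supp' = dir_deriv_supported[OF v(1) supp]
  have "(LINT x|lborel. u x * v' x + u' x * v x) = 0"
    by (rule integral_dir_deriv_eq_0[OF dir_deriv_mult[OF u(1) v(1)] _ _ supported_in_ball_mult(1)[OF supp]])
       (intro continuous_intros u v)+
  moreover have "integrable lborel (\<lambda>x. u x * v' x)" "integrable lborel (\<lambda>x. u' x * v x)"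
    by (intro integrable_supported_in_ball[where R=R] continuous_intros
          supported_in_ball_mult(1) u v supp supp')+
  ultimately show ?thesis by (simp add: add_eq_0_iff2)
qed

section \<open>Test functions\<close>

lemma Ck_SucD: "Ck (Suc k) f \<Longrightarrow> Ck k f"
proof (induction k arbitrary: f)
  case 0
  then show ?case
    by (auto intro!: differentiable_imp_continuous_on simp: differentiable_on_def)
next
  case (Suc k)
  then show ?case by (metis Ck.simps(2))
qed

lemma Ck_mono: "Ck k f \<Longrightarrow> m \<le> k \<Longrightarrow> Ck m f"
  by (induction k) (auto simp: le_Suc_eq simp del: Ck.simps dest: Ck_SucD)

lemma Ck_1D:
  assumes "Ck 1 f"
  shows "continuous_on UNIV f" "f differentiable (at x)" "continuous_on UNIV (partial j f)"
  using assms Ck_SucD[of 0 f] by simp_all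

lemma partial_add:
  assumes "f differentiable (at x)" "g differentiable (at x)"
  shows "partial j (\<lambda>x. f x + g x) x = partial j f x + partial j g x"
  using has_derivative_imp_partial[OF has_derivative_add
      [OF assms[unfolded frechet_derivative_works]]]
  by (simp add: partial_def)

lemma partial_bounded_linear:
  assumes "bounded_linear h" "f differentiable (at x)"
  shows "partial j (\<lambda>x. h (f x)) x = h (partial j f x)"
  using has_derivative_imp_partial[OF bounded_linear.has_derivative
      [OF assms(1) assms(2)[unfolded frechet_derivative_works]]]
  by (simp add: partial_def)

lemma Ck_add: "Ck k f \<Longrightarrow> Ck k g \<Longrightarrow> Ck k (\<lambda>x. f x + g x)"
proof (induction k arbitrary: f g)
  case 0
  then show ?case by (auto intro: continuous_on_add)
next
  case (Suc k)
  moreover have "partial j (\<lambda>x. f x + g x) = (\<lambda>x. partial j f x + partial j g x)" for j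
    using Suc.prems by (auto intro!: partial_add)
  ultimately show ?case by (auto intro: differentiable_add)
qed

lemma Ck_bounded_linear:
  assumes "bounded_linear h"
  shows "Ck k f \<Longrightarrow> Ck k (\<lambda>x. h (f x))"
proof (induction k arbitrary: f)
  case 0
  then show ?case
    using bounded_linear.continuous_on[OF assms] by auto
next
  case (Suc k)
  moreover have "partial j (\<lambda>x. h (f x)) = (\<lambda>x. h (partial j f x))" for j
    using Suc.prems by (auto intro!: partial_bounded_linear assms)
  moreover have "(\<lambda>x. h (f x)) differentiable (at x)" for x
    using Suc.prems bounded_linear.has_derivative[OF assms] unfolding differentiable_def
    by (metis Ck.simps(2) differentiable_def)
  ultimately show ?case by auto
qed

text \<open>This is the class of functions over which \<open>biharmonic_solution\<close>
  quantifies.\<close>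

definition test_function :: "(real^'n \<Rightarrow> complex) \<Rightarrow> bool"
  where "test_function \<phi> \<longleftrightarrow> (\<forall>m. Ck m \<phi>) \<and> compactly_supported \<phi>"

lemma test_functionD:
  assumes "test_function \<phi>"
  shows "continuous_on UNIV \<phi>" "dir_deriv j \<phi> (partial j \<phi>)"
proof -
  have "Ck 1 \<phi>" using assms by (auto simp: test_function_def)
  then show "continuous_on UNIV \<phi>" "dir_deriv j \<phi> (partial j \<phi>)"
    using Ck_1D by (blast intro: dir_deriv_partial)+
qed

lemma test_function_partial:
  assumes "test_function \<phi>"
  shows "test_function (partial j \<phi>)"
proof -
  have "Ck m (partial j \<phi>)" for m
    using assms Ck.simps(2)[of m \<phi>] by (auto simp: test_function_def)
  moreover have "compactly_supported (partial j \<phi>)"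
    using assms dir_deriv_supported[OF test_functionD(2)[OF assms]]
    by (auto simp: test_function_def compactly_supported_iff)
  ultimately show ?thesis by (simp add: test_function_def)
qed

lemma test_function_add:
  assumes "test_function \<phi>" "test_function \<psi>"
  shows "test_function (\<lambda>x. \<phi> x + \<psi> x)"
proof -
  obtain R S where "supported_in_ball R \<phi>" "supported_in_ball S \<psi>"
    using assms by (auto simp: test_function_def compactly_supported_iff)
  then have "supported_in_ball (max R S) (\<lambda>x. \<phi> x + \<psi> x)"
    by (simp add: supported_in_ball_def)
  then show ?thesis
    using assms by (auto simp: test_function_def compactly_supported_iff intro: Ck_add)
qed

lemma test_function_cmult:
  assumes "test_function \<phi>"
  shows "test_function (\<lambda>x. c * \<phi> x)"
  using assms Ck_bounded_linear[OF bounded_linear_mult_right, of _ \<phi> c]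
  by (auto simp: test_function_def compactly_supported_iff intro: supported_in_ball_mult(1))

lemma test_function_laplacian:
  assumes "test_function \<phi>"
  shows "test_function (laplacian \<phi>)"
proof -
  have "laplacian \<phi> = (\<lambda>x. partial 1 (partial 1 \<phi>) x + partial 2 (partial 2 \<phi>) x + partial 3 (partial 3 \<phi>) x)"
    by (simp add: laplacian_def fun_eq_iff sum_3)
  then show ?thesis
    by (auto intro!: test_function_add test_function_partial assms)
qed

lemma test_function_integrable:
  assumes "test_function \<phi>"
  shows "integrable lborel \<phi>"
  using assms test_functionD(1) integrable_supported_in_ball
  by (auto simp: test_function_def compactly_supported_iff)

lemma test_function_mult_integrable:
  fixes \<phi> :: "real^'n \<Rightarrow> complex"
  assumes "test_function \<phi>" "continuous_on UNIV u"
  shows "integrable lborel (\<lambda>x. u x * \<phi> x)"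
proof -
  obtain R where "supported_in_ball R \<phi>"
    using assms by (auto simp: test_function_def compactly_supported_iff)
  then show ?thesis
    by (intro integrable_supported_in_ball[of _ R] continuous_intros assms test_functionD
          supported_in_ball_mult(1))
qed

lemma integral_by_parts_test:
  assumes "dir_deriv j u u'" "continuous_on UNIV u" "continuous_on UNIV u'" "test_function \<phi>"
  shows "(LINT x|lborel. u x * partial j \<phi> x) = - (LINT x|lborel. u' x * \<phi> x)"
proof -
  obtain R where "supported_in_ball R \<phi>"
    using assms by (auto simp: test_function_def compactly_supported_iff)
  then show ?thesis
    by (intro integral_by_parts[where R=R and j=j] assms test_functionD(2)[OF assms(4)]
          test_functionD(1)[OF assms(4)] test_functionD(1)[OF test_function_partial[OF assms(4)]])
qed

text \<open>Meant for functions \<open>u\<close> given by a formula, namely the regularised kernel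
  and the plane wave, whose first and second derivatives are supplied as \<open>u1\<close> and
  \<open>u2\<close>.\<close>

lemma integral_laplacian_by_parts:
  assumes "\<And>j. dir_deriv j u (u1 j)" "\<And>j. dir_deriv j (u1 j) (u2 j)" "continuous_on UNIV u"
    "\<And>j. continuous_on UNIV (u1 j)" "\<And>j. continuous_on UNIV (u2 j)" "test_function \<phi>"
  shows "(LINT x|lborel. u x * laplacian \<phi> x) = (LINT x|lborel. (\<Sum>j\<in>UNIV. u2 j x) * \<phi> x)"
proof -
  have *: "(LINT x|lborel. u x * partial j (partial j \<phi>) x) = (LINT x|lborel. u2 j x * \<phi> x)" for j
    using integral_by_parts_test[OF assms(1,3,4) test_function_partial[OF assms(6)], of j j]
      integral_by_parts_test[OF assms(2,4,5,6), of j] by simp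
  have "(LINT x|lborel. u x * laplacian \<phi> x)
      = (\<Sum>j\<in>UNIV. LINT x|lborel. u x * partial j (partial j \<phi>) x)"
    unfolding laplacian_def sum_distrib_left
    by (intro Bochner_Integration.integral_sum test_function_mult_integrable test_function_partial assms)
  also have "\<dots> = (\<Sum>j\<in>UNIV. LINT x|lborel. u2 j x * \<phi> x)"
    by (simp add: *)
  also have "\<dots> = (LINT x|lborel. (\<Sum>j\<in>UNIV. u2 j x) * \<phi> x)"
    unfolding sum_distrib_right
    by (intro Bochner_Integration.integral_sum[symmetric] test_function_mult_integrable assms)
  finally show ?thesis .
qed

section \<open>Injectivity of the Fourier transform\<close>

text \<open>The algebra for Stone-Weierstrass. The product-to-sum formulas in the next lemmas close
  this linear span under multiplication.\<close>

inductive trig_poly :: "('a::real_inner \<Rightarrow> real) \<Rightarrow> bool" where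
  cos: "trig_poly (\<lambda>x. c * cos (\<xi> \<bullet> x))"
| sin: "trig_poly (\<lambda>x. c * sin (\<xi> \<bullet> x))"
| add: "trig_poly p \<Longrightarrow> trig_poly q \<Longrightarrow> trig_poly (\<lambda>x. p x + q x)"

lemma trig_poly_mult_cos: "trig_poly p \<Longrightarrow> trig_poly (\<lambda>x. c * cos (\<xi> \<bullet> x) * p x)"
proof (induction rule: trig_poly.induct)
  case (cos d \<eta>)
  have "(\<lambda>x. c * cos (\<xi> \<bullet> x) * (d * cos (\<eta> \<bullet> x)))
      = (\<lambda>x. (c * d / 2) * cos ((\<xi> - \<eta>) \<bullet> x) + (c * d / 2) * cos ((\<xi> + \<eta>) \<bullet> x))"
    by (auto simp: fun_eq_iff inner_diff_left inner_add_left cos_add cos_diff algebra_simps)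
  then show ?case by (simp only:) (intro trig_poly.intros)
next
  case (sin d \<eta>)
  have "(\<lambda>x. c * cos (\<xi> \<bullet> x) * (d * sin (\<eta> \<bullet> x)))
      = (\<lambda>x. (c * d / 2) * sin ((\<xi> + \<eta>) \<bullet> x) + (- (c * d / 2)) * sin ((\<xi> - \<eta>) \<bullet> x))"
    by (auto simp: fun_eq_iff inner_diff_left inner_add_left sin_add sin_diff algebra_simps)
  then show ?case by (simp only:) (intro trig_poly.intros)
next
  case (add p q)
  then show ?case using trig_poly.add by (force simp: distrib_left)
qed

lemma trig_poly_mult_sin: "trig_poly p \<Longrightarrow> trig_poly (\<lambda>x. c * sin (\<xi> \<bullet> x) * p x)"
proof (induction rule: trig_poly.induct)
  case (cos d \<eta>)
  have "(\<lambda>x. c * sin (\<xi> \<bullet> x) * (d * cos (\<eta> \<bullet> x)))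
      = (\<lambda>x. (c * d / 2) * sin ((\<xi> + \<eta>) \<bullet> x) + (c * d / 2) * sin ((\<xi> - \<eta>) \<bullet> x))"
    by (auto simp: fun_eq_iff inner_diff_left inner_add_left sin_add sin_diff algebra_simps)
  then show ?case by (simp only:) (intro trig_poly.intros)
next
  case (sin d \<eta>)
  have "(\<lambda>x. c * sin (\<xi> \<bullet> x) * (d * sin (\<eta> \<bullet> x)))
      = (\<lambda>x. (c * d / 2) * cos ((\<xi> - \<eta>) \<bullet> x) + (- (c * d / 2)) * cos ((\<xi> + \<eta>) \<bullet> x))"
    by (auto simp: fun_eq_iff inner_diff_left inner_add_left cos_add cos_diff algebra_simps)
  then show ?case by (simp only:) (intro trig_poly.intros)
next
  case (add p q)
  then show ?case using trig_poly.add by (force simp: distrib_left)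
qed

lemma trig_poly_mult: "trig_poly p \<Longrightarrow> trig_poly q \<Longrightarrow> trig_poly (\<lambda>x. p x * q x)"
proof (induction rule: trig_poly.induct)
  case (add p1 p2)
  then show ?case using trig_poly.add by (force simp: distrib_right)
qed (auto intro: trig_poly_mult_cos trig_poly_mult_sin)

lemma trig_poly_continuous: "trig_poly p \<Longrightarrow> continuous_on S p"
  by (induction rule: trig_poly.induct) (auto intro!: continuous_intros)

lemma continuous_AE_zero_imp_zero:
  fixes f :: "'a::euclidean_space \<Rightarrow> 'b::real_normed_vector"
  assumes "continuous_on UNIV f" "AE x in lborel. f x = 0"
  shows "f x = 0"
proof -
  have "open {x. f x \<noteq> 0}"
    using assms(1) by (intro open_Collect_neq continuous_intros)
  moreover have "negligible {x. f x \<noteq> 0}"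
  proof -
    have "{x. f x \<noteq> 0} \<in> null_sets lborel"
      using assms(2) \<open>open {x. f x \<noteq> 0}\<close> by (subst AE_iff_null_sets) auto
    then show ?thesis
      by (simp add: negligible_iff_null_sets null_sets_completionI)
  qed
  ultimately have "{x. f x \<noteq> 0} = {}" using open_not_negligible by blast
  then show ?thesis by blast
qed

text \<open>The hypotheses make \<open>g\<close> orthogonal to every trigonometric polynomial
  \<open>p\<close>. If \<open>p\<close> is uniformly within \<open>e\<close> of \<open>g\<close> on
  the support ball, then the integral of \<open>g * g\<close> equals that of
  \<open>(g - p) * g\<close>, which is at most \<open>e\<close> times the integral of
  \<open>|g|\<close>. Compact support makes uniform approximation on a ball enough.\<close>

lemma fourier_injective_real:
  fixes g :: "'a::euclidean_space \<Rightarrow> real"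
  assumes g: "continuous_on UNIV g" "supported_in_ball R g"
    and c: "\<And>\<xi>. (LINT x|lborel. cos (\<xi> \<bullet> x) * g x) = 0"
    and s: "\<And>\<xi>. (LINT x|lborel. sin (\<xi> \<bullet> x) * g x) = 0"
  shows "g x = 0"
proof -
  have int: "integrable lborel (\<lambda>x. p x * g x)" if "continuous_on UNIV p" for p
    using that by (intro integrable_supported_in_ball[of _ R] continuous_intros g supported_in_ball_mult(1))
  have intg: "integrable lborel (\<lambda>x. \<bar>g x\<bar>)"
    using integrable_supported_in_ball[OF g] by (rule integrable_abs)
  have zero: "(LINT x|lborel. p x * g x) = 0" if "trig_poly p" for p
    using that
  proof (induction rule: trig_poly.induct)
    case (add p q)
    have "(LINT x|lborel. (p x + q x) * g x) = (LINT x|lborel. p x * g x) + (LINT x|lborel. q x * g x)"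
      unfolding distrib_right
      by (intro Bochner_Integration.integral_add int trig_poly_continuous add)
    then show ?case using add by simp
  qed (simp_all add: c s mult.assoc)
  have le: "(LINT x|lborel. g x * g x) \<le> e * (LINT x|lborel. \<bar>g x\<bar>)" if "e > 0" for e
  proof -
    have "\<exists>p. trig_poly p \<and> (\<forall>x\<in>cball 0 R. \<bar>g x - p x\<bar> < e)"
    proof (rule Stone_Weierstrass_HOL)
      show "trig_poly (\<lambda>x. c)" for c :: real using trig_poly.cos[of c 0] by simp
      show "continuous_on (cball 0 R) f" if "trig_poly f" for f :: "'a \<Rightarrow> real"
        by (rule trig_poly_continuous[OF that])
      show "\<exists>f. trig_poly f \<and> f x \<noteq> f y" if xy: "x \<in> cball 0 R \<and> y \<in> cball 0 R \<and> x \<noteq> y" for x y :: 'a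
      proof -
        define v where "v = x - y"
        have "v \<bullet> v > 0" using xy by (simp add: v_def)
        \<comment> \<open>The scaling makes the phases at \<open>x\<close> and \<open>y\<close>
          differ by exactly \<open>pi / 2\<close>; a quarter turn cannot preserve both the cosine
          and the sine.\<close>
        define \<xi> where "\<xi> = (pi / 2 / (v \<bullet> v)) *\<^sub>R v"
        have *: "\<xi> \<bullet> x = \<xi> \<bullet> y + pi / 2"
        proof -
          have "\<xi> \<bullet> x - \<xi> \<bullet> y = \<xi> \<bullet> v" by (simp add: v_def inner_diff_right)
          also have "\<dots> = pi / 2" using \<open>v \<bullet> v > 0\<close> by (simp add: \<xi>_def)
          finally show ?thesis by simp
        qed
        have "cos (\<xi> \<bullet> x) \<noteq> cos (\<xi> \<bullet> y) \<or> sin (\<xi> \<bullet> x) \<noteq> sin (\<xi> \<bullet> y)"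
        proof (rule ccontr)
          assume "\<not> ?thesis"
          then have "- sin (\<xi> \<bullet> y) = cos (\<xi> \<bullet> y)" "cos (\<xi> \<bullet> y) = sin (\<xi> \<bullet> y)"
            unfolding * by (simp_all add: cos_add sin_add)
          then show False using sin_cos_squared_add[of "\<xi> \<bullet> y"] by simp
        qed
        moreover have "trig_poly (\<lambda>x. cos (\<xi> \<bullet> x))" "trig_poly (\<lambda>x. sin (\<xi> \<bullet> x))"
          using trig_poly.cos[of 1 \<xi>] trig_poly.sin[of 1 \<xi>] by simp_all
        ultimately show ?thesis by blast
      qed
    qed (use g(1) \<open>e > 0\<close> in \<open>auto intro: trig_poly.add trig_poly_mult continuous_on_subset\<close>)
    then obtain p where p: "trig_poly p" "\<And>x. x \<in> cball 0 R \<Longrightarrow> \<bar>g x - p x\<bar> < e" by blast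
    have "(LINT x|lborel. g x * g x) = (LINT x|lborel. g x * g x) - (LINT x|lborel. p x * g x)"
      using zero[OF p(1)] by simp
    also have "\<dots> = (LINT x|lborel. g x * g x - p x * g x)"
      by (intro Bochner_Integration.integral_diff[symmetric] int g trig_poly_continuous p)
    also have "\<dots> \<le> (LINT x|lborel. e * \<bar>g x\<bar>)"
    proof (rule integral_mono)
      show "integrable lborel (\<lambda>x. g x * g x - p x * g x)"
        by (intro Bochner_Integration.integrable_diff int g trig_poly_continuous p)
      fix x
      show "g x * g x - p x * g x \<le> e * \<bar>g x\<bar>"
      proof (cases "x \<in> cball 0 R")
        case True
        have "g x * g x - p x * g x = (g x - p x) * g x" by (simp add: algebra_simps)
        also have "\<dots> \<le> \<bar>g x - p x\<bar> * \<bar>g x\<bar>" by (metis abs_ge_self abs_mult)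
        also have "\<dots> \<le> e * \<bar>g x\<bar>" using p(2)[OF True] by (intro mult_right_mono) auto
        finally show ?thesis .
      next
        case False
        then show ?thesis using g(2) by (simp add: supported_in_ball_def)
      qed
    qed (use intg in auto)
    finally show ?thesis by simp
  qed
  have "(LINT x|lborel. g x * g x) \<le> 0"
  proof (rule field_le_epsilon)
    fix e :: real assume "e > 0"
    let ?I = "LINT x|lborel. \<bar>g x\<bar>"
    have "?I \<ge> 0" by simp
    then have "?I + 1 > 0" by linarith
    \<comment> \<open>The summand 1 in the denominator covers the case where the integral of
      \<open>|g|\<close> is 0.\<close>
    have "(LINT x|lborel. g x * g x) \<le> e / (?I + 1) * ?I"
      using \<open>e > 0\<close> \<open>?I \<ge> 0\<close> \<open>?I + 1 > 0\<close> by (intro le divide_pos_pos)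
    also have "\<dots> \<le> e" using \<open>e > 0\<close> \<open>?I + 1 > 0\<close> by (simp add: field_simps)
    finally show "(LINT x|lborel. g x * g x) \<le> 0 + e" by simp
  qed
  moreover have "(LINT x|lborel. g x * g x) \<ge> 0" by simp
  ultimately have "AE x in lborel. g x * g x = 0"
    using integral_nonneg_eq_0_iff_AE[OF int[OF g(1)]] by simp
  then have "AE x in lborel. g x = 0" by simp
  then show ?thesis by (rule continuous_AE_zero_imp_zero[OF g(1)])
qed

text \<open>The frequencies \<open>\<xi>\<close> and \<open>- \<xi>\<close> together give the cosine
  and sine integrals, after which real and imaginary parts separate.\<close>

lemma fourier_injective:
  fixes f :: "'a::euclidean_space \<Rightarrow> complex"
  assumes f: "continuous_on UNIV f" "supported_in_ball R f"
    and 0: "\<And>\<xi>. (LINT x|lborel. exp (- \<i> * of_real (\<xi> \<bullet> x)) * f x) = 0"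
  shows "f x = 0"
proof -
  define E where "E = (\<lambda>(\<xi>::'a) x. cis (- (\<xi> \<bullet> x)))"
  have E: "exp (- \<i> * of_real (\<xi> \<bullet> x)) = E \<xi> x" for \<xi> x
    by (simp add: E_def cis_conv_exp)
  have E0: "(LINT x|lborel. E \<xi> x * f x) = 0" for \<xi>
    using 0[of \<xi>] by (simp only: E)
  have contE: "continuous_on UNIV (E \<xi>)" for \<xi>
    unfolding E_def cis_conv_exp by (intro continuous_intros)
  have int: "integrable lborel (\<lambda>x. p x * f x)" if "continuous_on UNIV p" for p
    using that by (intro integrable_supported_in_ball[of _ R] continuous_intros f supported_in_ball_mult(1))
  have cos: "(LINT x|lborel. of_real (cos (\<xi> \<bullet> x)) * f x) = 0" for \<xi>
  proof -
    have "of_real (cos (\<xi> \<bullet> x)) * f x = (1/2) * (E \<xi> x * f x) + (1/2) * (E (-\<xi>) x * f x)" for x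
    proof -
      have "complex_of_real (cos (\<xi> \<bullet> x)) = (1/2) * E \<xi> x + (1/2) * E (-\<xi>) x"
        by (simp add: E_def complex_eq_iff)
      then show ?thesis by (simp only: distrib_right mult.assoc)
    qed
    then show ?thesis
      using E0 int[OF contE] by (simp only:) (subst Bochner_Integration.integral_add, auto)
  qed
  have sin: "(LINT x|lborel. of_real (sin (\<xi> \<bullet> x)) * f x) = 0" for \<xi>
  proof -
    have "of_real (sin (\<xi> \<bullet> x)) * f x = (\<i>/2) * (E \<xi> x * f x) + (-\<i>/2) * (E (-\<xi>) x * f x)" for x
    proof -
      have "complex_of_real (sin (\<xi> \<bullet> x)) = (\<i>/2) * E \<xi> x + (-\<i>/2) * E (-\<xi>) x"
        by (simp add: E_def complex_eq_iff)
      then show ?thesis by (simp only: distrib_right mult.assoc)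
    qed
    then show ?thesis
      using E0 int[OF contE] by (simp only:) (subst Bochner_Integration.integral_add, auto)
  qed
  have *: "Re (LINT x|lborel. of_real (h x) * f x) = (LINT x|lborel. h x * Re (f x))"
    "Im (LINT x|lborel. of_real (h x) * f x) = (LINT x|lborel. h x * Im (f x))"
    if "continuous_on UNIV h" for h
    using int[of "\<lambda>x. of_real (h x)"] that
    by (auto simp: integral_Re[symmetric] integral_Im[symmetric] intro!: continuous_intros)
  have cont: "continuous_on UNIV (\<lambda>x. cos (\<xi> \<bullet> x))" "continuous_on UNIV (\<lambda>x. sin (\<xi> \<bullet> x))" for \<xi> :: 'a
    by (intro continuous_intros)+
  have "Re (f x) = 0"
    by (rule fourier_injective_real[of "\<lambda>x. Re (f x)" R])
       (use f *[OF cont(1)] *[OF cont(2)] cos sin in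
         \<open>auto intro!: continuous_intros simp: supported_in_ball_def\<close>)
  moreover have "Im (f x) = 0"
    by (rule fourier_injective_real[of "\<lambda>x. Im (f x)" R])
       (use f *[OF cont(1)] *[OF cont(2)] cos sin in
         \<open>auto intro!: continuous_intros simp: supported_in_ball_def\<close>)
  ultimately show ?thesis by (simp add: complex_eq_iff)
qed

section \<open>Integrals of radial functions\<close>

text \<open>Finite measures on the line are determined by the half-lines \<open>{a<..}\<close>. For
  \<open>0 \<le> a \<le> R\<close> both sides give the volume of a shell,
  \<open>4/3 * pi * (R^3 - a^3)\<close>.\<close>

lemma distr_norm_ball:
  assumes "R > 0"
  shows "distr (density lborel (indicator (cball (0::real^3) R))) borel norm
    = density lborel (\<lambda>r. ennreal (4 * pi * r^2) * indicator {0..R} r)" (is "?M = ?N")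
proof (rule measure_eqI_lessThan)
  have vol: "emeasure lborel (cball (0::real^3) r) = ennreal (4/3 * pi * r^3)" if "r \<ge> 0" for r
    using that by (simp add: emeasure_cball unit_ball_vol_3)
  have M: "emeasure ?M {a<..} = emeasure lborel (cball (0::real^3) R - {x. norm x \<le> a})" for a
  proof -
    have meas: "norm -` {a<..} \<in> sets (borel :: (real^3) measure)" "indicator (cball (0::real^3) R) \<in> borel_measurable borel"
      using measurable_sets_borel[of norm borel "{a<..}"] by (auto intro!: borel_measurable_indicator)
    have "emeasure ?M {a<..} = (\<integral>\<^sup>+x. indicator (cball (0::real^3) R) x * indicator (norm -` {a<..}) x \<partial>lborel)"
      using meas by (subst emeasure_distr) (auto intro!: emeasure_density)
    also have "\<dots> = (\<integral>\<^sup>+x. indicator (cball (0::real^3) R - {x. norm x \<le> a}) x \<partial>lborel)"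
      by (intro nn_integral_cong) (auto simp: indicator_def)
    also have "\<dots> = emeasure lborel (cball (0::real^3) R - {x. norm x \<le> a})"
      by (intro nn_integral_indicator) auto
    finally show ?thesis .
  qed
  have int: "(\<integral>\<^sup>+r. ennreal (4 * pi * r^2) * indicator {a..R} r \<partial>lborel)
      = ennreal (4/3 * pi * R^3 - 4/3 * pi * a^3)" if "a \<le> R" for a
    using that by (intro nn_integral_FTC_Icc) (auto intro!: derivative_eq_intros)
  have N: "emeasure ?N {a<..} = (\<integral>\<^sup>+r. ennreal (4 * pi * r^2) * indicator ({0..R} \<inter> {a<..}) r \<partial>lborel)" for a
    by (subst emeasure_density) (auto intro!: nn_integral_cong simp: indicator_def)
  fix a
  show "emeasure ?M {a<..} < \<infinity>"
  proof -
    have "emeasure ?M {a<..} \<le> emeasure lborel (cball (0::real^3) R)"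
      unfolding M by (intro emeasure_mono) auto
    also have "\<dots> < \<infinity>" using emeasure_bounded_finite[OF bounded_cball] by simp
    finally show ?thesis .
  qed
  consider "a < 0" | "0 \<le> a" "a \<le> R" | "R < a" by linarith
  then show "emeasure ?M {a<..} = emeasure ?N {a<..}"
  proof cases
    case 1
    then have "\<not> norm x \<le> a" for x :: "real^3" using norm_ge_zero[of x] by linarith
    with 1 have *: "{x::real^3. norm x \<le> a} = {}" "{0..R} \<inter> {a<..} = {0..R}" by auto
    have "4/3 * pi * R^3 - 4/3 * pi * 0^3 = 4/3 * pi * R^3" by simp
    then have "(\<integral>\<^sup>+r. ennreal (4 * pi * r^2) * indicator {0..R} r \<partial>lborel) = ennreal (4/3 * pi * R^3)"
      using int[OF less_imp_le[OF \<open>R > 0\<close>]] by metis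
    then show ?thesis
      unfolding M N * Diff_empty vol[OF less_imp_le[OF \<open>R > 0\<close>]] by metis
  next
    case 2
    \<comment> \<open>The half-line is open at \<open>a\<close>, while the interval integrated by
      the fundamental theorem is closed; they differ by a null set.\<close>
    have eqN: "(\<integral>\<^sup>+r. ennreal (4 * pi * r^2) * indicator ({0..R} \<inter> {a<..}) r \<partial>lborel)
        = (\<integral>\<^sup>+r. ennreal (4 * pi * r^2) * indicator {a..R} r \<partial>lborel)"
    proof (rule nn_integral_cong_AE)
      show "AE r in lborel. ennreal (4 * pi * r^2) * indicator ({0..R} \<inter> {a<..}) r
          = ennreal (4 * pi * r^2) * indicator {a..R} r"
        using AE_lborel_singleton[of a]
      proof eventually_elim
        fix r assume "r \<noteq> a"
        then have "r \<in> {0..R} \<inter> {a<..} \<longleftrightarrow> r \<in> {a..R}" using 2 by auto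
        then show "ennreal (4 * pi * r^2) * indicator ({0..R} \<inter> {a<..}) r
          = ennreal (4 * pi * r^2) * indicator {a..R} r" unfolding indicator_def by (simp only:)
      qed
    qed
    have ball: "{x::real^3. norm x \<le> a} = cball 0 a" by auto
    have "emeasure lborel (cball (0::real^3) R - cball 0 a)
        = emeasure lborel (cball (0::real^3) R) - emeasure lborel (cball (0::real^3) a)"
      using 2 vol[of a] by (intro emeasure_Diff) auto
    also have "\<dots> = ennreal (4/3 * pi * R^3) - ennreal (4/3 * pi * a^3)"
      using 2 \<open>R > 0\<close> by (simp only: vol less_imp_le)
    also have "\<dots> = ennreal (4/3 * pi * R^3 - 4/3 * pi * a^3)"
      using 2 by (intro ennreal_minus) simp
    finally show ?thesis
      unfolding M N ball eqN int[OF 2(2)] .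
  next
    case 3
    then have *: "cball 0 R - {x::real^3. norm x \<le> a} = {}" "{0..R} \<inter> {a<..} = {}" by auto
    then show ?thesis unfolding M N * by simp
  qed
qed auto

lemma
  fixes f :: "real \<Rightarrow> real"
  assumes [measurable]: "f \<in> borel_measurable borel" and "R > 0"
  shows integral_radial: "(LINT x|lborel. indicator (cball (0::real^3) R) x * f (norm x))
      = (LINT r|lborel. indicator {0..R} r * (4 * pi * r^2 * f r))"
    and integrable_radial: "integrable lborel (\<lambda>x::real^3. indicator (cball 0 R) x * f (norm x))
      \<longleftrightarrow> integrable lborel (\<lambda>r. indicator {0..R} r * (4 * pi * r^2 * f r))"
proof -
  let ?M = "density lborel (indicator (cball (0::real^3) R))"
  let ?N = "density lborel (\<lambda>r. ennreal (indicator {0..R} r * (4 * pi * r^2)))"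
  have eq: "distr ?M borel norm = ?N"
    using distr_norm_ball[OF \<open>R > 0\<close>]
    by (auto simp: ennreal_mult' ennreal_indicator mult.commute indicator_def intro!: density_cong)
  have [measurable]: "cball (0::real^3) R \<in> sets borel" by simp
  have M: "?M = density lborel (\<lambda>x. ennreal (indicator (cball (0::real^3) R) x))"
    by (simp add: ennreal_indicator)
  show "(LINT x|lborel. indicator (cball (0::real^3) R) x * f (norm x))
      = (LINT r|lborel. indicator {0..R} r * (4 * pi * r^2 * f r))"
  proof -
    have "(LINT x|lborel. indicator (cball (0::real^3) R) x * f (norm x)) = (LINT x|?M. f (norm x))"
      unfolding M by (subst integral_density) auto
    also have "\<dots> = (LINT r|distr ?M borel norm. f r)"
      by (subst integral_distr) auto
    also have "\<dots> = (LINT r|lborel. indicator {0..R} r * (4 * pi * r^2) * f r)"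
      unfolding eq by (subst integral_density) auto
    finally show ?thesis by (simp add: mult.assoc)
  qed
  show "integrable lborel (\<lambda>x::real^3. indicator (cball 0 R) x * f (norm x))
      \<longleftrightarrow> integrable lborel (\<lambda>r. indicator {0..R} r * (4 * pi * r^2 * f r))"
  proof -
    have "integrable lborel (\<lambda>x::real^3. indicator (cball 0 R) x * f (norm x)) \<longleftrightarrow> integrable ?M (\<lambda>x. f (norm x))"
      unfolding M by (subst integrable_density) auto
    also have "\<dots> \<longleftrightarrow> integrable (distr ?M borel norm) f"
      by (subst integrable_distr_eq) auto
    also have "\<dots> \<longleftrightarrow> integrable lborel (\<lambda>r. indicator {0..R} r * (4 * pi * r^2) * f r)"
      unfolding eq by (subst integrable_density) auto
    finally show ?thesis by (simp add: mult.assoc)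
  qed
qed

text \<open>In polar coordinates the factor \<open>r^2\<close> absorbs \<open>1 / r^p\<close>, up to
  the single point \<open>r = 0\<close>.\<close>

lemma integrable_norm_inverse_power:
  assumes "p \<le> 2"
  shows "integrable lborel (\<lambda>x::real^3. indicator (cball 0 R) x * (1 / norm x ^ p) :: real)"
proof (cases "R > 0")
  case True
  have "integrable lborel (\<lambda>r. indicator {0..R} r *\<^sub>R (4 * pi * r ^ (2 - p)) :: real)"
    by (intro borel_integrable_compact continuous_intros) auto
  moreover have "AE r in lborel. indicator {0..R} r *\<^sub>R (4 * pi * r ^ (2 - p))
      = indicator {0..R} r * (4 * pi * r^2 * (1 / r ^ p))"
    using AE_lborel_singleton[of 0] by eventually_elim (use assms in \<open>auto simp: power_diff\<close>)
  ultimately show ?thesis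
    by (subst integrable_radial[of "\<lambda>r. 1 / r ^ p", OF _ True])
       (auto elim!: integrable_cong_AE_imp)
next
  case False
  have [measurable]: "cball (0::real^3) R \<in> sets borel" by simp
  have "AE x::real^3 in lborel. 0 = (indicator (cball 0 R) x * (1 / norm x ^ p) :: real)"
    using AE_lborel_singleton[of "0::real^3"]
  proof eventually_elim
    fix x :: "real^3" assume "x \<noteq> 0"
    then have "0 < norm x" by simp
    with False have "R < norm x" by linarith
    then have "x \<notin> cball 0 R" by simp
    then show "0 = (indicator (cball 0 R) x * (1 / norm x ^ p) :: real)" by simp
  qed
  moreover have "(\<lambda>x::real^3. indicator (cball 0 R) x * (1 / norm x ^ p) :: real) \<in> borel_measurable lborel"
    by measurable
  ultimately show ?thesis
    by (rule integrable_cong_AE_imp[OF integrable_zero, rotated])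
qed

section \<open>The fundamental solution\<close>

text \<open>On the convex left half-plane the derivative of \<open>exp\<close> has norm at most
  1.\<close>

lemma norm_exp_diff_1_le:
  fixes w :: complex
  assumes "Re w \<le> 0"
  shows "norm (exp w - 1) \<le> norm w"
proof -
  have "norm (exp w - exp 0) \<le> 1 * norm (w - 0)"
  proof (rule field_differentiable_bound[where S="{z. Re z \<le> 0}" and f'=exp])
    show "convex {z. Re z \<le> 0}" by (rule convex_halfspace_Re_le)
  qed (use assms in \<open>auto intro!: derivative_eq_intros\<close>)
  then show ?thesis by simp
qed

text \<open>The Newton-type kernel \<open>e\<^sup>a\<^sup>|\<^sup>z\<^sup>| / |z|\<close> is made smooth by replacing \<open>|z|\<close> with \<open>(|z|\<^sup>2 + \<epsilon>\<^sup>2)\<^sup>1\<^sup>/\<^sup>2\<close>.\<close>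

definition reg_norm :: "real \<Rightarrow> real^3 \<Rightarrow> real"
  where "reg_norm \<epsilon> z = sqrt (norm z ^ 2 + \<epsilon>^2)"

lemma reg_norm_facts:
  assumes "\<epsilon> > 0"
  shows "reg_norm \<epsilon> z > 0" "norm z \<le> reg_norm \<epsilon> z" "\<epsilon> \<le> reg_norm \<epsilon> z"
    "reg_norm \<epsilon> z ^ 2 = norm z ^ 2 + \<epsilon>^2"
proof -
  show *: "reg_norm \<epsilon> z > 0"
    using assms unfolding reg_norm_def by (intro real_sqrt_gt_zero add_nonneg_pos) auto
  show sq: "reg_norm \<epsilon> z ^ 2 = norm z ^ 2 + \<epsilon>^2"
    unfolding reg_norm_def by (intro real_sqrt_pow2) auto
  show "norm z \<le> reg_norm \<epsilon> z" "\<epsilon> \<le> reg_norm \<epsilon> z"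
    unfolding reg_norm_def by (intro real_le_rsqrt; simp)+
qed

lemma continuous_on_reg_norm [continuous_intros]: "continuous_on S (reg_norm \<epsilon>)"
  unfolding reg_norm_def by (intro continuous_intros)

lemma reg_norm_deriv:
  assumes "\<epsilon> > 0"
  shows "((\<lambda>t. reg_norm \<epsilon> (z + t *\<^sub>R axis j 1)) has_real_derivative z $ j / reg_norm \<epsilon> z) (at 0)"
proof -
  have *: "norm (z + t *\<^sub>R axis j 1) ^ 2 = norm z ^ 2 + 2 * t * (z $ j) + t^2" for t
    unfolding power2_norm_eq_inner
    by (simp add: inner_add_left inner_add_right inner_axis inner_axis' power2_eq_square algebra_simps)
  have "norm z ^ 2 + \<epsilon>^2 > 0" using assms by (simp add: add_nonneg_pos)
  then show ?thesis unfolding reg_norm_def *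
    by (auto intro!: derivative_eq_intros simp: field_simps)
qed

lemma has_vector_derivative_reg_norm:
  assumes "\<epsilon> > 0" "\<And>w. w \<noteq> 0 \<Longrightarrow> (H has_field_derivative H' w) (at w)"
  shows "((\<lambda>t. H (of_real (reg_norm \<epsilon> (z + t *\<^sub>R axis j 1)))) has_vector_derivative
    of_real (z $ j / reg_norm \<epsilon> z) * H' (of_real (reg_norm \<epsilon> z))) (at 0)"
proof -
  have 1: "((\<lambda>t. reg_norm \<epsilon> (z + t *\<^sub>R axis j 1)) has_vector_derivative z $ j / reg_norm \<epsilon> z) (at 0)"
    using reg_norm_deriv[OF assms(1)] by (simp add: has_real_derivative_iff_has_vector_derivative)
  have 2: "((\<lambda>s. H (of_real s)) has_vector_derivative H' (of_real (reg_norm \<epsilon> z))) (at (reg_norm \<epsilon> z))"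
    by (intro has_vector_derivative_real_field assms(2)) (use reg_norm_facts(1)[OF assms(1), of z] in simp)
  show ?thesis
    using vector_diff_chain_at[OF 1, of "\<lambda>s. H (of_real s)" "H' (of_real (reg_norm \<epsilon> z))"] 2
    by (simp add: o_def scaleR_conv_of_real)
qed

text \<open>Write \<open>s\<close> for \<open>reg_norm \<epsilon> z\<close>,
  \<open>H w = exp (a * w) / w\<close> and \<open>K w = H' w / w\<close>. Since \<open>s\<close> has
  partial derivative \<open>z $ j / s\<close>, the derivatives of \<open>H s\<close> are
  \<open>z $ j * K s\<close> and then \<open>K s + (z $ j)^2 * K' s / s\<close>.\<close>

lemma reg_kernel_deriv:
  assumes "\<epsilon> > 0"
  shows "dir_deriv j (\<lambda>z. exp (a * of_real (reg_norm \<epsilon> z)) / of_real (reg_norm \<epsilon> z))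
    (\<lambda>z. of_real (z $ j) * ((a / of_real (reg_norm \<epsilon> z)^2 - 1 / of_real (reg_norm \<epsilon> z)^3)
      * exp (a * of_real (reg_norm \<epsilon> z))))"
    (is "dir_deriv j ?\<Phi> ?\<Phi>1")
    and "dir_deriv j (\<lambda>z. of_real (z $ j) * ((a / of_real (reg_norm \<epsilon> z)^2 - 1 / of_real (reg_norm \<epsilon> z)^3)
      * exp (a * of_real (reg_norm \<epsilon> z))))
    (\<lambda>z. (a / of_real (reg_norm \<epsilon> z)^2 - 1 / of_real (reg_norm \<epsilon> z)^3) * exp (a * of_real (reg_norm \<epsilon> z))
      + of_real (z $ j ^ 2) * ((a^2 / of_real (reg_norm \<epsilon> z)^3 - 3 * a / of_real (reg_norm \<epsilon> z)^4
        + 3 / of_real (reg_norm \<epsilon> z)^5) * exp (a * of_real (reg_norm \<epsilon> z))))"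
proof -
  have H: "((\<lambda>w. exp (a * w) / w) has_field_derivative (a / w - 1 / w^2) * exp (a * w)) (at w)"
    if "w \<noteq> 0" for w :: complex
    using that by (auto intro!: derivative_eq_intros simp: field_simps power2_eq_square)
  have K: "((\<lambda>w. (a / w^2 - 1 / w^3) * exp (a * w)) has_field_derivative
      (a^2 / w^2 - 3 * a / w^3 + 3 / w^4) * exp (a * w)) (at w)" if "w \<noteq> 0" for w :: complex
  proof -
    have 1: "((\<lambda>w. a / w^2 - 1 / w^3) has_field_derivative (3 / w^4 - 2 * a / w^3)) (at w)"
    proof -
      have "((\<lambda>w. a / w^2 - 1 / w^3) has_field_derivative
          ((0 * w^2 - a * (2 * w)) / (w^2 * w^2) - (0 * w^3 - 1 * (3 * w^2)) / (w^3 * w^3))) (at w)"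
        using that by (intro DERIV_diff DERIV_divide DERIV_const)
          (auto intro!: derivative_eq_intros)
      also have "(0 * w^2 - a * (2 * w)) / (w^2 * w^2) - (0 * w^3 - 1 * (3 * w^2)) / (w^3 * w^3)
          = 3 / w^4 - 2 * a / w^3"
        using that by (simp add: divide_simps) (simp add: algebra_simps power_numeral_reduce)
      finally show ?thesis .
    qed
    have 2: "((\<lambda>w. exp (a * w)) has_field_derivative a * exp (a * w)) (at w)"
      by (auto intro!: derivative_eq_intros)
    have "(3 / w^4 - 2 * a / w^3) * exp (a * w) + a * exp (a * w) * (a / w^2 - 1 / w^3)
        = (a^2 / w^2 - 3 * a / w^3 + 3 / w^4) * exp (a * w)"
      using that by (simp add: divide_simps) (simp add: algebra_simps power_numeral_reduce)
    with DERIV_mult[OF 1 2] show ?thesis by simp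
  qed
  show "dir_deriv j ?\<Phi> ?\<Phi>1"
    unfolding dir_deriv_def
  proof
    fix z :: "real^3"
    have "reg_norm \<epsilon> z \<noteq> 0" using reg_norm_facts(1)[OF assms, of z] by simp
    then have "of_real (z $ j / reg_norm \<epsilon> z) * ((a / of_real (reg_norm \<epsilon> z) - 1 / of_real (reg_norm \<epsilon> z)^2)
        * exp (a * of_real (reg_norm \<epsilon> z))) = ?\<Phi>1 z"
      by (simp add: field_simps power2_eq_square power3_eq_cube)
    then show "((\<lambda>t. ?\<Phi> (z + t *\<^sub>R axis j 1)) has_vector_derivative ?\<Phi>1 z) (at 0)"
      using has_vector_derivative_reg_norm[OF assms H, of z j] by simp
  qed
  show "dir_deriv j ?\<Phi>1 (\<lambda>z. (a / of_real (reg_norm \<epsilon> z)^2 - 1 / of_real (reg_norm \<epsilon> z)^3) * exp (a * of_real (reg_norm \<epsilon> z))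
      + of_real (z $ j ^ 2) * ((a^2 / of_real (reg_norm \<epsilon> z)^3 - 3 * a / of_real (reg_norm \<epsilon> z)^4
        + 3 / of_real (reg_norm \<epsilon> z)^5) * exp (a * of_real (reg_norm \<epsilon> z))))" (is "dir_deriv j _ ?\<Phi>2")
    unfolding dir_deriv_def
  proof
    fix z :: "real^3"
    let ?K = "\<lambda>w. (a / w^2 - 1 / w^3) * exp (a * w)"
    have nz: "reg_norm \<epsilon> z \<noteq> 0" using reg_norm_facts(1)[OF assms, of z] by simp
    have 1: "((\<lambda>t. complex_of_real ((z + t *\<^sub>R axis j 1) $ j)) has_vector_derivative 1) (at 0)"
      by (auto intro!: derivative_eq_intros has_vector_derivative_real_field[of "\<lambda>t. of_real (z $ j) + t"])
    have "of_real (z $ j) * (of_real (z $ j / reg_norm \<epsilon> z) * ((a^2 / of_real (reg_norm \<epsilon> z)^2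
          - 3 * a / of_real (reg_norm \<epsilon> z)^3 + 3 / of_real (reg_norm \<epsilon> z)^4) * exp (a * of_real (reg_norm \<epsilon> z))))
        + 1 * ?K (of_real (reg_norm \<epsilon> z)) = ?\<Phi>2 z"
      using nz by (simp add: divide_simps) (simp add: algebra_simps power_numeral_reduce)
    then show "((\<lambda>t. ?\<Phi>1 (z + t *\<^sub>R axis j 1)) has_vector_derivative ?\<Phi>2 z) (at 0)"
      using has_vector_derivative_mult[OF 1 has_vector_derivative_reg_norm[OF assms K, of z j]]
      by (simp add: add.commute)
  qed
qed

text \<open>Summing the second derivatives produces \<open>norm z ^ 2 = s^2 - \<epsilon>^2\<close>,
  with \<open>s\<close> the regularised norm. The part with \<open>s^2\<close> combines to exactly
  \<open>a^2\<close> times the kernel; the part with \<open>\<epsilon>^2\<close> is the remainder on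
  the right, which concentrates at the origin as \<open>\<epsilon>\<close> tends to 0.\<close>

lemma reg_kernel_laplacian:
  assumes "\<epsilon> > 0" "test_function \<psi>"
  shows "(LINT z|lborel. exp (a * of_real (reg_norm \<epsilon> z)) / of_real (reg_norm \<epsilon> z) * (laplacian \<psi> z - a^2 * \<psi> z))
    = - (LINT z|lborel. of_real (\<epsilon>^2) * (a^2 / of_real (reg_norm \<epsilon> z)^3 - 3 * a / of_real (reg_norm \<epsilon> z)^4
        + 3 / of_real (reg_norm \<epsilon> z)^5) * exp (a * of_real (reg_norm \<epsilon> z)) * \<psi> z)"
proof -
  have nz: "reg_norm \<epsilon> z \<noteq> 0" for z using reg_norm_facts(1)[OF assms(1), of z] by simp
  define \<Phi> where "\<Phi> = (\<lambda>z. exp (a * of_real (reg_norm \<epsilon> z)) / of_real (reg_norm \<epsilon> z))"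
  define \<Phi>1 where "\<Phi>1 = (\<lambda>(j::3) z. of_real (z $ j) * ((a / of_real (reg_norm \<epsilon> z)^2 - 1 / of_real (reg_norm \<epsilon> z)^3)
      * exp (a * of_real (reg_norm \<epsilon> z))))"
  define \<Phi>2 where "\<Phi>2 = (\<lambda>(j::3) z. (a / of_real (reg_norm \<epsilon> z)^2 - 1 / of_real (reg_norm \<epsilon> z)^3) * exp (a * of_real (reg_norm \<epsilon> z))
      + of_real (z $ j ^ 2) * ((a^2 / of_real (reg_norm \<epsilon> z)^3 - 3 * a / of_real (reg_norm \<epsilon> z)^4
        + 3 / of_real (reg_norm \<epsilon> z)^5) * exp (a * of_real (reg_norm \<epsilon> z))))"
  define L where "L = (\<lambda>z. of_real (\<epsilon>^2) * (a^2 / of_real (reg_norm \<epsilon> z)^3 - 3 * a / of_real (reg_norm \<epsilon> z)^4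
        + 3 / of_real (reg_norm \<epsilon> z)^5) * exp (a * of_real (reg_norm \<epsilon> z)))"
  have c\<Phi>: "continuous_on UNIV \<Phi>" and cL: "continuous_on UNIV L"
    unfolding \<Phi>_def L_def by (auto intro!: continuous_intros simp: nz)
  have c1: "continuous_on UNIV (\<Phi>1 j)" and c2: "continuous_on UNIV (\<Phi>2 j)" for j
    unfolding \<Phi>1_def \<Phi>2_def by (auto intro!: continuous_intros simp: nz)
  have sum: "(\<Sum>j\<in>UNIV. \<Phi>2 j z) = a^2 * \<Phi> z - L z" for z
  proof -
    let ?s = "complex_of_real (reg_norm \<epsilon> z)" and ?E = "exp (a * of_real (reg_norm \<epsilon> z))"
    have "(\<Sum>j\<in>UNIV. complex_of_real (z $ j ^ 2)) = of_real (norm z ^ 2)"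
      by (simp add: norm_vec_def L2_set_def sum_nonneg)
    also have "norm z ^ 2 = reg_norm \<epsilon> z ^ 2 - \<epsilon>^2"
      using reg_norm_facts(4)[OF assms(1)] by simp
    finally have sq: "(\<Sum>j\<in>UNIV. complex_of_real (z $ j ^ 2)) = ?s^2 - of_real (\<epsilon>^2)" by simp
    have "(\<Sum>j\<in>UNIV. \<Phi>2 j z) = 3 * ((a / ?s^2 - 1 / ?s^3) * ?E)
        + (?s^2 - of_real (\<epsilon>^2)) * ((a^2 / ?s^3 - 3 * a / ?s^4 + 3 / ?s^5) * ?E)"
      unfolding \<Phi>2_def sum.distrib sum_distrib_right[symmetric] sq by simp
    also have "\<dots> = a^2 * \<Phi> z - L z"
    proof -
      have *: "?s \<noteq> 0" using nz[of z] by simp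
      have 1: "?s^2 * (a^2 / ?s^3 - 3 * a / ?s^4 + 3 / ?s^5) = a^2 / ?s - 3 * a / ?s^2 + 3 / ?s^3"
        using * by (simp add: field_simps power_numeral_reduce)
      have "3 * ((a / ?s^2 - 1 / ?s^3) * ?E) + (?s^2 - of_real (\<epsilon>^2)) * ((a^2 / ?s^3 - 3 * a / ?s^4 + 3 / ?s^5) * ?E)
        = (3 * (a / ?s^2 - 1 / ?s^3) + ?s^2 * (a^2 / ?s^3 - 3 * a / ?s^4 + 3 / ?s^5)) * ?E - L z"
        unfolding L_def by (simp only: algebra_simps)
      also have "3 * (a / ?s^2 - 1 / ?s^3) + ?s^2 * (a^2 / ?s^3 - 3 * a / ?s^4 + 3 / ?s^5) = a^2 / ?s"
        unfolding 1 by (simp add: algebra_simps)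
      finally show ?thesis by (simp add: \<Phi>_def)
    qed
    finally show ?thesis .
  qed
  have "(LINT z|lborel. \<Phi> z * laplacian \<psi> z) = (LINT z|lborel. (a^2 * \<Phi> z - L z) * \<psi> z)"
    unfolding sum[symmetric]
    by (rule integral_laplacian_by_parts[where ?u1.0=\<Phi>1, OF _ _ c\<Phi> c1 c2 assms(2)])
       (unfold \<Phi>_def \<Phi>1_def \<Phi>2_def, rule reg_kernel_deriv(1)[OF assms(1)], rule reg_kernel_deriv(2)[OF assms(1)])
  moreover have "integrable lborel (\<lambda>z. \<Phi> z * laplacian \<psi> z)" "integrable lborel (\<lambda>z. a^2 * (\<Phi> z * \<psi> z))"
    "integrable lborel (\<lambda>z. L z * \<psi> z)"
    by (intro integrable_mult_right test_function_mult_integrable c\<Phi> cL test_function_laplacian assms)+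
  ultimately have "(LINT z|lborel. \<Phi> z * laplacian \<psi> z - a^2 * (\<Phi> z * \<psi> z)) = - (LINT z|lborel. L z * \<psi> z)"
    by (simp add: left_diff_distrib mult.assoc)
  then show ?thesis
    unfolding \<Phi>_def L_def by (simp add: right_diff_distrib mult.left_commute)
qed

text \<open>The integrand is the most singular part of the remainder above. Its radial
  antiderivative is \<open>4 * pi * r^3 / sqrt (r^2 + \<epsilon>^2) ^ 3\<close>, so the mass tends
  to \<open>4 * pi\<close>, the constant of the fundamental solution.\<close>

lemma reg_kernel_mass:
  assumes "\<epsilon> > 0" "R > 0"
  shows "(LINT z|lborel. indicator (cball 0 R) z * (3 * \<epsilon>^2 / reg_norm \<epsilon> z ^ 5))
    = 4 * pi * R^3 / sqrt (R^2 + \<epsilon>^2) ^ 3"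
proof -
  define s where "s = (\<lambda>r. sqrt (r^2 + \<epsilon>^2))"
  have pos: "r^2 + \<epsilon>^2 > 0" for r :: real using assms(1) by (simp add: add_nonneg_pos)
  then have s: "s r > 0" "s r ^ 2 = r^2 + \<epsilon>^2" for r
    using less_imp_le[OF pos[of r]] by (simp_all add: s_def)
  have d: "(s has_real_derivative r / s r) (at r)" for r
    using pos[of r] unfolding s_def by (auto intro!: derivative_eq_intros simp: field_simps)
  have D: "((\<lambda>r. 4 * pi * r^3 / s r ^ 3) has_real_derivative 4 * pi * r^2 * (3 * \<epsilon>^2 / s r ^ 5)) (at r)" for r
  proof -
    have "((\<lambda>r. 4 * pi * r^3 / s r ^ 3) has_real_derivative
        (4 * pi * (3 * r^2) * s r ^ 3 - 4 * pi * r^3 * (3 * s r ^ 2 * (r / s r))) / (s r ^ 3 * s r ^ 3)) (at r)"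
      using s(1)[of r] by (intro DERIV_divide) (auto intro!: derivative_eq_intros d)
    also have "(4 * pi * (3 * r^2) * s r ^ 3 - 4 * pi * r^3 * (3 * s r ^ 2 * (r / s r))) / (s r ^ 3 * s r ^ 3)
        = 4 * pi * r^2 * 3 * (s r ^ 2 - r^2) / s r ^ 5"
      using s(1)[of r] by (simp add: divide_simps) (simp add: algebra_simps power_numeral_reduce)
    finally show ?thesis unfolding s(2) by (simp add: mult.assoc)
  qed
  have "(LINT z|lborel. indicator (cball (0::real^3) R) z * (3 * \<epsilon>^2 / sqrt (norm z ^ 2 + \<epsilon>^2) ^ 5))
      = (LINT r|lborel. indicator {0..R} r * (4 * pi * r^2 * (3 * \<epsilon>^2 / s r ^ 5)))"
    unfolding s_def by (rule integral_radial) (use assms in auto)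
  also have "\<dots> = (LINT r|lborel. (4 * pi * r^2 * (3 * \<epsilon>^2 / s r ^ 5)) * indicator {0..R} r)"
    by (simp only: mult.commute)
  also have "\<dots> = 4 * pi * R^3 / s R ^ 3 - 4 * pi * 0^3 / s 0 ^ 3"
  proof (rule integral_FTC_Icc_real)
    show "isCont (\<lambda>r. 4 * pi * r^2 * (3 * \<epsilon>^2 / s r ^ 5)) r" for r
      using s(1)[of r] DERIV_isCont[OF d] by (intro continuous_intros) auto
  qed (use assms D in auto)
  finally show ?thesis by (simp add: reg_norm_def s_def)
qed

text \<open>Only coordinate derivatives are bounded, so the point \<open>z\<close> is reached from 0
  by three moves along the axes.\<close>

lemma test_function_lipschitz_0:
  fixes \<psi> :: "real^3 \<Rightarrow> complex"
  assumes "test_function \<psi>"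
  obtains \<Lambda> where "\<Lambda> > 0" "\<And>z. norm (\<psi> z - \<psi> 0) \<le> \<Lambda> * norm z"
proof -
  have "\<exists>B>0. \<forall>x. norm (partial j \<psi> x) \<le> B" for j
  proof -
    have t: "test_function (partial j \<psi>)" by (rule test_function_partial[OF assms])
    then obtain R where R: "supported_in_ball R (partial j \<psi>)"
      by (auto simp: test_function_def compactly_supported_iff)
    obtain B where B: "B > 0" "\<And>x. norm (partial j \<psi> x) \<le> B * indicator (cball 0 R) x"
      using bounded_supported_in_ball[OF test_functionD(1)[OF t] R] by blast
    have "norm (partial j \<psi> x) \<le> B" for x
      using B(2)[of x] B(1) by (cases "x \<in> cball 0 R") (auto simp: indicator_def)
    then show ?thesis using B(1) by blast
  qed
  then obtain B where B: "\<And>j. B j > 0" "\<And>j x. norm (partial j \<psi> x) \<le> B j" by metis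
  have step: "norm (\<psi> (x + t *\<^sub>R axis j 1) - \<psi> x) \<le> B j * \<bar>t\<bar>" for x t j
    by (rule dir_deriv_bound[OF test_functionD(2)[OF assms] B(2)])
  have "norm (\<psi> z - \<psi> 0) \<le> (B 1 + B 2 + B 3) * norm z" for z
  proof -
    let ?p = "0 + z $ 1 *\<^sub>R axis 1 1 :: real^3"
    let ?q = "?p + z $ 2 *\<^sub>R axis 2 1"
    have z: "z = ?q + z $ 3 *\<^sub>R axis 3 1"
      by (simp add: vec_eq_iff forall_3 axis_def)
    have "\<psi> z - \<psi> 0 = (\<psi> z - \<psi> ?q) + (\<psi> ?q - \<psi> ?p) + (\<psi> ?p - \<psi> 0)" by simp
    also have "norm \<dots> \<le> norm (\<psi> z - \<psi> ?q) + norm (\<psi> ?q - \<psi> ?p) + norm (\<psi> ?p - \<psi> 0)"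
      by (meson norm_triangle_ineq norm_triangle_mono order_refl)
    also have "\<dots> \<le> B 3 * \<bar>z $ 3\<bar> + B 2 * \<bar>z $ 2\<bar> + B 1 * \<bar>z $ 1\<bar>"
      using step[of ?q "z $ 3" 3] step[of ?p "z $ 2" 2] step[of 0 "z $ 1" 1] z by (intro add_mono) (simp_all only:)
    also have "\<dots> \<le> B 3 * norm z + B 2 * norm z + B 1 * norm z"
      using B(1) by (intro add_mono mult_left_mono component_le_norm_cart) (auto simp: less_imp_le)
    finally show ?thesis by (simp add: algebra_simps)
  qed
  then show thesis using that[of "B 1 + B 2 + B 3"] B(1) by (simp add: add_pos_pos)
qed


text \<open>In distributions, \<open>exp (a |z|) / |z|\<close> is mapped by
  \<open>Laplacian - a^2\<close> to \<open>- 4 pi\<close> times the Dirac mass at 0. Regularise with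
  \<open>\<epsilon> = e n\<close>: the left side of \<open>reg_kernel_laplacian\<close> converges
  with majorant \<open>1 / |z|\<close>, and the remainder is compared with \<open>\<psi> 0\<close>
  times a mass whose integral is known explicitly.\<close>

lemma fundamental_solution_at_0:
  fixes a :: complex and \<psi> :: "real^3 \<Rightarrow> complex"
  assumes "Re a \<le> 0" and \<psi>: "test_function \<psi>"
  shows "(LINT z|lborel. exp (a * of_real (norm z)) / of_real (norm z) * (laplacian \<psi> z - a^2 * \<psi> z))
    = - 4 * of_real pi * \<psi> 0"
proof -
  obtain R0 where "supported_in_ball R0 \<psi>"
    using \<psi> by (auto simp: test_function_def compactly_supported_iff)
  then have "supported_in_ball (max R0 1) \<psi>" by (rule supported_in_ball_mono) simp
  moreover have "max R0 1 > 0" by simp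
  ultimately obtain R where R: "R > 0" "supported_in_ball R \<psi>" by blast
  obtain B where B: "B > 0" "\<And>x. norm (\<psi> x) \<le> B * indicator (cball 0 R) x"
    using bounded_supported_in_ball[OF test_functionD(1)[OF \<psi>] R(2)] by blast
  define \<zeta> where "\<zeta> = (\<lambda>z. laplacian \<psi> z - a^2 * \<psi> z)"
  have \<zeta>: "test_function \<zeta>"
    using test_function_add[OF test_function_laplacian[OF \<psi>] test_function_cmult[OF \<psi>, of "-(a^2)"]]
    by (simp add: \<zeta>_def)
  then obtain S where S: "supported_in_ball S \<zeta>"
    by (auto simp: test_function_def compactly_supported_iff)
  obtain C where C: "C > 0" "\<And>x. norm (\<zeta> x) \<le> C * indicator (cball 0 S) x"
    using bounded_supported_in_ball[OF test_functionD(1)[OF \<zeta>] S] by blast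
  obtain \<Lambda> where \<Lambda>: "\<Lambda> > 0" "\<And>z. norm (\<psi> z - \<psi> 0) \<le> \<Lambda> * norm z"
    using test_function_lipschitz_0[OF \<psi>] by blast
  have [measurable]: "\<psi> \<in> borel_measurable borel" "\<zeta> \<in> borel_measurable borel"
    using test_functionD(1)[OF \<psi>] test_functionD(1)[OF \<zeta>] by (auto intro: borel_measurable_continuous_onI)
  have [measurable]: "reg_norm \<epsilon> \<in> borel_measurable borel" for \<epsilon>
    unfolding reg_norm_def by measurable
  have [measurable]: "cball (0::real^3) r \<in> sets borel" for r by simp
  define e where "e = (\<lambda>n. inverse (real (Suc n)))"
  have e: "e n > 0" for n by (simp add: e_def)
  have e0: "e \<longlonglongrightarrow> 0" unfolding e_def by (rule LIMSEQ_inverse_real_of_nat)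
  define s where "s = (\<lambda>n. reg_norm (e n))"
  have s: "s n z > 0" "norm z \<le> s n z" "e n \<le> s n z" for n z
    using reg_norm_facts[OF e] by (simp_all add: s_def)
  have [measurable]: "s n \<in> borel_measurable borel" for n by (simp add: s_def)
  have s_lim: "(\<lambda>n. s n z) \<longlonglongrightarrow> norm z" for z
  proof -
    have "(\<lambda>n. sqrt (norm z ^ 2 + e n ^ 2)) \<longlonglongrightarrow> sqrt (norm z ^ 2 + 0 ^ 2)"
      by (intro tendsto_intros e0)
    then show ?thesis by (simp add: s_def reg_norm_def)
  qed
  define E where "E = (\<lambda>n z. exp (a * complex_of_real (s n z)))"
  have norm_E: "norm (E n z) \<le> 1" for n z
    using assms(1) s(1)[where n=n and z=z] by (simp add: E_def mult_le_0_iff)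
  have E_lim: "(\<lambda>n. E n z) \<longlonglongrightarrow> exp (a * of_real (norm z))" for z
    unfolding E_def by (intro tendsto_intros s_lim)
  have [measurable]: "E n \<in> borel_measurable borel" for n unfolding E_def by measurable
  have int1: "integrable lborel (\<lambda>z::real^3. indicator (cball 0 r) z * (1 / norm z))" for r
    using integrable_norm_inverse_power[of 1 r] by simp
  have int2: "integrable lborel (\<lambda>z::real^3. indicator (cball 0 r) z * (1 / norm z ^ 2))" for r
    using integrable_norm_inverse_power[of 2 r] by simp
  have lim1: "(\<lambda>n. LINT z|lborel. E n z / of_real (s n z) * \<zeta> z)
      \<longlonglongrightarrow> (LINT z|lborel. exp (a * of_real (norm z)) / of_real (norm z) * \<zeta> z)"
  proof (rule integral_dominated_convergence[where w="\<lambda>z. C * (indicator (cball 0 S) z * (1 / norm z))"])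
    show "integrable lborel (\<lambda>z. C * (indicator (cball 0 S) z * (1 / norm (z::real^3))))"
      by (intro integrable_mult_right int1)
    show "AE z in lborel. (\<lambda>n. E n z / of_real (s n z) * \<zeta> z)
        \<longlonglongrightarrow> exp (a * of_real (norm z)) / of_real (norm z) * \<zeta> z"
      using AE_lborel_singleton[of 0]
    proof eventually_elim
      fix z :: "real^3" assume "z \<noteq> 0"
      then show "(\<lambda>n. E n z / of_real (s n z) * \<zeta> z)
        \<longlonglongrightarrow> exp (a * of_real (norm z)) / of_real (norm z) * \<zeta> z"
        by (intro tendsto_intros E_lim s_lim) simp
    qed
    show "AE z in lborel. norm (E n z / of_real (s n z) * \<zeta> z) \<le> C * (indicator (cball 0 S) z * (1 / norm z))" for n
      using AE_lborel_singleton[of 0]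
    proof eventually_elim
      fix z :: "real^3" assume "z \<noteq> 0"
      have "norm (E n z / of_real (s n z) * \<zeta> z) = norm (E n z) * (1 / s n z) * norm (\<zeta> z)"
        using s(1)[where n=n and z=z] by (simp add: norm_mult norm_divide)
      also have "\<dots> \<le> 1 * (1 / norm z) * (C * indicator (cball 0 S) z)"
        using norm_E C(2) s[where n=n and z=z] s(2)[where n=n and z=z] \<open>z \<noteq> 0\<close>
        by (intro mult_mono mult_nonneg_nonneg divide_left_mono) auto
      finally show "norm (E n z / of_real (s n z) * \<zeta> z) \<le> C * (indicator (cball 0 S) z * (1 / norm z))"
        by (simp add: mult_ac)
    qed
  qed measurable
  define L where "L = (\<lambda>n z. of_real (e n ^ 2) * (a^2 / of_real (s n z)^3 - 3 * a / of_real (s n z)^4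
        + 3 / of_real (s n z)^5) * E n z * \<psi> z)"
  define M where "M = (\<lambda>n z. indicator (cball 0 R) z * (3 * e n ^ 2 / s n z ^ 5))"
  have [measurable]: "L n \<in> borel_measurable borel" "M n \<in> borel_measurable borel" for n
    unfolding L_def M_def by measurable
  have eq: "(LINT z|lborel. E n z / of_real (s n z) * \<zeta> z) = - (LINT z|lborel. L n z)" for n
    unfolding E_def L_def s_def \<zeta>_def using reg_kernel_laplacian[OF e[of n] \<psi>, of a] by simp
  have M_int: "(LINT z|lborel. M n z) = 4 * pi * R^3 / sqrt (R^2 + e n ^ 2) ^ 3" for n
    unfolding M_def s_def by (rule reg_kernel_mass[OF e R(1)])
  have M_integrable: "integrable lborel (M n)" for n
  proof -
    have "integrable lborel (\<lambda>z. indicator (cball 0 R) z *\<^sub>R (3 * e n ^ 2 / s n z ^ 5))"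
      unfolding s_def using reg_norm_facts(1)[OF e[of n]]
      by (intro borel_integrable_compact continuous_intros) (auto simp: less_imp_neq[symmetric])
    then show ?thesis by (simp add: M_def)
  qed
  have L_integrable: "integrable lborel (L n)" for n
  proof -
    have "continuous_on UNIV (\<lambda>z. of_real (e n ^ 2) * (a^2 / of_real (s n z)^3 - 3 * a / of_real (s n z)^4
        + 3 / of_real (s n z)^5) * E n z)"
      unfolding s_def E_def using reg_norm_facts(1)[OF e[of n]]
      by (auto intro!: continuous_intros simp: less_imp_neq[symmetric])
    then show ?thesis unfolding L_def by (rule test_function_mult_integrable[OF \<psi>])
  qed
  \<comment> \<open>The majorant comes from \<open>e n \<le> s n z\<close> and
    \<open>norm z \<le> s n z\<close>: \<open>e^2 / s^3 \<le> 1 / |z|\<close> and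
    \<open>e^2 / s^4 \<le> 1 / |z|^2\<close>. The term with \<open>e^2 / s^5\<close> would be too
    singular; subtracting the mass at \<open>\<psi> 0\<close> leaves a Lipschitz difference of order
    \<open>s\<close> (bound \<open>b3\<close>), reducing it to \<open>e^2 / s^4\<close>.\<close>
  define w where "w = (\<lambda>z::real^3. (norm a ^ 2 * B) * (indicator (cball 0 R) z * (1 / norm z))
      + (3 * norm a * B + 3 * (norm a * B + \<Lambda>)) * (indicator (cball 0 R) z * (1 / norm z ^ 2)))"
  have lim2: "(\<lambda>n. LINT z|lborel. (L n z - of_real (M n z) * \<psi> 0)) \<longlonglongrightarrow> (LINT z|(lborel::(real^3) measure). 0)"
  proof (rule integral_dominated_convergence[where w=w])
    show "integrable lborel w"
      unfolding w_def by (intro Bochner_Integration.integrable_add integrable_mult_right int1 int2)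
    show "AE z in lborel. (\<lambda>n. L n z - of_real (M n z) * \<psi> 0) \<longlonglongrightarrow> 0"
      using AE_lborel_singleton[of 0]
    proof eventually_elim
      fix z :: "real^3" assume "z \<noteq> 0"
      have "(\<lambda>n. L n z - of_real (M n z) * \<psi> 0) \<longlonglongrightarrow>
        of_real (0 ^ 2) * (a^2 / of_real (norm z)^3 - 3 * a / of_real (norm z)^4
        + 3 / of_real (norm z)^5) * exp (a * of_real (norm z)) * \<psi> z
        - of_real (indicator (cball 0 R) z * (3 * 0 ^ 2 / norm z ^ 5)) * \<psi> 0"
        unfolding L_def M_def using \<open>z \<noteq> 0\<close> by (intro tendsto_intros e0 s_lim E_lim) auto
      then show "(\<lambda>n. L n z - of_real (M n z) * \<psi> 0) \<longlonglongrightarrow> 0" by simp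
    qed
    show "AE z in lborel. norm (L n z - of_real (M n z) * \<psi> 0) \<le> w z" for n
      using AE_lborel_singleton[of 0]
    proof eventually_elim
      fix z :: "real^3" assume "z \<noteq> 0"
      then have nz: "norm z > 0" by simp
      show "norm (L n z - of_real (M n z) * \<psi> 0) \<le> w z"
      proof (cases "z \<in> cball 0 R")
        case False
        then have "\<psi> z = 0" using R(2) by (simp add: supported_in_ball_def)
        then show ?thesis using False by (simp add: L_def M_def w_def)
      next
        case True
        have \<psi>B: "norm (\<psi> z) \<le> B" using B(2)[of z] True by simp
        let ?s = "s n z" and ?E = "E n z"
        note sz = s(1)[where n=n and z=z] s(2)[where n=n and z=z] s(3)[where n=n and z=z]
        have es: "e n ^ 2 \<le> ?s ^ 2" using sz e[of n] by (intro power_mono) auto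
        have b1: "e n ^ 2 / ?s ^ 3 \<le> 1 / norm z"
        proof -
          have "e n ^ 2 / ?s ^ 3 \<le> ?s ^ 2 / ?s ^ 3" using es sz by (intro divide_right_mono) auto
          also have "\<dots> = 1 / ?s" using sz by (simp add: field_simps power_numeral_reduce)
          also have "\<dots> \<le> 1 / norm z" by (intro divide_left_mono mult_pos_pos sz nz) auto
          finally show ?thesis .
        qed
        have b2: "e n ^ 2 / ?s ^ 4 \<le> 1 / norm z ^ 2"
        proof -
          have "e n ^ 2 / ?s ^ 4 \<le> ?s ^ 2 / ?s ^ 4" using es sz by (intro divide_right_mono) auto
          also have "\<dots> = 1 / ?s ^ 2" using sz by (simp add: field_simps power_numeral_reduce)
          also have "\<dots> \<le> 1 / norm z ^ 2" by (intro divide_left_mono power_mono mult_pos_pos zero_less_power sz nz) auto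
          finally show ?thesis .
        qed
        have b3: "norm (?E * \<psi> z - \<psi> 0) \<le> (norm a * B + \<Lambda>) * ?s"
        proof -
          have "?E * \<psi> z - \<psi> 0 = (?E - 1) * \<psi> z + (\<psi> z - \<psi> 0)" by (simp add: algebra_simps)
          also have "norm \<dots> \<le> norm (?E - 1) * norm (\<psi> z) + norm (\<psi> z - \<psi> 0)"
            using norm_triangle_ineq by (metis norm_mult)
          also have "\<dots> \<le> (norm a * ?s) * B + \<Lambda> * ?s"
          proof (intro add_mono mult_mono)
            have "norm (exp (a * of_real ?s) - 1) \<le> norm (a * of_real ?s)"
              using assms(1) sz by (intro norm_exp_diff_1_le) (simp add: mult_le_0_iff)
            then show "norm (?E - 1) \<le> norm a * ?s" using sz by (simp add: E_def norm_mult)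
            show "norm (\<psi> z - \<psi> 0) \<le> \<Lambda> * ?s"
              using \<Lambda>(2)[of z] mult_left_mono[OF sz(2), of \<Lambda>] \<Lambda>(1) by linarith
          qed (use \<psi>B sz in auto)
          finally show ?thesis by (simp add: algebra_simps)
        qed
        have split: "L n z - of_real (M n z) * \<psi> 0
            = a^2 * of_real (e n ^ 2 / ?s ^ 3) * (?E * \<psi> z) - 3 * a * of_real (e n ^ 2 / ?s ^ 4) * (?E * \<psi> z)
              + of_real (3 * (e n ^ 2 / ?s ^ 5)) * (?E * \<psi> z - \<psi> 0)"
          using True by (simp add: L_def M_def algebra_simps diff_divide_distrib)
        have nE: "norm (?E * \<psi> z) \<le> B"
          using mult_mono[OF norm_E[where n=n and z=z] \<psi>B] by (simp add: norm_mult)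
        have "norm (L n z - of_real (M n z) * \<psi> 0)
            \<le> norm (a^2 * of_real (e n ^ 2 / ?s ^ 3) * (?E * \<psi> z))
              + norm (3 * a * of_real (e n ^ 2 / ?s ^ 4) * (?E * \<psi> z))
              + norm (of_real (3 * (e n ^ 2 / ?s ^ 5)) * (?E * \<psi> z - \<psi> 0))"
          unfolding split by (intro norm_triangle_le add_mono norm_triangle_ineq4 order_refl)
        also have "\<dots> = norm a ^ 2 * (e n ^ 2 / ?s ^ 3) * norm (?E * \<psi> z)
              + 3 * norm a * (e n ^ 2 / ?s ^ 4) * norm (?E * \<psi> z)
              + 3 * (e n ^ 2 / ?s ^ 5) * norm (?E * \<psi> z - \<psi> 0)"
          using sz by (simp add: norm_mult norm_power norm_divide)
        also have "\<dots> \<le> norm a ^ 2 * (1 / norm z) * B + 3 * norm a * (1 / norm z ^ 2) * B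
              + 3 * (e n ^ 2 / ?s ^ 5) * ((norm a * B + \<Lambda>) * ?s)"
          using b1 b2 b3 nE sz by (intro add_mono mult_mono mult_left_mono) (auto intro!: mult_nonneg_nonneg)
        also have "3 * (e n ^ 2 / ?s ^ 5) * ((norm a * B + \<Lambda>) * ?s) = 3 * (norm a * B + \<Lambda>) * (e n ^ 2 / ?s ^ 4)"
          using sz by (simp add: field_simps power_numeral_reduce)
        also have "\<dots> \<le> 3 * (norm a * B + \<Lambda>) * (1 / norm z ^ 2)"
          using b2 B(1) \<Lambda>(1) by (intro mult_left_mono) (auto intro!: add_nonneg_nonneg mult_nonneg_nonneg)
        also have "norm a ^ 2 * (1 / norm z) * B + 3 * norm a * (1 / norm z ^ 2) * B
              + 3 * (norm a * B + \<Lambda>) * (1 / norm z ^ 2) = w z"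
          using True by (simp add: w_def algebra_simps)
        finally show ?thesis by simp
      qed
    qed
  qed measurable
  have "(LINT z|lborel. (L n z - of_real (M n z) * \<psi> 0))
      = (LINT z|lborel. L n z) - of_real (4 * pi * R^3 / sqrt (R^2 + e n ^ 2) ^ 3) * \<psi> 0" for n
    using L_integrable[of n] M_integrable[of n] M_int[of n] by simp
  with lim2 have lim3: "(\<lambda>n. (LINT z|lborel. L n z) - of_real (4 * pi * R^3 / sqrt (R^2 + e n ^ 2) ^ 3) * \<psi> 0) \<longlonglongrightarrow> 0"
    by simp
  have lim4: "(\<lambda>n. of_real (4 * pi * R^3 / sqrt (R^2 + e n ^ 2) ^ 3) * \<psi> 0)
      \<longlonglongrightarrow> of_real (4 * pi * R^3 / sqrt (R^2 + 0 ^ 2) ^ 3) * \<psi> 0"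
    using R(1) by (intro tendsto_intros e0) auto
  have "(\<lambda>n. LINT z|lborel. L n z) \<longlonglongrightarrow> 4 * of_real pi * \<psi> 0"
    using tendsto_add[OF lim3 lim4] R(1) by simp
  then have "(\<lambda>n. - (LINT z|lborel. L n z)) \<longlonglongrightarrow> - (4 * of_real pi * \<psi> 0)" by (rule tendsto_minus)
  from LIMSEQ_unique[OF lim1[unfolded eq] this] show ?thesis by (simp add: \<zeta>_def)
qed

section \<open>Bounds for the resolvent kernel\<close>

text \<open>The radial profile of \<open>G0\<close>. At \<open>r = 0\<close> it and
  \<open>gker'\<close> are 0 by division by zero, so the bounds below can include that
  point.\<close>

definition gker :: "real \<Rightarrow> real \<Rightarrow> complex"
  where "gker \<kappa> r = (exp (\<i> * of_real (\<kappa> * r)) - of_real (exp (- \<kappa> * r))) / of_real (8 * pi * \<kappa>^2 * r)"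

definition gker' :: "real \<Rightarrow> real \<Rightarrow> complex"
  where "gker' \<kappa> r = ((\<i> * exp (\<i> * of_real (\<kappa> * r)) + of_real (exp (- \<kappa> * r))) * of_real (\<kappa> * r)
      - (exp (\<i> * of_real (\<kappa> * r)) - of_real (exp (- \<kappa> * r)))) / of_real (8 * pi * \<kappa>^2 * r^2)"

lemma G0_eq: "G0 x y \<kappa> = gker \<kappa> (norm (x - y))"
  by (simp add: G0_def gker_def)

lemma gker_deriv:
  assumes "\<kappa> > 0" "r > 0"
  shows "(gker \<kappa> has_vector_derivative gker' \<kappa> r) (at r)"
proof -
  define H where "H = (\<lambda>w. (exp (\<i> * (of_real \<kappa> * w)) - exp (- of_real \<kappa> * w)) / (of_real (8 * pi * \<kappa>^2) * w :: complex))"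
  define c where "c = complex_of_real (8 * pi * \<kappa>^2)"
  have c: "c \<noteq> 0" "complex_of_real r \<noteq> 0" using assms by (auto simp: c_def)
  define e1 where "e1 = exp (\<i> * (of_real \<kappa> * of_real r) :: complex)"
  define e2 where "e2 = exp (- of_real \<kappa> * of_real r :: complex)"
  have num: "((\<lambda>w. exp (\<i> * (of_real \<kappa> * w)) - exp (- of_real \<kappa> * w)) has_field_derivative
      of_real \<kappa> * (\<i> * e1 + e2)) (at (of_real r))"
    unfolding e1_def e2_def by (auto intro!: derivative_eq_intros simp: algebra_simps)
  have den: "((\<lambda>w. c * w) has_field_derivative c) (at (of_real r))"
    by (auto intro!: derivative_eq_intros)
  have "(H has_field_derivative ((of_real \<kappa> * (\<i> * e1 + e2)) * (c * of_real r) - (e1 - e2) * c)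
      / ((c * of_real r) * (c * of_real r))) (at (of_real r))"
    using DERIV_divide[OF num den] c unfolding H_def c_def e1_def e2_def by simp
  also have "((of_real \<kappa> * (\<i> * e1 + e2)) * (c * of_real r) - (e1 - e2) * c) / ((c * of_real r) * (c * of_real r))
      = ((\<i> * e1 + e2) * of_real (\<kappa> * r) - (e1 - e2)) / (c * of_real r ^ 2)"
    using c by (simp add: divide_simps power2_eq_square) (simp add: algebra_simps)
  also have "\<dots> = gker' \<kappa> r"
    by (simp add: gker'_def e1_def e2_def c_def exp_of_real[symmetric])
  finally have "((\<lambda>s. H (of_real s)) has_vector_derivative gker' \<kappa> r) (at r)"
    by (rule has_vector_derivative_real_field)
  moreover have "(\<lambda>s. H (of_real s)) = gker \<kappa>"
    by (auto simp: H_def gker_def exp_of_real[symmetric])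
  ultimately show ?thesis by simp
qed

text \<open>These control the numerators of \<open>gker\<close> and of its derivative. The bound
  linear in \<open>x\<close> expresses that the two exponentials cancel at 0.\<close>

lemma norm_exp_diff_le:
  fixes x :: real
  assumes "x \<ge> 0"
  shows "norm (exp (\<i> * of_real x) - of_real (exp (- x))) \<le> 2"
    "norm (exp (\<i> * of_real x) - of_real (exp (- x))) \<le> 2 * x"
    "norm (\<i> * exp (\<i> * of_real x) + of_real (exp (- x))) \<le> 2"
    "norm (exp (\<i> * of_real x) + of_real (exp (- x))) \<le> 2"
proof -
  have e: "norm (exp (\<i> * complex_of_real x)) = 1" by simp
  have e': "norm (complex_of_real (exp (- x))) \<le> 1" using assms by simp
  show "norm (exp (\<i> * of_real x) - of_real (exp (- x))) \<le> 2"
    using norm_triangle_ineq4[of "exp (\<i> * complex_of_real x)" "of_real (exp (- x))"] e e' by linarith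
  show "norm (\<i> * exp (\<i> * of_real x) + of_real (exp (- x))) \<le> 2"
    using norm_triangle_ineq[of "\<i> * exp (\<i> * complex_of_real x)" "of_real (exp (- x))"] e'
      norm_mult[of \<i> "exp (\<i> * complex_of_real x)"] unfolding e norm_ii by linarith
  show "norm (exp (\<i> * of_real x) + of_real (exp (- x))) \<le> 2"
    using norm_triangle_ineq[of "exp (\<i> * complex_of_real x)" "of_real (exp (- x))"] e e' by linarith
  have "norm (exp (\<i> * complex_of_real x) - 1) \<le> x"
    using norm_exp_diff_1_le[of "\<i> * of_real x"] assms by (simp add: norm_mult)
  moreover have "norm (complex_of_real (exp (- x)) - 1) \<le> x"
    using norm_exp_diff_1_le[of "of_real (- x)"] assms by (simp only: exp_of_real) simp
  ultimately show "norm (exp (\<i> * of_real x) - of_real (exp (- x))) \<le> 2 * x"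
    using norm_triangle_ineq4[of "exp (\<i> * complex_of_real x) - 1" "of_real (exp (- x)) - 1"] by simp
qed

lemma pi_8_ge: "8 * pi \<ge> 4" using pi_gt3 by simp

text \<open>The cancellation in the numerator removes the singularity, giving a bound uniform in
  \<open>r\<close>; this makes \<open>R0\<close> defined on all integrable functions. The second
  bound pays with \<open>1 / r\<close> for an additional power of
  \<open>1 / \<kappa>\<close>.\<close>

lemma gker_bounds:
  assumes "\<kappa> > 0" "r \<ge> 0"
  shows "norm (gker \<kappa> r) \<le> 1 / \<kappa>" "norm (gker \<kappa> r) \<le> 1 / (\<kappa>^2 * r)"
proof -
  let ?N = "exp (\<i> * of_real (\<kappa> * r)) - complex_of_real (exp (- (\<kappa> * r)))"
  have k: "\<kappa> * r \<ge> 0" using assms by simp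
  note b = norm_exp_diff_le[OF k]
  have eq: "norm (gker \<kappa> r) = norm ?N / (8 * pi * \<kappa>^2 * r)"
    using assms by (simp add: gker_def norm_divide norm_mult norm_power)
  show "norm (gker \<kappa> r) \<le> 1 / \<kappa>"
  proof (cases "r = 0")
    case False
    then have "norm ?N / (8 * pi * \<kappa>^2 * r) \<le> 2 * (\<kappa> * r) / (4 * \<kappa>^2 * r)"
      using assms b(2) pi_8_ge by (intro frac_le mult_right_mono) auto
    also have "\<dots> \<le> 1 / \<kappa>" using assms False by (simp add: field_simps power2_eq_square)
    finally show ?thesis unfolding eq .
  qed (use assms in \<open>simp add: gker_def\<close>)
  show "norm (gker \<kappa> r) \<le> 1 / (\<kappa>^2 * r)"
  proof (cases "r = 0")
    case False
    then have "norm ?N / (8 * pi * \<kappa>^2 * r) \<le> 2 / (4 * \<kappa>^2 * r)"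
      using assms b(1) pi_8_ge by (intro frac_le mult_right_mono) auto
    also have "\<dots> \<le> 1 / (\<kappa>^2 * r)" using assms False by (simp add: field_simps)
    finally show ?thesis unfolding eq .
  qed (use assms in \<open>simp add: gker_def\<close>)
qed

text \<open>The first bound makes the kernel Lipschitz uniformly in \<open>\<kappa>\<close>, which
  differentiates \<open>R0\<close>; the second carries the factor \<open>1 / \<kappa>\<close> behind
  the contraction.\<close>

lemma gker'_bounds:
  assumes "\<kappa> > 0" "r \<ge> 0"
  shows "norm (gker' \<kappa> r) \<le> 1" "norm (gker' \<kappa> r) \<le> 1 / (\<kappa> * r)"
proof -
  define N where "N = (\<lambda>r. (\<i> * exp (\<i> * of_real (\<kappa> * r)) + of_real (exp (- \<kappa> * r))) * of_real (\<kappa> * r)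
      - (exp (\<i> * of_real (\<kappa> * r)) - complex_of_real (exp (- \<kappa> * r))))"
  have eq: "norm (gker' \<kappa> r) = norm (N r) / (8 * pi * \<kappa>^2 * r^2)"
    using assms by (simp add: gker'_def N_def norm_divide norm_mult norm_power)
  have k: "\<kappa> * t \<ge> 0" if "t \<ge> 0" for t using assms that by simp
  have N1: "norm (N r) \<le> 4 * (\<kappa> * r)"
  proof -
    have "norm (N r) \<le> norm ((\<i> * exp (\<i> * of_real (\<kappa> * r)) + complex_of_real (exp (- \<kappa> * r))) * of_real (\<kappa> * r))
       + norm (exp (\<i> * of_real (\<kappa> * r)) - complex_of_real (exp (- \<kappa> * r)))"
      unfolding N_def by (rule norm_triangle_ineq4)
    also have "\<dots> = norm (\<i> * exp (\<i> * of_real (\<kappa> * r)) + complex_of_real (exp (- (\<kappa> * r)))) * (\<kappa> * r)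
       + norm (exp (\<i> * of_real (\<kappa> * r)) - complex_of_real (exp (- (\<kappa> * r))))"
      using k[OF assms(2)] unfolding norm_mult[of _ "of_real (\<kappa> * r)"] norm_of_real by (simp only: mult_minus_left abs_of_nonneg)
    also have "\<dots> \<le> 2 * (\<kappa> * r) + 2 * (\<kappa> * r)"
      using norm_exp_diff_le[OF k[OF assms(2)]] k[OF assms(2)] by (intro add_mono mult_right_mono)
    finally show ?thesis by simp
  qed
  \<comment> \<open>In \<open>N'\<close> all terms without a factor \<open>t\<close> cancel, leaving
    \<open>- \<kappa>^2 * t * (exp (\<i> \<kappa> t) + exp (- \<kappa> t))\<close>. Thus
    \<open>N\<close> vanishes to second order at 0 and cancels the \<open>r^2\<close> in the
    denominator of \<open>gker'\<close>.\<close>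
  have N2: "norm (N r) \<le> 2 * (\<kappa>^2 * r^2)"
  proof -
    have "norm (N r - N 0) \<le> 2 * \<kappa>^2 * r * norm (r - 0)"
    proof (rule differentiable_bound[where S="{0..r}" and
          f'="\<lambda>t h. h *\<^sub>R (- of_real (\<kappa>^2 * t) * (exp (\<i> * of_real (\<kappa> * t)) + of_real (exp (- \<kappa> * t))))"])
      fix t assume t: "t \<in> {0..r}"
      have "((\<lambda>w. (\<i> * exp (\<i> * (of_real \<kappa> * w)) + exp (- of_real \<kappa> * w)) * (of_real \<kappa> * w)
          - (exp (\<i> * (of_real \<kappa> * w)) - exp (- of_real \<kappa> * w))) has_field_derivative
          - of_real (\<kappa>^2 * t) * (exp (\<i> * (of_real \<kappa> * of_real t)) + exp (- of_real \<kappa> * of_real t)))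
          (at (of_real t :: complex))"
        by (auto intro!: derivative_eq_intros simp: algebra_simps power2_eq_square)
      from has_vector_derivative_real_field[OF this]
      have "(N has_vector_derivative - of_real (\<kappa>^2 * t) * (exp (\<i> * of_real (\<kappa> * t)) + of_real (exp (- \<kappa> * t)))) (at t)"
        by (simp add: exp_of_real[symmetric] N_def)
      then show "(N has_derivative (\<lambda>h. h *\<^sub>R (- of_real (\<kappa>^2 * t) * (exp (\<i> * of_real (\<kappa> * t)) + of_real (exp (- \<kappa> * t))))))
          (at t within {0..r})"
        by (simp add: has_vector_derivative_def has_derivative_at_withinI)
      show "onorm (\<lambda>h. h *\<^sub>R (- of_real (\<kappa>^2 * t) * (exp (\<i> * of_real (\<kappa> * t)) + complex_of_real (exp (- \<kappa> * t))))) \<le> 2 * \<kappa>^2 * r"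
      proof (rule onorm_le)
        fix h :: real
        have "norm (exp (\<i> * of_real (\<kappa> * t)) + complex_of_real (exp (- \<kappa> * t))) \<le> 2"
          using norm_exp_diff_le(4)[of "\<kappa> * t"] k t by simp
        then have "\<kappa>^2 * t * norm (exp (\<i> * of_real (\<kappa> * t)) + complex_of_real (exp (- \<kappa> * t))) \<le> \<kappa>^2 * r * 2"
          using t by (intro mult_mono) auto
        from mult_left_mono[OF this, of "\<bar>h\<bar>"]
        show "norm (h *\<^sub>R (- of_real (\<kappa>^2 * t) * (exp (\<i> * of_real (\<kappa> * t)) + complex_of_real (exp (- \<kappa> * t)))))
            \<le> 2 * \<kappa>^2 * r * norm h"
          using t by (simp only: norm_scaleR norm_mult norm_minus_cancel norm_of_real) (simp add: mult_ac)
      qed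
    qed (use assms in auto)
    moreover have "N 0 = 0" by (simp add: N_def)
    ultimately show ?thesis using assms by (simp add: power2_eq_square mult_ac)
  qed
  show "norm (gker' \<kappa> r) \<le> 1"
  proof (cases "r = 0")
    case False
    then have "norm (N r) / (8 * pi * \<kappa>^2 * r^2) \<le> 2 * (\<kappa>^2 * r^2) / (4 * \<kappa>^2 * r^2)"
      using assms N2 pi_8_ge by (intro frac_le mult_right_mono) auto
    also have "\<dots> \<le> 1" using assms False by (simp add: field_simps)
    finally show ?thesis unfolding eq .
  qed (simp add: gker'_def)
  show "norm (gker' \<kappa> r) \<le> 1 / (\<kappa> * r)"
  proof (cases "r = 0")
    case False
    then have "norm (N r) / (8 * pi * \<kappa>^2 * r^2) \<le> 4 * (\<kappa> * r) / (4 * \<kappa>^2 * r^2)"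
      using assms N1 pi_8_ge by (intro frac_le mult_right_mono) auto
    also have "\<dots> = 1 / (\<kappa> * r)" using assms False by (simp add: field_simps power2_eq_square)
    finally show ?thesis unfolding eq .
  qed (simp add: gker'_def)
qed

lemma gker_lipschitz:
  assumes "\<kappa> > 0" "r > 0" "s > 0"
  shows "norm (gker \<kappa> r - gker \<kappa> s) \<le> \<bar>r - s\<bar>"
proof -
  have "norm (gker \<kappa> r - gker \<kappa> s) \<le> 1 * norm (r - s)"
  proof (rule differentiable_bound[where S="{0<..}" and f'="\<lambda>t h. h *\<^sub>R gker' \<kappa> t"])
    fix t :: real assume t: "t \<in> {0<..}"
    then show "(gker \<kappa> has_derivative (\<lambda>h. h *\<^sub>R gker' \<kappa> t)) (at t within {0<..})"
      using gker_deriv[OF assms(1), of t] by (simp add: has_vector_derivative_def has_derivative_at_withinI)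
    show "onorm (\<lambda>h. h *\<^sub>R gker' \<kappa> t) \<le> 1"
      by (rule onorm_le) (use gker'_bounds(1)[OF assms(1), of t] t in \<open>auto intro: mult_left_le\<close>)
  qed (use assms in auto)
  then show ?thesis by simp
qed

text \<open>For \<open>z \<noteq> 0\<close> and positive \<open>\<kappa>\<close> this is the
  differential of the kernel \<open>gker \<kappa> (norm z)\<close> in direction \<open>h\<close>; at
  \<open>z = 0\<close> it takes the value 0.\<close>

definition DG :: "real \<Rightarrow> real^3 \<Rightarrow> real^3 \<Rightarrow> complex"
  where "DG \<kappa> z h = gker' \<kappa> (norm z) * of_real (z \<bullet> h / norm z)"

lemma DG_bound:
  assumes "norm (gker' \<kappa> (norm z)) \<le> b"
  shows "norm (DG \<kappa> z h) \<le> b * norm h"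
proof -
  have "\<bar>z \<bullet> h / norm z\<bar> \<le> norm h"
    using Cauchy_Schwarz_ineq2[of z h] by (cases "z = 0") (auto simp: field_simps)
  then show ?thesis
    using assms unfolding DG_def norm_mult norm_of_real
    by (intro mult_mono) (auto intro: order_trans[OF norm_ge_zero])
qed

lemma DG_bounds:
  assumes "\<kappa> > 0"
  shows "norm (DG \<kappa> z h) \<le> norm h" "norm (DG \<kappa> z h) \<le> 1 / (\<kappa> * norm z) * norm h"
  using DG_bound[OF gker'_bounds(1)[OF assms norm_ge_zero]] DG_bound[OF gker'_bounds(2)[OF assms norm_ge_zero]]
  by auto

lemma DG_linear: "DG \<kappa> z (h + k) = DG \<kappa> z h + DG \<kappa> z k" "DG \<kappa> z (c *\<^sub>R h) = c *\<^sub>R DG \<kappa> z h"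
proof -
  show "DG \<kappa> z (h + k) = DG \<kappa> z h + DG \<kappa> z k"
    by (simp add: DG_def inner_add_right add_divide_distrib distrib_left)
  show "DG \<kappa> z (c *\<^sub>R h) = c *\<^sub>R DG \<kappa> z h"
    by (simp only: DG_def inner_scaleR_right times_divide_eq_right[symmetric] of_real_mult
        scaleR_conv_of_real[where 'a=complex] mult.left_commute)
qed

lemma gker_measurable [measurable]: "gker \<kappa> \<in> borel_measurable borel" "gker' \<kappa> \<in> borel_measurable borel"
  unfolding gker_def gker'_def by measurable

lemma G0_measurable: "(\<lambda>y. G0 x y \<kappa>) \<in> borel_measurable borel"
  unfolding G0_eq by measurable

lemma DG_measurable: "(\<lambda>y. DG \<kappa> (x - y) h) \<in> borel_measurable borel"
  unfolding DG_def by measurable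

lemma isCont_DG:
  assumes "z \<noteq> 0" "\<kappa> > 0"
  shows "isCont (\<lambda>z. DG \<kappa> z h) z"
  unfolding DG_def gker'_def using assms by (intro continuous_intros) auto

lemma G0_has_derivative:
  assumes "\<kappa> > 0" "x \<noteq> y"
  shows "((\<lambda>x. G0 x y \<kappa>) has_derivative DG \<kappa> (x - y)) (at x)"
proof -
  have 1: "((\<lambda>x. norm (x - y)) has_derivative (\<lambda>h. (x - y) \<bullet> h / norm (x - y))) (at x)"
  proof -
    have "(norm has_derivative (\<lambda>h. h \<bullet> sgn (x - y))) (at (x - y))"
      using assms by (intro has_derivative_norm) auto
    moreover have "((\<lambda>x. x - y) has_derivative (\<lambda>h. h)) (at x)"
      by (auto intro!: derivative_eq_intros)
    ultimately have "((\<lambda>x. norm (x - y)) has_derivative (\<lambda>h. h \<bullet> sgn (x - y))) (at x)"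
      using has_derivative_compose by blast
    moreover have "h \<bullet> sgn (x - y) = (x - y) \<bullet> h / norm (x - y)" for h
      by (simp add: sgn_div_norm inner_commute divide_inverse mult.commute)
    ultimately show ?thesis by simp
  qed
  have "(gker \<kappa> has_derivative (\<lambda>t. t *\<^sub>R gker' \<kappa> (norm (x - y)))) (at (norm (x - y)))"
    using gker_deriv[OF assms(1), of "norm (x - y)"] assms by (simp add: has_vector_derivative_def)
  from has_derivative_compose[OF 1 this] show ?thesis
    unfolding G0_eq DG_def by (simp add: scaleR_conv_of_real mult.commute)
qed

lemma G0_lipschitz:
  assumes "\<kappa> > 0" "x \<noteq> y" "x' \<noteq> y"
  shows "norm (G0 x y \<kappa> - G0 x' y \<kappa>) \<le> norm (x - x')"
proof -
  have "norm (G0 x y \<kappa> - G0 x' y \<kappa>) \<le> \<bar>norm (x - y) - norm (x' - y)\<bar>"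
    unfolding G0_eq using assms by (intro gker_lipschitz) auto
  also have "\<dots> \<le> norm (x - x')"
    using norm_triangle_ineq3[of "x - y" "x' - y"] by simp
  finally show ?thesis .
qed

lemma G0_bounds:
  assumes "\<kappa> > 0"
  shows "norm (G0 x y \<kappa>) \<le> 1 / \<kappa>" "norm (G0 x y \<kappa>) \<le> 1 / (\<kappa>^2 * norm (x - y))"
  unfolding G0_eq using gker_bounds[OF assms norm_ge_zero] by auto

section \<open>The free resolvent on integrable functions\<close>

lemma integrable_bounded_mult:
  fixes g f :: "'a \<Rightarrow> complex"
  assumes "integrable M f" "g \<in> borel_measurable M" "\<And>x. norm (g x) \<le> b"
  shows "integrable M (\<lambda>x. g x * f x)" "norm (LINT x|M. g x * f x) \<le> b * (LINT x|M. norm (f x))"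
proof -
  have le: "norm (g x * f x) \<le> b * norm (f x)" for x
    using assms(3)[of x] by (simp add: norm_mult mult_right_mono)
  have int: "integrable M (\<lambda>x. b * norm (f x))" using assms(1) by simp
  have "b * norm (f x) \<ge> 0" for x using le order_trans[OF norm_ge_zero] by blast
  then show 1: "integrable M (\<lambda>x. g x * f x)"
    using le assms(1,2) by (intro Bochner_Integration.integrable_bound[OF int]) auto
  have "norm (LINT x|M. g x * f x) \<le> (LINT x|M. norm (g x * f x))" by (rule integral_norm_bound)
  also have "\<dots> \<le> (LINT x|M. b * norm (f x))"
    using 1 int le by (intro integral_mono) auto
  finally show "norm (LINT x|M. g x * f x) \<le> b * (LINT x|M. norm (f x))" by simp
qed

lemma G0_integrable:
  assumes "\<kappa> > 0" "integrable lborel f"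
  shows "integrable lborel (\<lambda>y. G0 x y \<kappa> * f y)"
    and R0_bound: "norm (R0 \<kappa> f x) \<le> 1 / \<kappa> * (LINT y|lborel. norm (f y))"
  using integrable_bounded_mult[OF assms(2), of "\<lambda>y. G0 x y \<kappa>" "1 / \<kappa>"] G0_measurable G0_bounds(1)[OF assms(1)]
  by (auto simp: R0_def)

lemma DG_integrable:
  assumes "\<kappa> > 0" "integrable lborel f"
  shows "integrable lborel (\<lambda>y. DG \<kappa> (x - y) h * f y)"
    and DG_integral_bound: "norm (LINT y|lborel. DG \<kappa> (x - y) h * f y) \<le> norm h * (LINT y|lborel. norm (f y))"
  using integrable_bounded_mult[OF assms(2), of "\<lambda>y. DG \<kappa> (x - y) h" "norm h"] DG_measurable DG_bounds(1)[OF assms(1)]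
  by auto

text \<open>Differentiation under the integral by dominated convergence. Asking only that
  \<open>f\<close> be integrable matters for uniqueness, where the density of an arbitrary
  scattering solution is at first known only to be integrable.\<close>

lemma R0_has_derivative:
  assumes \<kappa>: "\<kappa> > 0" and f: "integrable lborel f"
  shows "(R0 \<kappa> f has_derivative (\<lambda>h. LINT y|lborel. DG \<kappa> (x - y) h * f y)) (at x)"
proof -
  let ?D = "\<lambda>h. LINT y|lborel. DG \<kappa> (x - y) h * f y"
  have [measurable]: "f \<in> borel_measurable lborel" using f by auto
  have lin: "bounded_linear ?D"
  proof (rule bounded_linear_intro)
    show "?D (h + k) = ?D h + ?D k" for h k
      using DG_integrable[OF assms] by (simp add: DG_linear distrib_right)
    show "?D (c *\<^sub>R h) = c *\<^sub>R ?D h" for c h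
      by (simp add: DG_linear)
    show "norm (?D h) \<le> norm h * (LINT y|lborel. norm (f y))" for h
      by (rule DG_integral_bound[OF assms])
  qed
  have lim: "((\<lambda>z. norm (R0 \<kappa> f z - R0 \<kappa> f x - ?D (z - x)) / norm (z - x)) \<longlongrightarrow> 0) (at x)"
    unfolding tendsto_at_iff_sequentially
  proof (intro allI impI)
    fix X :: "nat \<Rightarrow> real^3"
    assume X: "\<forall>i. X i \<in> UNIV - {x}" "X \<longlonglongrightarrow> x"
    then have Xx: "X n \<noteq> x" for n by auto
    \<comment> \<open>The kernel increments and \<open>DG\<close> are both at most
      \<open>norm (X n - x)\<close>, so the normalised remainder is bounded by 2 and
      \<open>2 * norm (f y)\<close> is a majorant.\<close>
    define q where "q = (\<lambda>n y. ((G0 (X n) y \<kappa> - G0 x y \<kappa> - DG \<kappa> (x - y) (X n - x)) /\<^sub>R norm (X n - x)) * f y)"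
    have [measurable]: "q n \<in> borel_measurable lborel" for n
      unfolding q_def using G0_measurable DG_measurable by measurable
    have "(\<lambda>n. LINT y|lborel. q n y) \<longlonglongrightarrow> (LINT y|(lborel::(real^3) measure). 0)"
    proof (rule integral_dominated_convergence[where w="\<lambda>y. 2 * norm (f y)"])
      show "integrable lborel (\<lambda>y. 2 * norm (f y))" using f by simp
      show "AE y in lborel. (\<lambda>n. q n y) \<longlonglongrightarrow> 0"
        using AE_lborel_singleton[of x]
      proof eventually_elim
        fix y assume "y \<noteq> x"
        then have "((\<lambda>z. G0 z y \<kappa>) has_derivative DG \<kappa> (x - y)) (at x)"
          using G0_has_derivative[OF \<kappa>, of x y] by simp
        then have "((\<lambda>z. norm (G0 z y \<kappa> - G0 x y \<kappa> - DG \<kappa> (x - y) (z - x)) / norm (z - x)) \<longlongrightarrow> 0) (at x)"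
          by (simp add: has_derivative_iff_norm)
        then have "(\<lambda>n. norm (G0 (X n) y \<kappa> - G0 x y \<kappa> - DG \<kappa> (x - y) (X n - x)) / norm (X n - x)) \<longlonglongrightarrow> 0"
          using X unfolding tendsto_at_iff_sequentially by (auto simp: o_def)
        then have "(\<lambda>n. norm ((G0 (X n) y \<kappa> - G0 x y \<kappa> - DG \<kappa> (x - y) (X n - x)) /\<^sub>R norm (X n - x))) \<longlonglongrightarrow> 0"
          by (simp add: divide_inverse mult.commute)
        then have "(\<lambda>n. (G0 (X n) y \<kappa> - G0 x y \<kappa> - DG \<kappa> (x - y) (X n - x)) /\<^sub>R norm (X n - x)) \<longlonglongrightarrow> 0"
          by (rule tendsto_norm_zero_cancel)
        then show "(\<lambda>n. q n y) \<longlonglongrightarrow> 0"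
          unfolding q_def by (rule tendsto_mult_left_zero)
      qed
      show "AE y in lborel. norm (q n y) \<le> 2 * norm (f y)" for n
        using AE_lborel_singleton[of x] AE_lborel_singleton[of "X n"]
      proof eventually_elim
        fix y assume y: "y \<noteq> x" "y \<noteq> X n"
        have "norm (G0 (X n) y \<kappa> - G0 x y \<kappa> - DG \<kappa> (x - y) (X n - x)) \<le> norm (X n - x) + norm (X n - x)"
          using norm_triangle_ineq4[of "G0 (X n) y \<kappa> - G0 x y \<kappa>" "DG \<kappa> (x - y) (X n - x)"]
            G0_lipschitz[OF \<kappa>, of "X n" y x] DG_bounds(1)[OF \<kappa>, of "x - y" "X n - x"] y[symmetric] by linarith
        then have "norm ((G0 (X n) y \<kappa> - G0 x y \<kappa> - DG \<kappa> (x - y) (X n - x)) /\<^sub>R norm (X n - x)) \<le> 2"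
          unfolding norm_scaleR using Xx[of n] by (simp add: inverse_eq_divide pos_divide_le_eq del: diff_diff_eq)
        then show "norm (q n y) \<le> 2 * norm (f y)"
          unfolding q_def norm_mult by (intro mult_right_mono) auto
      qed
    qed measurable
    moreover have "norm (LINT y|lborel. q n y) = norm (R0 \<kappa> f (X n) - R0 \<kappa> f x - ?D (X n - x)) / norm (X n - x)" for n
    proof -
      have "(LINT y|lborel. q n y) = (LINT y|lborel. (G0 (X n) y \<kappa> * f y - G0 x y \<kappa> * f y
          - DG \<kappa> (x - y) (X n - x) * f y) /\<^sub>R norm (X n - x))"
        by (intro Bochner_Integration.integral_cong) (auto simp: q_def left_diff_distrib)
      also have "\<dots> = (R0 \<kappa> f (X n) - R0 \<kappa> f x - ?D (X n - x)) /\<^sub>R norm (X n - x)"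
        using G0_integrable[OF assms] DG_integrable[OF assms] by (simp add: R0_def)
      finally show ?thesis by (simp add: divide_inverse mult.commute)
    qed
    ultimately show "((\<lambda>z. norm (R0 \<kappa> f z - R0 \<kappa> f x - ?D (z - x)) / norm (z - x)) \<circ> X) \<longlonglongrightarrow> 0"
      using tendsto_norm_zero[of "\<lambda>n. LINT y|lborel. q n y" sequentially] by (simp add: o_def)
  qed
  show ?thesis using lin lim by (simp add: has_derivative_iff_norm)
qed

lemma R0_differentiable:
  assumes "\<kappa> > 0" "integrable lborel f"
  shows "R0 \<kappa> f differentiable (at x)"
    "partial j (R0 \<kappa> f) x = (LINT y|lborel. DG \<kappa> (x - y) (axis j 1) * f y)"
  using R0_has_derivative[OF assms, of x] has_derivative_imp_partial[OF R0_has_derivative[OF assms]]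
  by (auto simp: differentiable_def)

lemma continuous_on_R0:
  assumes "\<kappa> > 0" "integrable lborel f"
  shows "continuous_on S (R0 \<kappa> f)"
  using differentiable_imp_continuous_within[OF R0_differentiable(1)[OF assms]]
  by (blast intro: continuous_at_imp_continuous_on)

lemma continuous_on_partial_R0:
  assumes \<kappa>: "\<kappa> > 0" and f: "integrable lborel f"
  shows "continuous_on S (partial j (R0 \<kappa> f))"
proof (intro continuous_at_imp_continuous_on ballI)
  fix x :: "real^3"
  have [measurable]: "f \<in> borel_measurable lborel" using f by auto
  show "isCont (partial j (R0 \<kappa> f)) x"
    unfolding continuous_at_sequentially
  proof (intro allI impI)
    fix X :: "nat \<Rightarrow> real^3" assume X: "X \<longlonglongrightarrow> x"
    have "(\<lambda>n. LINT y|lborel. DG \<kappa> (X n - y) (axis j 1) * f y)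
        \<longlonglongrightarrow> (LINT y|lborel. DG \<kappa> (x - y) (axis j 1) * f y)"
    proof (rule integral_dominated_convergence[where w="\<lambda>y. norm (f y)"])
      show "integrable lborel (\<lambda>y. norm (f y))" using f by simp
      show "AE y in lborel. (\<lambda>n. DG \<kappa> (X n - y) (axis j 1) * f y) \<longlonglongrightarrow> DG \<kappa> (x - y) (axis j 1) * f y"
        using AE_lborel_singleton[of x]
      proof eventually_elim
        fix y assume "y \<noteq> x"
        then have "(\<lambda>n. DG \<kappa> (X n - y) (axis j 1)) \<longlonglongrightarrow> DG \<kappa> (x - y) (axis j 1)"
          by (intro isCont_tendsto_compose[OF isCont_DG] tendsto_intros X \<kappa>) auto
        then show "(\<lambda>n. DG \<kappa> (X n - y) (axis j 1) * f y) \<longlonglongrightarrow> DG \<kappa> (x - y) (axis j 1) * f y"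
          by (intro tendsto_intros)
      qed
      show "AE y in lborel. norm (DG \<kappa> (X n - y) (axis j 1) * f y) \<le> norm (f y)" for n
        using DG_bounds(1)[OF \<kappa>, of _ "axis j 1"] by (simp add: norm_mult mult_left_le_one_le)
    qed (use DG_measurable in measurable)
    then show "(partial j (R0 \<kappa> f) \<circ> X) \<longlonglongrightarrow> partial j (R0 \<kappa> f) x"
      by (simp add: o_def R0_differentiable(2)[OF assms])
  qed
qed

section \<open>The free resolvent solves the inhomogeneous equation weakly\<close>

lemma partial_translate:
  assumes "\<And>x. f differentiable (at x)"
  shows "partial j (\<lambda>z. f (z + y)) x = partial j f (x + y)" "(\<lambda>z. f (z + y)) differentiable (at x)"
proof -
  have "((\<lambda>z. z + y) has_derivative (\<lambda>h. h)) (at x)"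
    by (auto intro!: derivative_eq_intros)
  moreover have "(f has_derivative frechet_derivative f (at (x + y))) (at (x + y))"
    using assms frechet_derivative_works by blast
  ultimately have *: "((\<lambda>z. f (z + y)) has_derivative frechet_derivative f (at (x + y))) (at x)"
    using has_derivative_compose by blast
  show "partial j (\<lambda>z. f (z + y)) x = partial j f (x + y)"
    using has_derivative_imp_partial[OF *] by (simp add: partial_def)
  show "(\<lambda>z. f (z + y)) differentiable (at x)"
    using * by (auto simp: differentiable_def)
qed

lemma Ck_translate: "Ck k f \<Longrightarrow> Ck k (\<lambda>z. f (z + y))"
proof (induction k arbitrary: f)
  case 0
  then show ?case by (auto intro!: continuous_on_compose2[of UNIV f] continuous_intros)
next
  case (Suc k)
  then have "partial j (\<lambda>z. f (z + y)) = (\<lambda>z. partial j f (z + y))" for j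
    using partial_translate(1) by fastforce
  with Suc show ?case using partial_translate(2) by (metis Ck.simps(2))
qed

lemma test_function_differentiable: "test_function \<phi> \<Longrightarrow> \<phi> differentiable (at x)"
  using Ck_1D(2)[of \<phi>] by (auto simp: test_function_def)

lemma test_function_translate:
  fixes \<phi> :: "real^'n \<Rightarrow> complex"
  assumes "test_function \<phi>"
  shows "test_function (\<lambda>z. \<phi> (z + y))"
proof -
  obtain R where R: "supported_in_ball R \<phi>"
    using assms by (auto simp: test_function_def compactly_supported_iff)
  have "supported_in_ball (R + norm y) (\<lambda>z::real^'n. \<phi> (z + y))"
    unfolding supported_in_ball_def
  proof (intro allI impI)
    fix z :: "real^'n" assume "R + norm y < norm z"
    moreover have "norm z \<le> norm (z + y) + norm y"
      using norm_triangle_ineq4[of "z + y" y] by simp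
    ultimately have "R < norm (z + y)" by linarith
    then show "\<phi> (z + y) = 0" using R by (simp add: supported_in_ball_def)
  qed
  then show ?thesis
    using assms Ck_translate by (auto simp: test_function_def compactly_supported_iff)
qed

lemma laplacian_translate:
  assumes "test_function \<phi>"
  shows "laplacian (\<lambda>z. \<phi> (z + y)) = (\<lambda>z. laplacian \<phi> (z + y))"
proof -
  have "partial j (\<lambda>z. \<phi> (z + y)) = (\<lambda>z. partial j \<phi> (z + y))" for j
    using partial_translate(1)[OF test_function_differentiable[OF assms]] by blast
  moreover have "partial j (\<lambda>z. partial j \<phi> (z + y)) x = partial j (partial j \<phi>) (x + y)" for j x
    using partial_translate(1)[OF test_function_differentiable[OF test_function_partial[OF assms]]] by blast
  ultimately show ?thesis unfolding laplacian_def by simp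
qed

lemma laplacian_add_cmult:
  assumes "test_function \<phi>" "test_function \<psi>"
  shows "laplacian (\<lambda>x. \<phi> x + c * \<psi> x) x = laplacian \<phi> x + c * laplacian \<psi> x"
proof -
  have p: "partial j (\<lambda>x. \<phi> x + c * \<psi> x) = (\<lambda>x. partial j \<phi> x + c * partial j \<psi> x)"
    if "test_function \<phi>" "test_function \<psi>" for j and \<phi> \<psi> :: "real^3 \<Rightarrow> complex"
  proof
    fix x
    have "partial j (\<lambda>x. \<phi> x + c * \<psi> x) x = partial j \<phi> x + partial j (\<lambda>x. c * \<psi> x) x"
      by (intro partial_add test_function_differentiable test_function_cmult that)
    also have "partial j (\<lambda>x. c * \<psi> x) x = c * partial j \<psi> x"
      by (intro partial_bounded_linear bounded_linear_mult_right test_function_differentiable that)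
    finally show "partial j (\<lambda>x. \<phi> x + c * \<psi> x) x = partial j \<phi> x + c * partial j \<psi> x" .
  qed
  show ?thesis
    unfolding laplacian_def p[OF assms] p[OF test_function_partial[OF assms(1)] test_function_partial[OF assms(2)]]
    by (simp add: sum.distrib sum_distrib_left)
qed

lemma newton_kernel_integrable:
  assumes "Re a \<le> 0" "test_function \<psi>"
  shows "integrable lborel (\<lambda>z::real^3. exp (a * of_real (norm z)) / of_real (norm z) * \<psi> z)"
proof -
  obtain R where R: "supported_in_ball R \<psi>"
    using assms by (auto simp: test_function_def compactly_supported_iff)
  obtain B where B: "B > 0" "\<And>x. norm (\<psi> x) \<le> B * indicator (cball 0 R) x"
    using bounded_supported_in_ball[OF test_functionD(1)[OF assms(2)] R] by blast
  have [measurable]: "\<psi> \<in> borel_measurable borel"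
    using test_functionD(1)[OF assms(2)] by (auto intro: borel_measurable_continuous_onI)
  have "integrable lborel (\<lambda>z::real^3. B * (indicator (cball 0 R) z * (1 / norm z ^ 1)))"
    by (intro integrable_mult_right integrable_norm_inverse_power) simp
  then show ?thesis
  proof (rule Bochner_Integration.integrable_bound)
    show "AE z in lborel. norm (exp (a * of_real (norm z)) / of_real (norm z) * \<psi> z)
        \<le> norm (B * (indicator (cball 0 R) z * (1 / norm z ^ 1)))"
    proof (rule AE_I2)
      fix z :: "real^3"
      have "norm (exp (a * of_real (norm z))) \<le> 1"
        using assms(1) by (simp add: mult_le_0_iff)
      then have "norm (exp (a * of_real (norm z))) * (1 / norm z) * norm (\<psi> z)
          \<le> 1 * (1 / norm z) * (B * indicator (cball 0 R) z)"
        by (intro mult_mono B(2)) auto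
      then show "norm (exp (a * of_real (norm z)) / of_real (norm z) * \<psi> z)
        \<le> norm (B * (indicator (cball 0 R) z * (1 / norm z ^ 1)))"
        using B(1) by (simp add: norm_mult norm_divide mult_ac)
    qed
  qed measurable
qed

text \<open>For \<open>a = \<i> \<kappa>\<close> and \<open>a = - \<kappa>\<close> the operator
  factors as \<open>(Laplacian - a^2) (Laplacian + a^2)\<close>. After translating \<open>y\<close>
  to 0, \<open>fundamental_solution_at_0\<close> applied to
  \<open>laplacian \<psi> + a^2 \<psi>\<close> gives
  \<open>- 4 pi (laplacian \<psi> + a^2 \<psi>)\<close> at 0. Subtracting the two cases cancels the
  Laplacian and leaves \<open>8 pi \<kappa>^2 \<psi> 0\<close>, the normalisation of
  \<open>G0\<close>.\<close>

lemma G0_fundamental_solution: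
  assumes "\<kappa> > 0" and \<phi>: "test_function \<phi>"
  shows "(LINT x|lborel. G0 x y \<kappa> * (laplacian (laplacian \<phi>) x - of_real (\<kappa>^4) * \<phi> x)) = \<phi> y"
proof -
  define \<psi> where "\<psi> = (\<lambda>z. \<phi> (z + y))"
  have \<psi>: "test_function \<psi>" unfolding \<psi>_def by (rule test_function_translate[OF \<phi>])
  note L\<psi> = test_function_laplacian[OF \<psi>]
  define \<zeta> where "\<zeta> = (\<lambda>z. laplacian (laplacian \<psi>) z - of_real (\<kappa>^4) * \<psi> z)"
  have \<zeta>: "test_function \<zeta>"
    using test_function_add[OF test_function_laplacian[OF L\<psi>] test_function_cmult[OF \<psi>, of "- of_real (\<kappa>^4)"]]
    by (simp add: \<zeta>_def)
  have \<zeta>_eq: "\<zeta> = (\<lambda>z. laplacian (laplacian \<phi>) (z + y) - of_real (\<kappa>^4) * \<phi> (z + y))"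
    unfolding \<zeta>_def \<psi>_def laplacian_translate[OF \<phi>] laplacian_translate[OF test_function_laplacian[OF \<phi>]] ..
  have fund: "(LINT z|lborel. exp (a * of_real (norm z)) / of_real (norm z) * \<zeta> z)
      = - 4 * of_real pi * (laplacian \<psi> 0 + a^2 * \<psi> 0)"
    if a: "Re a \<le> 0" "a^4 = of_real (\<kappa>^4)" for a
  proof -
    have t: "test_function (\<lambda>z. laplacian \<psi> z + a^2 * \<psi> z)"
      by (intro test_function_add test_function_cmult L\<psi> \<psi>)
    have "laplacian (\<lambda>z. laplacian \<psi> z + a^2 * \<psi> z) z - a^2 * (laplacian \<psi> z + a^2 * \<psi> z) = \<zeta> z" for z
      unfolding laplacian_add_cmult[OF L\<psi> \<psi>] \<zeta>_def a(2)[symmetric]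
      by (simp add: algebra_simps power2_eq_square power4_eq_xxxx)
    with fundamental_solution_at_0[OF a(1) t] show ?thesis by simp
  qed
  have a1: "Re (\<i> * of_real \<kappa>) \<le> 0" "(\<i> * of_real \<kappa>)^4 = of_real (\<kappa>^4)"
    and a2: "Re (- of_real \<kappa>) \<le> 0" "(- of_real \<kappa> :: complex)^4 = of_real (\<kappa>^4)"
    using \<open>\<kappa> > 0\<close> by (simp_all add: power_mult_distrib)
  have c: "continuous_on UNIV (\<lambda>x. laplacian (laplacian \<phi>) x - of_real (\<kappa>^4) * \<phi> x)"
    by (intro continuous_intros test_functionD(1) test_function_laplacian \<phi>)
  then have [measurable]: "(\<lambda>x. laplacian (laplacian \<phi>) x - of_real (\<kappa>^4) * \<phi> x) \<in> borel_measurable borel"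
    by (rule borel_measurable_continuous_onI)
  have [measurable]: "(\<lambda>x. G0 x y \<kappa>) \<in> borel_measurable borel"
    unfolding G0_eq by measurable
  have "(LINT x|lborel. G0 x y \<kappa> * (laplacian (laplacian \<phi>) x - of_real (\<kappa>^4) * \<phi> x))
      = (LINT z|lborel. G0 (z + y) y \<kappa> * (laplacian (laplacian \<phi>) (z + y) - of_real (\<kappa>^4) * \<phi> (z + y)))"
    by (rule integral_lborel_translation[symmetric]) measurable
  also have "\<dots> = (LINT z|lborel. 1 / (8 * of_real pi * of_real \<kappa>^2) *
      (exp (\<i> * of_real \<kappa> * of_real (norm z)) / of_real (norm z) * \<zeta> z
        - exp (- of_real \<kappa> * of_real (norm z)) / of_real (norm z) * \<zeta> z))"
  proof (rule Bochner_Integration.integral_cong[OF refl])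
    fix z
    show "G0 (z + y) y \<kappa> * (laplacian (laplacian \<phi>) (z + y) - of_real (\<kappa>^4) * \<phi> (z + y))
      = 1 / (8 * of_real pi * of_real \<kappa>^2) *
      (exp (\<i> * of_real \<kappa> * of_real (norm z)) / of_real (norm z) * \<zeta> z
        - exp (- of_real \<kappa> * of_real (norm z)) / of_real (norm z) * \<zeta> z)"
    proof (cases "z = 0")
      case False
      then show ?thesis using \<open>\<kappa> > 0\<close>
        unfolding \<zeta>_eq G0_def by (simp add: field_simps exp_of_real[symmetric])
    qed (simp add: G0_def)
  qed
  also have "\<dots> = 1 / (8 * of_real pi * of_real \<kappa>^2) *
      (- 4 * of_real pi * (laplacian \<psi> 0 + (\<i> * of_real \<kappa>)^2 * \<psi> 0)
        - (- 4 * of_real pi * (laplacian \<psi> 0 + (- of_real \<kappa>)^2 * \<psi> 0)))"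
    by (subst integral_mult_right_zero, subst Bochner_Integration.integral_diff)
       (intro newton_kernel_integrable a1 a2 \<zeta>, intro newton_kernel_integrable a1 a2 \<zeta>,
        simp only: fund[OF a1] fund[OF a2])
  also have "\<dots> = \<psi> 0"
    using \<open>\<kappa> > 0\<close> by (simp add: field_simps power_mult_distrib)
  finally show ?thesis by (simp add: \<psi>_def)
qed

text \<open>Fubini moves the operator onto the kernel; the bound \<open>1 / \<kappa>\<close> on
  \<open>G0\<close> provides integrability on the product.\<close>

lemma R0_weak_solution:
  assumes "\<kappa> > 0" and f: "integrable lborel f" and \<phi>: "test_function \<phi>"
  shows "(LINT x|lborel. R0 \<kappa> f x * (laplacian (laplacian \<phi>) x - of_real (\<kappa>^4) * \<phi> x)) = (LINT x|lborel. f x * \<phi> x)"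
proof -
  define \<zeta> where "\<zeta> = (\<lambda>x. laplacian (laplacian \<phi>) x - of_real (\<kappa>^4) * \<phi> x)"
  have \<zeta>: "test_function \<zeta>"
    using test_function_add[OF test_function_laplacian[OF test_function_laplacian[OF \<phi>]]
        test_function_cmult[OF \<phi>, of "- of_real (\<kappa>^4)"]]
    by (simp add: \<zeta>_def)
  have \<zeta>int: "integrable lborel \<zeta>" by (rule test_function_integrable[OF \<zeta>])
  have [measurable]: "f \<in> borel_measurable lborel" "\<zeta> \<in> borel_measurable lborel"
    using f \<zeta>int by auto
  have [measurable]: "(\<lambda>(x, y). G0 x y \<kappa>) \<in> borel_measurable (lborel \<Otimes>\<^sub>M lborel)"
    unfolding G0_eq by measurable
  have prod: "integrable (lborel \<Otimes>\<^sub>M lborel) (\<lambda>(x, y). G0 x y \<kappa> * (\<zeta> x * f y))"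
  proof -
    have "integrable (lborel \<Otimes>\<^sub>M lborel) (\<lambda>(x, y). \<zeta> x * f y)"
    proof (rule lborel_pair.Fubini_integrable)
      show "integrable lborel (\<lambda>x. LINT y|lborel. norm (case (x, y) of (x, y) \<Rightarrow> \<zeta> x * f y))"
        using \<zeta>int by (simp add: norm_mult)
      show "AE x in lborel. integrable lborel (\<lambda>y. case (x, y) of (x, y) \<Rightarrow> \<zeta> x * f y)"
        using f by simp
    qed measurable
    then show ?thesis
      using integrable_bounded_mult(1)[of "lborel \<Otimes>\<^sub>M lborel" "\<lambda>(x, y). \<zeta> x * f y" "\<lambda>(x, y). G0 x y \<kappa>" "1 / \<kappa>"]
        G0_bounds(1)[OF assms(1)] by (auto simp: case_prod_unfold)
  qed
  have "(LINT x|lborel. R0 \<kappa> f x * \<zeta> x) = (LINT x|lborel. LINT y|lborel. G0 x y \<kappa> * (\<zeta> x * f y))"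
    unfolding R0_def integral_mult_left_zero[symmetric] by (simp only: mult_ac)
  also have "\<dots> = (LINT y|lborel. LINT x|lborel. G0 x y \<kappa> * (\<zeta> x * f y))"
    using lborel_pair.Fubini_integral[OF prod] by simp
  also have "\<dots> = (LINT y|lborel. (LINT x|lborel. G0 x y \<kappa> * \<zeta> x) * f y)"
    unfolding integral_mult_left_zero[symmetric] by (simp only: mult_ac)
  also have "\<dots> = (LINT y|lborel. \<phi> y * f y)"
    using G0_fundamental_solution[OF assms(1) \<phi>] by (simp add: \<zeta>_def)
  finally show ?thesis by (simp add: \<zeta>_def mult.commute)
qed

section \<open>Plane waves\<close>

lemma plane_wave_has_derivative:
  "(plane_wave \<theta> \<kappa> has_derivative (\<lambda>h. \<i> * of_real (\<kappa> * (h \<bullet> \<theta>)) * plane_wave \<theta> \<kappa> x)) (at x)"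
proof -
  have "((\<lambda>x. \<i> * complex_of_real (\<kappa> * (x \<bullet> \<theta>))) has_derivative (\<lambda>h. \<i> * of_real (\<kappa> * (h \<bullet> \<theta>)))) (at x)"
    by (auto intro!: derivative_eq_intros)
  moreover have "(exp has_derivative (\<lambda>w. plane_wave \<theta> \<kappa> x * w)) (at (\<i> * complex_of_real (\<kappa> * (x \<bullet> \<theta>))))"
    using DERIV_exp[of "\<i> * complex_of_real (\<kappa> * (x \<bullet> \<theta>))"] by (simp add: has_field_derivative_def plane_wave_def)
  ultimately show ?thesis
    unfolding plane_wave_def[of \<theta> \<kappa>] using has_derivative_compose by (fastforce simp: plane_wave_def mult.commute)
qed

lemma plane_wave_facts:
  shows "plane_wave \<theta> \<kappa> differentiable (at x)" "norm (plane_wave \<theta> \<kappa> x) = 1"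
    "partial j (plane_wave \<theta> \<kappa>) x = \<i> * of_real (\<kappa> * \<theta> $ j) * plane_wave \<theta> \<kappa> x"
    "continuous_on S (plane_wave \<theta> \<kappa>)"
proof -
  show "plane_wave \<theta> \<kappa> differentiable (at x)"
    using plane_wave_has_derivative by (auto simp: differentiable_def)
  show "norm (plane_wave \<theta> \<kappa> x) = 1" by (simp add: plane_wave_def)
  show "partial j (plane_wave \<theta> \<kappa>) x = \<i> * of_real (\<kappa> * \<theta> $ j) * plane_wave \<theta> \<kappa> x"
    using has_derivative_imp_partial[OF plane_wave_has_derivative] by (simp add: inner_axis')
  show "continuous_on S (plane_wave \<theta> \<kappa>)"
    unfolding plane_wave_def by (intro continuous_intros)
qed

text \<open>For a unit direction the Laplacian multiplies the plane wave by
  \<open>- \<kappa>^2\<close>. Two integrations by parts against test functions therefore give the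
  factor \<open>\<kappa>^4\<close>.\<close>

lemma plane_wave_weak_solution:
  assumes "norm \<theta> = 1" and \<phi>: "test_function \<phi>"
  shows "(LINT x|lborel. plane_wave \<theta> \<kappa> x * (laplacian (laplacian \<phi>) x - of_real (\<kappa>^4) * \<phi> x)) = 0"
proof -
  let ?e = "plane_wave \<theta> \<kappa>"
  define e1 where "e1 = (\<lambda>j x. \<i> * of_real (\<kappa> * \<theta> $ j) * ?e x)"
  define e2 where "e2 = (\<lambda>j x. \<i> * of_real (\<kappa> * \<theta> $ j) * (\<i> * of_real (\<kappa> * \<theta> $ j) * ?e x))"
  have d1: "dir_deriv j ?e (e1 j)" for j
    using dir_deriv_partial[of ?e j] plane_wave_facts(1) unfolding plane_wave_facts(3)[abs_def] e1_def by blast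
  have d2: "dir_deriv j (e1 j) (e2 j)" for j
    using d1[of j] unfolding dir_deriv_def e2_def e1_def
    by (intro allI has_vector_derivative_mult_right) auto
  have "(\<Sum>j\<in>UNIV. (\<theta> $ j)^2) = 1"
    using assms(1) by (simp add: norm_vec_def L2_set_def)
  then have \<theta>: "(\<Sum>j\<in>UNIV. complex_of_real (\<theta> $ j) ^ 2) = 1"
    by (metis (no_types, lifting) of_real_1 of_real_power of_real_sum sum.cong)
  have sum: "(\<Sum>j\<in>UNIV. e2 j x) = - of_real (\<kappa>^2) * ?e x" for x
  proof -
    have "e2 j x = - of_real (\<kappa>^2) * ?e x * complex_of_real (\<theta> $ j) ^ 2" for j
      by (simp add: e2_def power2_eq_square algebra_simps)
    then have "(\<Sum>j\<in>UNIV. e2 j x) = - of_real (\<kappa>^2) * ?e x * (\<Sum>j\<in>UNIV. complex_of_real (\<theta> $ j) ^ 2)"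
      by (simp only: sum_distrib_left)
    then show ?thesis unfolding \<theta> by simp
  qed
  have lap: "(LINT x|lborel. ?e x * laplacian \<psi> x) = - of_real (\<kappa>^2) * (LINT x|lborel. ?e x * \<psi> x)"
    if "test_function \<psi>" for \<psi>
  proof -
    have "(LINT x|lborel. ?e x * laplacian \<psi> x) = (LINT x|lborel. (\<Sum>j\<in>UNIV. e2 j x) * \<psi> x)"
      by (rule integral_laplacian_by_parts[where ?u1.0=e1, OF d1 d2 _ _ _ that])
         (auto simp: e1_def e2_def intro!: continuous_intros plane_wave_facts)
    then show ?thesis unfolding sum by (simp add: mult.assoc)
  qed
  note L = test_function_laplacian[OF \<phi>]
  have "(LINT x|lborel. ?e x * (laplacian (laplacian \<phi>) x - of_real (\<kappa>^4) * \<phi> x))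
      = (LINT x|lborel. ?e x * laplacian (laplacian \<phi>) x - of_real (\<kappa>^4) * (?e x * \<phi> x))"
    by (simp add: algebra_simps)
  also have "\<dots> = (LINT x|lborel. ?e x * laplacian (laplacian \<phi>) x) - of_real (\<kappa>^4) * (LINT x|lborel. ?e x * \<phi> x)"
    by (subst Bochner_Integration.integral_diff)
       (auto intro!: test_function_mult_integrable test_function_laplacian L \<phi> integrable_mult_right plane_wave_facts)
  also have "\<dots> = 0"
    unfolding lap[OF L] lap[OF \<phi>] by (simp add: power2_eq_square power4_eq_xxxx)
  finally show ?thesis .
qed

section \<open>Existence and uniqueness of the scattering solution\<close>

lemma lower_order_add:
  assumes "u differentiable (at x)" "w differentiable (at x)"
  shows "lower_order A V (\<lambda>x. u x + w x) x = lower_order A V u x + lower_order A V w x"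
  unfolding lower_order_def partial_add[OF assms] by (simp add: sum.distrib algebra_simps)

lemma lower_order_minus:
  assumes "u differentiable (at x)"
  shows "lower_order A V (\<lambda>x. - u x) x = - lower_order A V u x"
  unfolding lower_order_def partial_bounded_linear[OF bounded_linear_minus[OF bounded_linear_ident] assms]
  by (simp add: sum_negf)

lemma R0_diff:
  assumes "\<kappa> > 0" "integrable lborel f" "integrable lborel g"
  shows "R0 \<kappa> (\<lambda>y. f y - g y) x = R0 \<kappa> f x - R0 \<kappa> g x"
  using G0_integrable[OF assms(1,2)] G0_integrable[OF assms(1,3)]
  by (simp add: R0_def right_diff_distrib)

lemma lower_order_R0_diff:
  assumes "\<kappa> > 0" "integrable lborel f" "integrable lborel g"
  shows "lower_order A V (R0 \<kappa> (\<lambda>y. f y - g y)) x = lower_order A V (R0 \<kappa> f) x - lower_order A V (R0 \<kappa> g) x"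
proof -
  have "partial j (R0 \<kappa> (\<lambda>y. f y - g y)) x = partial j (R0 \<kappa> f) x - partial j (R0 \<kappa> g) x" for j
    using R0_differentiable(2)[OF assms(1)] assms DG_integrable[OF assms(1)]
    by (simp add: right_diff_distrib)
  then show ?thesis
    unfolding lower_order_def R0_diff[OF assms] by (simp add: sum_subtractf right_diff_distrib)
qed

text \<open>The exponent belongs to the weight with \<open>\<delta> = 2\<close>. In polar
  coordinates the integrand is at most \<open>4 pi / (1 + r)^2\<close>, so the integrals over balls
  stay below \<open>4 pi\<close> and monotone convergence applies.\<close>

lemma integrable_weight: "integrable lborel (\<lambda>x::real^3. (1 + norm x) powr (- 4))"
proof -
  define f where "f = (\<lambda>(n::nat) (x::real^3). indicator (cball 0 (real n + 1)) x * (1 + norm x) powr (- 4))"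
  define g where "g = (\<lambda>r::real. 4 * pi * r^2 * (1 + r) powr (- 4))"
  have [measurable]: "cball (0::real^3) r \<in> sets borel" for r by simp
  have G: "integrable lborel (\<lambda>r. indicator {0..real n + 1} r * (4 * pi * (1 / (1 + r)^2)))" for n
  proof -
    have "integrable lborel (\<lambda>r. indicator {0..real n + 1} r *\<^sub>R (4 * pi * (1 / (1 + r)^2)))"
      by (intro borel_integrable_compact continuous_intros) auto
    then show ?thesis by simp
  qed
  have gG: "indicator {0..real n + 1} r * g r \<le> indicator {0..real n + 1} r * (4 * pi * (1 / (1 + r)^2))"
    "0 \<le> indicator {0..real n + 1} r * g r" for n r
  proof -
    have "g r \<le> 4 * pi * (1 / (1 + r)^2) \<and> 0 \<le> g r" if "r \<ge> 0"
    proof -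
      have "(1 + r) powr (- 4) = 1 / (1 + r)^4"
        using that by (simp add: powr_minus_divide powr_numeral)
      moreover have "r^2 * (1 / (1 + r)^4) \<le> 1 / (1 + r)^2"
      proof -
        have "r^2 \<le> (1 + r)^2" using that by (intro power_mono) auto
        then have "r^2 / (1 + r)^4 \<le> (1 + r)^2 / (1 + r)^4" using that by (intro divide_right_mono) auto
        also have "(1 + r)^4 = (1 + r)^2 * (1 + r)^2" by (simp flip: power_add)
        also have "(1 + r)^2 / ((1 + r)^2 * (1 + r)^2) = 1 / (1 + r)^2"
        proof -
          have "(1 + r)^2 \<noteq> 0" using that by simp
          then show ?thesis by (simp only: divide_divide_eq_left[symmetric] divide_self not_False_eq_True)
        qed
        finally show ?thesis by simp
      qed
      ultimately have "(1 + r) powr (- 4) = 1 / (1 + r)^4" "4 * pi * (r^2 * (1 / (1 + r)^4)) \<le> 4 * pi * (1 / (1 + r)^2)"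
        by (auto intro!: mult_left_mono simp del: times_divide_eq_right)
      then show ?thesis unfolding g_def by (simp add: mult.assoc)
    qed
    then show "indicator {0..real n + 1} r * g r \<le> indicator {0..real n + 1} r * (4 * pi * (1 / (1 + r)^2))"
      "0 \<le> indicator {0..real n + 1} r * g r"
      by (auto simp: indicator_def)
  qed
  have g_int: "integrable lborel (\<lambda>r. indicator {0..real n + 1} r * g r)" for n
    by (rule Bochner_Integration.integrable_bound[OF G[of n]]) (use gG[of n] in \<open>auto simp: g_def\<close>)
  have [measurable]: "(\<lambda>r::real. (1 + r) powr (- 4)) \<in> borel_measurable borel" by measurable
  have f_int: "integrable lborel (f n)" for n
    unfolding f_def using integrable_radial[of "\<lambda>r. (1 + r) powr (- 4)" "real n + 1"] g_int[of n]
    by (simp add: g_def)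
  have f_le: "integral\<^sup>L lborel (f n) \<le> 4 * pi" for n
  proof -
    have "integral\<^sup>L lborel (f n) = (LINT r|lborel. indicator {0..real n + 1} r * g r)"
      unfolding f_def g_def by (subst integral_radial) auto
    also have "\<dots> \<le> (LINT r|lborel. indicator {0..real n + 1} r * (4 * pi * (1 / (1 + r)^2)))"
      by (intro integral_mono g_int G gG)
    also have "\<dots> = (LINT r|lborel. (4 * pi * (1 / (1 + r)^2)) * indicator {0..real n + 1} r)"
      by (simp only: mult.commute)
    also have "\<dots> = - 4 * pi / (1 + (real n + 1)) - (- 4 * pi / (1 + 0))"
    proof (rule integral_FTC_Icc_real)
      fix r :: real assume r: "0 \<le> r" "r \<le> real n + 1"
      then have "1 + r \<noteq> 0" by simp
      then show "((\<lambda>r. - 4 * pi / (1 + r)) has_real_derivative 4 * pi * (1 / (1 + r)^2)) (at r)"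
        by (auto intro!: derivative_eq_intros simp: field_simps power2_eq_square)
      show "isCont (\<lambda>r. 4 * pi * (1 / (1 + r)^2)) r"
        using \<open>1 + r \<noteq> 0\<close> by (intro continuous_intros) auto
    qed simp
    also have "\<dots> \<le> 4 * pi" by simp
    finally show ?thesis .
  qed
  have f_mono: "f m x \<le> f n x" if "m \<le> n" for m n x
    using that unfolding f_def by (auto simp: indicator_def)
  have "incseq (\<lambda>n. integral\<^sup>L lborel (f n))"
    unfolding incseq_def using f_mono f_int by (auto intro!: integral_mono)
  then obtain L where L: "(\<lambda>n. integral\<^sup>L lborel (f n)) \<longlonglongrightarrow> L"
    using f_le by (metis incseq_convergent)
  show ?thesis
  proof (rule integrable_monotone_convergence[OF f_int _ _ L])
    show "AE x in lborel. mono (\<lambda>n. f n x)" using f_mono by (auto simp: mono_def)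
    show "AE x in lborel. (\<lambda>n. f n x) \<longlonglongrightarrow> (1 + norm x) powr (- 4)"
    proof (rule AE_I2)
      fix x :: "real^3"
      obtain N :: nat where N: "norm x \<le> real N" using real_arch_simple by blast
      have "\<forall>\<^sub>F n in sequentially. f n x = (1 + norm x) powr (- 4)"
        using eventually_ge_at_top[of N] by eventually_elim (use N in \<open>auto simp: f_def indicator_def\<close>)
      then show "(\<lambda>n. f n x) \<longlonglongrightarrow> (1 + norm x) powr (- 4)" by (rule tendsto_eventually)
    qed
  qed measurable
qed

text \<open>Because \<open>\<delta> = 2\<close> is admissible and makes the weight integrable,
  boundedness of the scattered wave and its gradient suffices; no decay estimate is
  required.\<close>

lemma weighted_L2_bounded:
  fixes g :: "real^3 \<Rightarrow> 'b::{real_normed_vector, second_countable_topology}"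
  assumes "g \<in> borel_measurable lborel" "\<And>x. norm (g x) \<le> b"
  shows "weighted_L2 2 g"
  unfolding weighted_L2_def
proof
  have [measurable]: "g \<in> borel_measurable lborel" by (rule assms)
  have "integrable lborel (\<lambda>x::real^3. (1 + norm x) powr (- 4) * b^2)"
    using integrable_weight by (rule integrable_mult_left)
  then show "integrable lborel (\<lambda>x. (1 + norm x) powr (- 2 * 2) * (norm (g x))^2)"
  proof (rule Bochner_Integration.integrable_bound)
    show "AE x in lborel. norm ((1 + norm x) powr (- 2 * 2) * (norm (g x))^2) \<le> norm ((1 + norm x) powr (- 4) * b^2)"
      using power_mono[OF assms(2) norm_ge_zero, of _ 2] by (auto intro!: mult_left_mono simp: abs_mult)
  qed measurable
qed (rule assms)

text \<open>The radius \<open>2 * R\<close> covers all differences of two points of the ball of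
  radius \<open>R\<close>; hence this number bounds the Newton potential of that ball at each of its
  points.\<close>

definition newton_mass :: "real \<Rightarrow> real"
  where "newton_mass R = (LINT z|lborel. indicator (cball (0::real^3) (2 * R)) z * (1 / norm z))"

lemma newton_mass_nonneg: "newton_mass R \<ge> 0"
  unfolding newton_mass_def by (intro Bochner_Integration.integral_nonneg) auto

lemma newton_kernel_local:
  assumes "norm x \<le> R"
  shows "integrable lborel (\<lambda>y::real^3. indicator (cball 0 R) y * (1 / norm (x - y)))"
    "(LINT y|lborel. indicator (cball 0 R) y * (1 / norm (x - y))) \<le> newton_mass R"
proof -
  let ?k = "\<lambda>z::real^3. indicator (cball 0 (2 * R)) z * (1 / norm z) :: real"
  have [measurable]: "cball (0::real^3) r \<in> sets borel" for r by simp
  have int: "integrable lborel ?k"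
    using integrable_norm_inverse_power[of 1 "2 * R"] by simp
  have le: "indicator (cball 0 R) y * (1 / norm (x - y)) \<le> ?k (y + (- x))" for y
    using norm_triangle_ineq4[of y x] assms by (auto simp: indicator_def norm_minus_commute)
  have intk: "integrable lborel (\<lambda>y. ?k (y + (- x)))"
    by (rule integrable_lborel_translation[OF int])
  show 1: "integrable lborel (\<lambda>y::real^3. indicator (cball 0 R) y * (1 / norm (x - y)))"
    by (rule Bochner_Integration.integrable_bound[OF intk]) (use le in auto)
  have "(LINT y|lborel. indicator (cball 0 R) y * (1 / norm (x - y))) \<le> (LINT y|lborel. ?k (y + (- x)))"
    by (intro integral_mono 1 intk le)
  also have "\<dots> = newton_mass R"
    unfolding newton_mass_def by (rule integral_lborel_translation) measurable
  finally show "(LINT y|lborel. indicator (cball 0 R) y * (1 / norm (x - y))) \<le> newton_mass R" .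
qed

text \<open>One estimate for both the kernel \<open>G0\<close> and its gradient \<open>DG\<close>,
  which differ only in the constant \<open>b\<close>.\<close>

lemma kernel_integral_local_bound:
  fixes K f :: "real^3 \<Rightarrow> complex"
  assumes "norm x \<le> R" and K: "\<And>y. norm (K y) \<le> b / norm (x - y)" "K \<in> borel_measurable borel"
    and f: "\<And>y. norm (f y) \<le> m" "supported_in_ball R f" "f \<in> borel_measurable lborel"
  shows "integrable lborel (\<lambda>y. K y * f y)" "norm (LINT y|lborel. K y * f y) \<le> b * m * newton_mass R"
proof -
  let ?w = "\<lambda>y. (b * m) * (indicator (cball 0 R) y * (1 / norm (x - y)))"
  have m: "m \<ge> 0" using f(1) norm_ge_zero order_trans by blast
  have b: "b \<ge> 0"
  proof (rule ccontr)
    assume "\<not> b \<ge> 0"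
    obtain y where "y \<noteq> x" using UNIV_not_singleton by blast
    with \<open>\<not> b \<ge> 0\<close> have "b / norm (x - y) < 0" by (simp add: divide_neg_pos)
    with K(1)[of y] show False using norm_ge_zero[of "K y"] by linarith
  qed
  have int: "integrable lborel ?w"
    by (intro integrable_mult_right newton_kernel_local assms)
  have le: "norm (K y * f y) \<le> ?w y" for y
  proof (cases "y \<in> cball 0 R")
    case True
    then show ?thesis
      using mult_mono[OF K(1) f(1)[of y], of y] b by (simp add: norm_mult)
  next
    case False
    then show ?thesis using f(2) by (simp add: supported_in_ball_def)
  qed
  show 1: "integrable lborel (\<lambda>y. K y * f y)"
  proof (rule Bochner_Integration.integrable_bound[OF int])
    show "AE y in lborel. norm (K y * f y) \<le> norm (?w y)"
      by (rule AE_I2, rule order_trans[OF le]) (simp only: real_norm_def abs_ge_self)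
  qed (use K(2) f(3) in auto)
  have "norm (LINT y|lborel. K y * f y) \<le> (LINT y|lborel. norm (K y * f y))"
    by (rule integral_norm_bound)
  also have "\<dots> \<le> integral\<^sup>L lborel ?w"
    using 1 int le by (intro integral_mono) auto
  also have "\<dots> = (b * m) * (LINT y|lborel. indicator (cball 0 R) y * (1 / norm (x - y)))"
    by (rule integral_mult_right_zero)
  also have "\<dots> \<le> (b * m) * newton_mass R"
    by (intro mult_left_mono newton_kernel_local(2) assms mult_nonneg_nonneg b m)
  finally show "norm (LINT y|lborel. K y * f y) \<le> b * m * newton_mass R" .
qed

text \<open>The single constant \<open>a\<close> bounds the three components of \<open>A\<close> and
  also \<open>V\<close>; this is the origin of the recurring factor \<open>4 * a\<close>. Only
  continuity is recorded, enough for the fixed point and for the asymptotics.\<close>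

locale potential =
  fixes A :: "real^3 \<Rightarrow> complex^3" and V :: "real^3 \<Rightarrow> complex" and R a :: real
  assumes A_cont: "continuous_on UNIV (\<lambda>x. A x $ j)" and V_cont: "continuous_on UNIV V"
    and A_supp: "supported_in_ball R (\<lambda>x. A x $ j)" and V_supp: "supported_in_ball R V"
    and A_bound: "norm (A x $ j) \<le> a" and V_bound: "norm (V x) \<le> a"
    and R_pos: "R > 0" and a_pos: "a > 0"
begin

abbreviation "PR \<equiv> newton_mass R"

text \<open>The term \<open>8 * a * PR\<close> makes the fixed-point map contract by
  \<open>1 / 2\<close>; the maximum with 1 allows \<open>1 / \<kappa>^2\<close> to be estimated by
  \<open>1 / \<kappa>\<close>.\<close>

definition \<kappa>0 :: real where "\<kappa>0 = max 1 (8 * a * PR)"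

lemma \<kappa>0: "\<kappa> \<ge> \<kappa>0 \<Longrightarrow> \<kappa> \<ge> 1" "\<kappa> \<ge> \<kappa>0 \<Longrightarrow> 4 * a * PR / \<kappa> \<le> 1 / 2"
proof -
  assume "\<kappa> \<ge> \<kappa>0"
  then have "\<kappa> \<ge> 1" "8 * a * PR \<le> \<kappa>" by (simp_all add: \<kappa>0_def)
  then show "\<kappa> \<ge> 1" "4 * a * PR / \<kappa> \<le> 1 / 2" by (simp_all add: pos_divide_le_eq)
qed

lemma lower_order_cont:
  assumes "\<And>j. continuous_on UNIV (partial j u)" "continuous_on UNIV u"
  shows "continuous_on UNIV (lower_order A V u)"
  unfolding lower_order_def by (intro continuous_intros A_cont V_cont assms)

lemma lower_order_supp: "supported_in_ball R (lower_order A V u)"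
  using A_supp V_supp by (simp add: supported_in_ball_def lower_order_def)

lemma lower_order_bound:
  assumes "\<And>j. norm x \<le> R \<Longrightarrow> norm (partial j u x) \<le> b" "norm x \<le> R \<Longrightarrow> norm (u x) \<le> b" "b \<ge> 0"
  shows "norm (lower_order A V u x) \<le> 4 * a * b"
proof (cases "norm x \<le> R")
  case True
  have "norm (lower_order A V u x) \<le> (\<Sum>j\<in>UNIV. norm (A x $ j * partial j u x)) + norm (V x * u x)"
    unfolding lower_order_def by (intro norm_triangle_le add_mono norm_sum) simp
  also have "\<dots> \<le> (\<Sum>j\<in>(UNIV::3 set). a * b) + a * b"
    unfolding norm_mult using assms True A_bound V_bound a_pos
    by (intro add_mono sum_mono mult_mono) auto
  finally show ?thesis by simp
next
  case False
  then have "lower_order A V u x = 0"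
    using lower_order_supp[of u] by (simp add: supported_in_ball_def)
  then show ?thesis using assms(3) a_pos by simp
qed

lemma R0_local_bounds:
  assumes "\<kappa> \<ge> 1" "continuous_on UNIV f" "supported_in_ball R f" "\<And>y. norm (f y) \<le> m" "norm x \<le> R"
  shows "norm (partial j (R0 \<kappa> f) x) \<le> m * PR / \<kappa>" "norm (R0 \<kappa> f x) \<le> m * PR / \<kappa>^2"
proof -
  have int: "integrable lborel f" by (rule integrable_supported_in_ball[OF assms(2,3)])
  then have meas: "f \<in> borel_measurable lborel" by simp
  have "norm (DG \<kappa> (x - y) (axis j 1)) \<le> (1 / \<kappa>) / norm (x - y)" for y
    using DG_bounds(2)[of \<kappa> "x - y" "axis j 1"] assms(1) by simp
  from kernel_integral_local_bound(2)[OF assms(5) this DG_measurable assms(4,3) meas]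
  show "norm (partial j (R0 \<kappa> f) x) \<le> m * PR / \<kappa>"
    using assms(1) by (subst R0_differentiable(2)) (auto simp: int)
  have "norm (G0 x y \<kappa>) \<le> (1 / \<kappa>^2) / norm (x - y)" for y
    using G0_bounds(2)[of \<kappa> x y] assms(1) by simp
  from kernel_integral_local_bound(2)[OF assms(5) this G0_measurable assms(4,3) meas]
  show "norm (R0 \<kappa> f x) \<le> m * PR / \<kappa>^2"
    by (simp add: R0_def)
qed

text \<open>This is the gain of \<open>1 / \<kappa>\<close> per Born iteration, in the supremum norm
  of the density.\<close>

lemma lower_order_R0_bound:
  assumes "\<kappa> \<ge> 1" "continuous_on UNIV f" "supported_in_ball R f" "\<And>y. norm (f y) \<le> m"
  shows "norm (lower_order A V (R0 \<kappa> f) x) \<le> 4 * a * (m * PR / \<kappa>)"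
proof (rule lower_order_bound)
  have m: "m \<ge> 0" using assms(4) norm_ge_zero order_trans by blast
  then show "m * PR / \<kappa> \<ge> 0" using assms(1) newton_mass_nonneg by simp
  show "norm (partial j (R0 \<kappa> f) x) \<le> m * PR / \<kappa>" if "norm x \<le> R" for j
    by (rule R0_local_bounds(1)[OF assms that])
  show "norm (R0 \<kappa> f x) \<le> m * PR / \<kappa>" if "norm x \<le> R"
  proof -
    have "norm (R0 \<kappa> f x) \<le> m * PR / \<kappa>^2" by (rule R0_local_bounds(2)[OF assms that])
    also have "\<dots> \<le> m * PR / \<kappa>"
      using assms(1) m newton_mass_nonneg self_le_power[of \<kappa> 2] by (intro divide_left_mono) auto
    finally show ?thesis .
  qed
qed

lemma lower_order_R0_cont:
  assumes "\<kappa> > 0" "integrable lborel f"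
  shows "continuous_on UNIV (lower_order A V (R0 \<kappa> f))"
  by (intro lower_order_cont continuous_on_partial_R0 continuous_on_R0 assms)

text \<open>Solving for the density \<open>f\<close> instead of the field \<open>u\<close> keeps the
  problem on the support ball. Banach's theorem is applied in the closed set of bounded continuous
  functions vanishing outside it.\<close>

lemma ex1_density:
  assumes \<kappa>: "\<kappa> \<ge> \<kappa>0" and g: "continuous_on UNIV g" "supported_in_ball R g"
  shows "\<exists>!f. continuous_on UNIV f \<and> supported_in_ball R f \<and> f = (\<lambda>x. g x - lower_order A V (R0 \<kappa> f) x)"
proof -
  have \<kappa>1: "\<kappa> \<ge> 1" "\<kappa> > 0" using \<kappa>0(1)[OF \<kappa>] by auto
  \<comment> \<open>Prescribing the value set \<open>{0}\<close> outside the ball gives the support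
    condition in a form whose closedness is immediate.\<close>
  define S where "S = (PiC {x. R < norm x} (\<lambda>_. {0}) :: ((real^3) \<Rightarrow>\<^sub>C complex) set)"
  have S: "f \<in> S \<longleftrightarrow> supported_in_ball R (apply_bcontfun f)" for f
    by (auto simp: S_def mem_PiC_iff supported_in_ball_def)
  have int: "integrable lborel (apply_bcontfun f)" if "f \<in> S" for f
    using that S by (intro integrable_supported_in_ball) auto
  define \<Phi> where "\<Phi> = (\<lambda>f. Bcontfun (\<lambda>x. g x - lower_order A V (R0 \<kappa> (apply_bcontfun f)) x))"
  have \<Phi>c: "continuous_on UNIV (\<lambda>x. g x - lower_order A V (R0 \<kappa> f) x)" if "integrable lborel f" for f
    by (intro continuous_intros g lower_order_R0_cont that \<kappa>1)
  have \<Phi>s: "supported_in_ball R (\<lambda>x. g x - lower_order A V (R0 \<kappa> f) x)" for f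
    using g(2) lower_order_supp[of "R0 \<kappa> f"] by (simp add: supported_in_ball_def)
  have bcont: "h \<in> bcontfun" if h: "continuous_on UNIV h" "supported_in_ball R h" for h :: "real^3 \<Rightarrow> complex"
  proof -
    obtain B where B: "B > 0" "\<And>x. norm (h x) \<le> B * indicator (cball 0 R) x"
      using bounded_supported_in_ball[OF h] by blast
    have "norm (h x) \<le> B" for x
      using B(2)[of x] B(1) by (cases "x \<in> cball 0 R") (auto simp: indicator_def)
    then show ?thesis by (rule bcontfun_normI[OF h(1)])
  qed
  have \<Phi>: "apply_bcontfun (\<Phi> f) = (\<lambda>x. g x - lower_order A V (R0 \<kappa> (apply_bcontfun f)) x)" if "f \<in> S" for f
    unfolding \<Phi>_def by (rule Bcontfun_inverse[OF bcont[OF \<Phi>c[OF int[OF that]] \<Phi>s]])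
  have "\<exists>!f\<in>S. \<Phi> f = f"
  proof (rule Banach_fix)
    show "complete S" unfolding S_def complete_eq_closed by (intro closed_PiC) auto
    show "S \<noteq> {}" using S[of 0] by (auto simp: supported_in_ball_def)
    show "\<Phi> ` S \<subseteq> S" using \<Phi> \<Phi>s S by auto
    show "dist (\<Phi> f) (\<Phi> h) \<le> 1 / 2 * dist f h" if fh: "f \<in> S" "h \<in> S" for f h
    proof (rule dist_bound)
      fix x
      let ?d = "\<lambda>y. apply_bcontfun f y - apply_bcontfun h y"
      have "dist (apply_bcontfun (\<Phi> f) x) (apply_bcontfun (\<Phi> h) x)
          = norm (lower_order A V (R0 \<kappa> ?d) x)"
        unfolding \<Phi>[OF fh(1)] \<Phi>[OF fh(2)] lower_order_R0_diff[OF \<kappa>1(2) int[OF fh(1)] int[OF fh(2)]]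
        by (simp add: dist_norm norm_minus_commute)
      also have "\<dots> \<le> 4 * a * (dist f h * PR / \<kappa>)"
      proof (rule lower_order_R0_bound[OF \<kappa>1(1)])
        show "continuous_on UNIV ?d" by (intro continuous_intros continuous_on_apply_bcontfun)
        show "supported_in_ball R ?d" using fh S by (simp add: supported_in_ball_def)
        show "norm (?d y) \<le> dist f h" for y
          using dist_bounded[of f y h] by (simp add: dist_norm)
      qed
      also have "\<dots> = (4 * a * PR / \<kappa>) * dist f h" by (simp add: field_simps)
      also have "\<dots> \<le> 1 / 2 * dist f h"
        using \<kappa>0(2)[OF \<kappa>] by (intro mult_right_mono) auto
      finally show "dist (apply_bcontfun (\<Phi> f) x) (apply_bcontfun (\<Phi> h) x) \<le> 1 / 2 * dist f h" .
    qed
  qed auto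
  then obtain f where f0: "f \<in> S \<and> \<Phi> f = f" and uniq: "\<forall>h. h \<in> S \<and> \<Phi> h = h \<longrightarrow> h = f"
    by (rule ex1E)
  note f = conjunct1[OF f0] conjunct2[OF f0]
  show ?thesis
  proof (rule ex1I[of _ "apply_bcontfun f"])
    show "continuous_on UNIV (apply_bcontfun f) \<and> supported_in_ball R (apply_bcontfun f) \<and>
        apply_bcontfun f = (\<lambda>x. g x - lower_order A V (R0 \<kappa> (apply_bcontfun f)) x)"
    proof (intro conjI)
      show "supported_in_ball R (apply_bcontfun f)" using f(1) S by blast
      show "apply_bcontfun f = (\<lambda>x. g x - lower_order A V (R0 \<kappa> (apply_bcontfun f)) x)"
        using \<Phi>[OF f(1)] unfolding f(2) .
    qed (rule continuous_on_apply_bcontfun)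
    fix h assume h: "continuous_on UNIV h \<and> supported_in_ball R h \<and> h = (\<lambda>x. g x - lower_order A V (R0 \<kappa> h) x)"
    have "h \<in> bcontfun" by (rule bcont[OF conjunct1[OF h] conjunct1[OF conjunct2[OF h]]])
    then obtain h' where h': "h = apply_bcontfun h'" by (rule bcontfunE)
    have hS: "h' \<in> S" using conjunct1[OF conjunct2[OF h]] S unfolding h' by blast
    have "apply_bcontfun (\<Phi> h') = h"
      by (rule trans[OF \<Phi>[OF hS, folded h'] conjunct2[OF conjunct2[OF h], symmetric]])
    then have "\<Phi> h' = h'" unfolding h' by (simp only: apply_bcontfun_inject)
    then show "h = apply_bcontfun f" using uniq hS h' by blast
  qed
qed

section \<open>The density of the scattered wave\<close>

definition source :: "real^3 \<Rightarrow> real \<Rightarrow> real^3 \<Rightarrow> complex"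
  where "source \<theta> \<kappa> = lower_order A V (plane_wave \<theta> \<kappa>)"

lemma source_cont: "continuous_on UNIV (source \<theta> \<kappa>)"
  unfolding source_def
proof (rule lower_order_cont)
  have "partial j (plane_wave \<theta> \<kappa>) = (\<lambda>x. \<i> * of_real (\<kappa> * \<theta> $ j) * plane_wave \<theta> \<kappa> x)" for j
    using plane_wave_facts(3) by blast
  then show "continuous_on UNIV (partial j (plane_wave \<theta> \<kappa>))" for j
    by (simp only:) (intro continuous_intros plane_wave_facts)
qed (rule plane_wave_facts)

lemma source_supp: "supported_in_ball R (source \<theta> \<kappa>)"
  unfolding source_def by (rule lower_order_supp)

lemma source_bound:
  assumes "norm \<theta> = 1" "\<kappa> \<ge> 1"
  shows "norm (source \<theta> \<kappa> x) \<le> 4 * a * \<kappa>"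
  unfolding source_def
proof (rule lower_order_bound)
  show "norm (partial j (plane_wave \<theta> \<kappa>) x) \<le> \<kappa>" for j
    using assms component_le_norm_cart[of \<theta> j]
    by (simp add: plane_wave_facts norm_mult abs_mult mult_left_le)
  show "norm (plane_wave \<theta> \<kappa> x) \<le> \<kappa>" using assms by (simp add: plane_wave_facts)
qed (use assms in auto)

text \<open>For \<open>\<kappa> \<ge> \<kappa>0\<close> and a unit direction this turns out to be
  \<open>(A \<cdot> \<nabla> + V) u\<close>, the quantity that the scattering amplitude
  integrates.\<close>

definition scat_density :: "real^3 \<Rightarrow> real \<Rightarrow> real^3 \<Rightarrow> complex"
  where "scat_density \<theta> \<kappa> = (THE f. continuous_on UNIV f \<and> supported_in_ball R f \<and>
    f = (\<lambda>x. source \<theta> \<kappa> x - lower_order A V (R0 \<kappa> f) x))"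

lemma scat_density:
  assumes "\<kappa> \<ge> \<kappa>0"
  shows "continuous_on UNIV (scat_density \<theta> \<kappa>)" "supported_in_ball R (scat_density \<theta> \<kappa>)"
    "scat_density \<theta> \<kappa> x = source \<theta> \<kappa> x - lower_order A V (R0 \<kappa> (scat_density \<theta> \<kappa>)) x"
proof -
  have *: "continuous_on UNIV (scat_density \<theta> \<kappa>) \<and> supported_in_ball R (scat_density \<theta> \<kappa>) \<and>
    scat_density \<theta> \<kappa> = (\<lambda>x. source \<theta> \<kappa> x - lower_order A V (R0 \<kappa> (scat_density \<theta> \<kappa>)) x)"
    unfolding scat_density_def by (rule theI'[OF ex1_density[OF assms source_cont source_supp]])
  then show "continuous_on UNIV (scat_density \<theta> \<kappa>)" "supported_in_ball R (scat_density \<theta> \<kappa>)"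
    by (rule conjunct1, rule conjunct1[OF conjunct2])
  show "scat_density \<theta> \<kappa> x = source \<theta> \<kappa> x - lower_order A V (R0 \<kappa> (scat_density \<theta> \<kappa>)) x"
    by (rule fun_cong[OF conjunct2[OF conjunct2[OF *]]])
qed

lemma scat_density_unique:
  assumes "\<kappa> \<ge> \<kappa>0" "continuous_on UNIV f" "supported_in_ball R f"
    "\<And>x. f x = source \<theta> \<kappa> x - lower_order A V (R0 \<kappa> f) x"
  shows "f = scat_density \<theta> \<kappa>"
proof -
  have *: "f = (\<lambda>x. source \<theta> \<kappa> x - lower_order A V (R0 \<kappa> f) x)" by (rule ext) (rule assms(4))
  show ?thesis
    unfolding scat_density_def
    by (rule the1_equality[OF ex1_density[OF assms(1) source_cont source_supp], symmetric])
       (intro conjI assms(2,3) *)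
qed

lemma lower_order_total_field:
  assumes "\<kappa> > 0" "integrable lborel f"
  shows "lower_order A V (\<lambda>x. plane_wave \<theta> \<kappa> x + - R0 \<kappa> f x) x = source \<theta> \<kappa> x - lower_order A V (R0 \<kappa> f) x"
proof -
  have "(\<lambda>x. - R0 \<kappa> f x) differentiable (at x)"
    by (intro differentiable_minus R0_differentiable(1) assms)
  then show ?thesis
    unfolding source_def
    by (subst lower_order_add) (simp_all add: plane_wave_facts lower_order_minus R0_differentiable(1)[OF assms])
qed

text \<open>Applying the perturbation to this field returns the density by the fixed-point equation.
  The weak equation then adds that of the plane wave to minus that of \<open>R0\<close>, and the
  weighted conditions hold with \<open>\<delta> = 2\<close> because the scattered wave and its
  gradient are bounded.\<close>

lemma scattering_solution_density:
  assumes \<kappa>: "\<kappa> \<ge> \<kappa>0" and \<theta>: "norm \<theta> = 1"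
  shows "is_scattering_solution A V \<theta> \<kappa> (\<lambda>x. plane_wave \<theta> \<kappa> x + - R0 \<kappa> (scat_density \<theta> \<kappa>) x)"
    (is "is_scattering_solution A V \<theta> \<kappa> ?u")
proof -
  let ?f = "scat_density \<theta> \<kappa>"
  have \<kappa>1: "\<kappa> > 0" using \<kappa>0(1)[OF \<kappa>] by simp
  have int: "integrable lborel ?f" by (rule integrable_supported_in_ball[OF scat_density(1,2)[OF \<kappa>]])
  have lo: "lower_order A V ?u = ?f"
    by (intro ext) (simp only: lower_order_total_field[OF \<kappa>1 int] scat_density(3)[OF \<kappa>, symmetric])
  have diff: "(\<lambda>x. - R0 \<kappa> ?f x) differentiable (at x)" for x
    by (intro differentiable_minus R0_differentiable(1) \<kappa>1 int)
  have weak: "(LINT x|lborel. ?u x * (laplacian (laplacian \<phi>) x - of_real (\<kappa>^4) * \<phi> x) + ?f x * \<phi> x) = 0"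
    if \<phi>: "test_function \<phi>" for \<phi>
  proof -
    define \<zeta> where "\<zeta> = (\<lambda>x. laplacian (laplacian \<phi>) x - of_real (\<kappa>^4) * \<phi> x)"
    have \<zeta>: "test_function \<zeta>"
      using test_function_add[OF test_function_laplacian[OF test_function_laplacian[OF \<phi>]]
          test_function_cmult[OF \<phi>, of "- of_real (\<kappa>^4)"]]
      by (simp add: \<zeta>_def)
    have i: "integrable lborel (\<lambda>x. plane_wave \<theta> \<kappa> x * \<zeta> x)" "integrable lborel (\<lambda>x. R0 \<kappa> ?f x * \<zeta> x)"
      "integrable lborel (\<lambda>x. ?f x * \<phi> x)"
      by (intro test_function_mult_integrable \<zeta> \<phi> plane_wave_facts continuous_on_R0 \<kappa>1 int scat_density(1)[OF \<kappa>])+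
    have "(LINT x|lborel. ?u x * \<zeta> x + ?f x * \<phi> x)
        = (LINT x|lborel. plane_wave \<theta> \<kappa> x * \<zeta> x - R0 \<kappa> ?f x * \<zeta> x + ?f x * \<phi> x)"
      by (simp add: algebra_simps)
    also have "\<dots> = (LINT x|lborel. plane_wave \<theta> \<kappa> x * \<zeta> x) - (LINT x|lborel. R0 \<kappa> ?f x * \<zeta> x) + (LINT x|lborel. ?f x * \<phi> x)"
      using i by simp
    also have "\<dots> = 0"
      using plane_wave_weak_solution[OF \<theta> \<phi>] R0_weak_solution[OF \<kappa>1 int \<phi>] by (simp add: \<zeta>_def)
    finally show ?thesis by (simp add: \<zeta>_def)
  qed
  have "biharmonic_solution A V \<kappa> ?u"
    unfolding biharmonic_solution_def lo
    using weak differentiable_add[OF plane_wave_facts(1) diff] by (auto simp: test_function_def)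
  moreover have "weighted_L2 2 (\<lambda>x. - R0 \<kappa> ?f x)"
  proof (rule weighted_L2_bounded)
    show "(\<lambda>x. - R0 \<kappa> ?f x) \<in> borel_measurable lborel"
      using continuous_on_R0[OF \<kappa>1 int] by (auto intro!: borel_measurable_continuous_onI continuous_intros)
    show "norm (- R0 \<kappa> ?f x) \<le> 1 / \<kappa> * (LINT y|lborel. norm (?f y))" for x
      using R0_bound[OF \<kappa>1 int, of x] by simp
  qed
  moreover have "weighted_L2 2 (grad (\<lambda>x. - R0 \<kappa> ?f x))"
  proof -
    have g: "grad (\<lambda>x. - R0 \<kappa> ?f x) = (\<lambda>x. \<chi> j. - partial j (R0 \<kappa> ?f) x)"
      unfolding grad_def
      by (simp add: partial_bounded_linear[OF bounded_linear_minus[OF bounded_linear_ident] R0_differentiable(1)[OF \<kappa>1 int]])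
    show ?thesis
    proof (rule weighted_L2_bounded)
      have "continuous_on UNIV (\<lambda>x. \<chi> j. - partial j (R0 \<kappa> ?f) x)"
        by (intro continuous_on_vec_lambda continuous_intros continuous_on_partial_R0 \<kappa>1 int)
      then show "grad (\<lambda>x. - R0 \<kappa> ?f x) \<in> borel_measurable lborel"
        unfolding g by (auto intro!: borel_measurable_continuous_onI)
      show "norm (grad (\<lambda>x. - R0 \<kappa> ?f x) x) \<le> (\<Sum>j\<in>(UNIV::3 set). LINT y|lborel. norm (?f y))" for x
      proof -
        have "norm (grad (\<lambda>x. - R0 \<kappa> ?f x) x) \<le> (\<Sum>j\<in>UNIV. norm (partial j (R0 \<kappa> ?f) x))"
          unfolding g norm_vec_def by (rule order_trans[OF L2_set_le_sum]) auto
        also have "\<dots> \<le> (\<Sum>j\<in>(UNIV::3 set). LINT y|lborel. norm (?f y))"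
        proof (rule sum_mono)
          fix j :: 3
          show "norm (partial j (R0 \<kappa> ?f) x) \<le> (LINT y|lborel. norm (?f y))"
            using DG_integral_bound[OF \<kappa>1 int, of x "axis j 1"] R0_differentiable(2)[OF \<kappa>1 int, of j x] by simp
        qed
        finally show ?thesis .
      qed
    qed
  qed
  ultimately show ?thesis
    unfolding is_scattering_solution_def lo
    by (intro conjI exI[of _ "\<lambda>x. - R0 \<kappa> ?f x"] exI[of _ "2::real"]) auto
qed

text \<open>A given solution need not a priori have a continuous density, so the fixed-point
  uniqueness does not apply at once. The weighted condition on the gradient first makes the density
  integrable; the outgoing representation then makes it continuous.\<close>

lemma scattering_solution_unique:
  assumes \<kappa>: "\<kappa> \<ge> \<kappa>0" and \<theta>: "norm \<theta> = 1" and u: "is_scattering_solution A V \<theta> \<kappa> u"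
  shows "u = (\<lambda>x. plane_wave \<theta> \<kappa> x + - R0 \<kappa> (scat_density \<theta> \<kappa>) x)"
proof -
  define f where "f = lower_order A V u"
  have \<kappa>1: "\<kappa> > 0" using \<kappa>0(1)[OF \<kappa>] by simp
  note sc = u[unfolded is_scattering_solution_def]
  note bih = conjunct1[OF sc]
  from conjunct2[OF sc] obtain usc where usc0: "(\<forall>x. u x = plane_wave \<theta> \<kappa> x + usc x) \<and>
      (\<forall>x. usc x = - R0 \<kappa> (lower_order A V u) x) \<and>
      (\<exists>\<delta>>1/2. weighted_L2 \<delta> usc \<and> weighted_L2 \<delta> (grad usc))"
    by (rule exE)
  note usc1 = conjunct1[OF usc0] and usc2 = conjunct1[OF conjunct2[OF usc0]]
  have "\<exists>\<delta>>1/2. weighted_L2 \<delta> usc \<and> weighted_L2 \<delta> (grad usc)"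
    by (rule conjunct2[OF conjunct2[OF usc0]])
  then obtain \<delta> :: real where \<delta>: "\<delta> > 1/2" "weighted_L2 \<delta> (grad usc)" by blast
  have usc: "u x = plane_wave \<theta> \<kappa> x + usc x" "usc x = - R0 \<kappa> f x" for x
    unfolding f_def by (rule spec[OF usc1], rule spec[OF usc2])
  have u_diff: "u differentiable (at x)" for x using bih by (simp add: biharmonic_solution_def)
  have usc_eq: "usc = (\<lambda>x. u x + - plane_wave \<theta> \<kappa> x)" by (rule ext) (simp add: usc(1))
  have usc_diff: "usc differentiable (at x)" for x
    by (subst usc_eq) (intro differentiable_add differentiable_minus u_diff plane_wave_facts)
  have u_eq: "u = (\<lambda>x. plane_wave \<theta> \<kappa> x + usc x)" by (rule ext) (rule usc(1))
  have f_eq: "f x = source \<theta> \<kappa> x + lower_order A V usc x" for x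
    unfolding f_def source_def
    by (subst u_eq, rule lower_order_add) (rule plane_wave_facts, rule usc_diff)
  have usc_cont: "continuous_on UNIV usc"
    using usc_diff differentiable_imp_continuous_within by (blast intro: continuous_at_imp_continuous_on)
  have intf: "integrable lborel f"
  proof -
    have meas_grad: "grad usc \<in> borel_measurable lborel" using \<delta>(2) by (simp add: weighted_L2_def)
    have [measurable]: "partial j usc \<in> borel_measurable borel" for j
    proof -
      have "(\<lambda>x. grad usc x $ j) \<in> borel_measurable lborel"
        by (rule borel_measurable_continuous_on[OF _ meas_grad]) (intro continuous_intros)
      then show ?thesis by (simp add: grad_def)
    qed
    have [measurable]: "cball (0::real^3) r \<in> sets borel" for r by simp
    have grad_int: "integrable lborel (\<lambda>x. A x $ j * partial j usc x)" for j
    proof -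
      have [measurable]: "(\<lambda>x. A x $ j) \<in> borel_measurable borel"
        using A_cont by (auto intro: borel_measurable_continuous_onI)
      define w where "w = (\<lambda>x. (1 + norm x) powr (- 2 * \<delta>) * (norm (grad usc x))^2)"
      have w: "integrable lborel w" using \<delta>(2) by (simp add: weighted_L2_def w_def)
      have "integrable lborel (\<lambda>x. indicator (cball 0 R) x *\<^sub>R a :: real)"
        by (intro borel_integrable_compact) auto
      \<comment> \<open>On the bounded support the weight is at least
        \<open>(1 + R) powr (- 2 * \<delta>)\<close>. With \<open>t \<le> 1 + t^2\<close> this turns
        the weighted square-integrability of the gradient into integrability of \<open>A $ j\<close>
        times its partial derivatives.\<close>
      then have "integrable lborel (\<lambda>x. indicator (cball 0 R) x * a + a * (1 + R) powr (2 * \<delta>) * w x)"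
        using w by (intro Bochner_Integration.integrable_add integrable_mult_right) auto
      then show ?thesis
      proof (rule Bochner_Integration.integrable_bound)
        show "AE x in lborel. norm (A x $ j * partial j usc x)
            \<le> norm (indicator (cball 0 R) x * a + a * (1 + R) powr (2 * \<delta>) * w x)"
        proof (rule AE_I2)
          fix x
          have w0: "w x \<ge> 0" by (simp add: w_def)
          show "norm (A x $ j * partial j usc x) \<le> norm (indicator (cball 0 R) x * a + a * (1 + R) powr (2 * \<delta>) * w x)"
          proof (cases "norm x \<le> R")
            case False
            then have "A x $ j = 0" using A_supp[of j] by (simp add: supported_in_ball_def)
            then show ?thesis by simp
          next
            case True
            let ?g = "norm (grad usc x)"
            have "norm (partial j usc x) \<le> ?g"
              using Finite_Cartesian_Product.norm_nth_le[of "grad usc x" j] by (simp add: grad_def)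
            also have "?g \<le> 1 + ?g^2"
            proof -
              have "0 \<le> (?g - 1)^2" by simp
              then have "2 * ?g \<le> 1 + ?g^2" by (simp add: power2_diff)
              then show ?thesis using norm_ge_zero[of "grad usc x"] by linarith
            qed
            also have "?g^2 \<le> (1 + R) powr (2 * \<delta>) * w x"
            proof -
              have "1 \<le> (1 + R) powr (2 * \<delta>) * (1 + norm x) powr (- 2 * \<delta>)"
              proof -
                have "(1 + norm x) powr (2 * \<delta>) \<le> (1 + R) powr (2 * \<delta>)"
                  using True \<delta>(1) by (intro powr_mono2) auto
                then have "(1 + norm x) powr (2 * \<delta>) * (1 + norm x) powr (- 2 * \<delta>)
                    \<le> (1 + R) powr (2 * \<delta>) * (1 + norm x) powr (- 2 * \<delta>)"
                  by (intro mult_right_mono) auto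
                moreover have "(1 + norm x) powr (2 * \<delta>) * (1 + norm x) powr (- 2 * \<delta>) = 1"
                proof -
                  have "1 + norm x \<noteq> 0" using norm_ge_zero[of x] by linarith
                  then show ?thesis by (simp add: powr_add[symmetric])
                qed
                ultimately show ?thesis by simp
              qed
              from mult_right_mono[OF this, of "?g^2"] show ?thesis by (simp add: w_def mult.assoc)
            qed
            finally have "norm (A x $ j) * norm (partial j usc x) \<le> a * (1 + (1 + R) powr (2 * \<delta>) * w x)"
              using A_bound a_pos by (intro mult_mono) auto
            then show ?thesis
              using True w0 a_pos by (simp add: norm_mult algebra_simps)
          qed
        qed
      qed measurable
    qed
    have "integrable lborel (\<lambda>x. V x * usc x)"
      by (rule integrable_supported_in_ball[OF _ supported_in_ball_mult(2)[OF V_supp]])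
         (intro continuous_intros V_cont usc_cont)
    then have "integrable lborel (lower_order A V usc)"
      unfolding lower_order_def using grad_int by auto
    moreover have "integrable lborel (source \<theta> \<kappa>)"
      by (rule integrable_supported_in_ball[OF source_cont source_supp])
    ultimately have "integrable lborel (\<lambda>x. source \<theta> \<kappa> x + lower_order A V usc x)"
      by (intro Bochner_Integration.integrable_add)
    then show ?thesis unfolding f_eq[symmetric] .
  qed
  have u_eq': "u = (\<lambda>x. plane_wave \<theta> \<kappa> x + - R0 \<kappa> f x)"
    by (rule ext) (simp only: usc(2)[symmetric] usc(1)[symmetric])
  have fix_eq: "f x = source \<theta> \<kappa> x - lower_order A V (R0 \<kappa> f) x" for x
    unfolding lower_order_total_field[OF \<kappa>1 intf, symmetric] u_eq'[symmetric] by (simp only: f_def)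
  \<comment> \<open>The bootstrap: integrability of \<open>f\<close> makes
    \<open>R0 \<kappa> f\<close> continuously differentiable, so the right side of
    \<open>fix_eq\<close>, and with it \<open>f\<close>, is continuous.\<close>
  have "continuous_on UNIV (\<lambda>x. source \<theta> \<kappa> x - lower_order A V (R0 \<kappa> f) x)"
    by (intro continuous_intros source_cont lower_order_R0_cont \<kappa>1 intf)
  then have "continuous_on UNIV f" unfolding fix_eq[symmetric] .
  moreover have "supported_in_ball R f" unfolding f_def by (rule lower_order_supp)
  ultimately have "f = scat_density \<theta> \<kappa>" by (rule scat_density_unique[OF \<kappa> _ _ fix_eq])
  then show ?thesis using u_eq' by simp
qed

lemma scattering_amplitude_eq:
  assumes \<kappa>: "\<kappa> \<ge> \<kappa>0" and \<theta>: "norm \<theta> = 1"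
  shows "scattering_amplitude A V \<omega> \<theta> \<kappa> =
    (LINT y|lborel. exp (- \<i> * of_real (\<kappa> * (\<omega> \<bullet> y))) * scat_density \<theta> \<kappa> y)"
proof -
  have \<kappa>1: "\<kappa> > 0" using \<kappa>0(1)[OF \<kappa>] by simp
  have int: "integrable lborel (scat_density \<theta> \<kappa>)" by (rule integrable_supported_in_ball[OF scat_density(1,2)[OF \<kappa>]])
  have "scattering_solution A V \<theta> \<kappa> = (\<lambda>x. plane_wave \<theta> \<kappa> x + - R0 \<kappa> (scat_density \<theta> \<kappa>) x)"
    unfolding scattering_solution_def
    by (rule the_equality) (rule scattering_solution_density[OF assms], erule scattering_solution_unique[OF assms])
  moreover have "lower_order A V (\<lambda>x. plane_wave \<theta> \<kappa> x + - R0 \<kappa> (scat_density \<theta> \<kappa>) x) = scat_density \<theta> \<kappa>"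
    by (intro ext) (simp only: lower_order_total_field[OF \<kappa>1 int] scat_density(3)[OF \<kappa>, symmetric])
  ultimately show ?thesis by (simp add: scattering_amplitude_def)
qed

end

section \<open>An oscillatory integral\<close>

text \<open>Averaging over \<open>\<kappa> \<in> [n, 2 n]\<close> preserves the limit and, by Fubini, replaces \<open>e\<^sup>i\<^sup>\<kappa>\<^sup>\<phi>\<close> by a factor of
  size \<open>O(1 / (n |\<phi>|))\<close>.\<close>

lemma oscillatory_integral_limit_zero:
  fixes M :: "'a::euclidean_space \<Rightarrow> complex" and \<phi> :: "'a \<Rightarrow> real"
  assumes M: "integrable lborel M" and [measurable]: "\<phi> \<in> borel_measurable borel"
    and nz: "AE w in lborel. \<phi> w \<noteq> 0"
    and lim: "((\<lambda>\<kappa>. LINT w|lborel. exp (\<i> * of_real (\<kappa> * \<phi> w)) * M w) \<longlongrightarrow> c) at_top"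
  shows "c = 0"
proof -
  define F where "F = (\<lambda>\<kappa>. LINT w|lborel. exp (\<i> * of_real (\<kappa> * \<phi> w)) * M w)"
  have Mm [measurable]: "M \<in> borel_measurable borel" using M by auto
  have Fm [measurable]: "F \<in> borel_measurable borel"
  proof -
    have "(\<lambda>(\<kappa>, w). exp (\<i> * of_real (\<kappa> * \<phi> w)) * M w) \<in> borel_measurable (borel \<Otimes>\<^sub>M lborel)"
      by measurable
    then show ?thesis unfolding F_def by (rule lborel.borel_measurable_lebesgue_integral)
  qed
  have F_bound: "norm (F \<kappa>) \<le> (LINT w|lborel. norm (M w))" for \<kappa>
    unfolding F_def using integrable_bounded_mult(2)[OF M, of "\<lambda>w. exp (\<i> * of_real (\<kappa> * \<phi> w))" 1] by simp
  \<comment> \<open>The average over \<open>[n, 2 n]\<close> is rescaled by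
    \<open>\<kappa> = n s\<close> to the fixed interval \<open>[1, 2]\<close> of length 1, so that
    dominated convergence applies.\<close>
  define J where "J = (\<lambda>n::nat. LINT s|lborel. indicator {1..2} s *\<^sub>R F (real n * s))"
  have int_ind: "integrable lborel (\<lambda>s. indicator {1..2::real} s *\<^sub>R b)" for b :: "'b::{banach,second_countable_topology}"
    by (intro borel_integrable_compact) auto
  have "J \<longlonglongrightarrow> (LINT s|lborel. indicator {1..2::real} s *\<^sub>R c)"
    unfolding J_def
  proof (rule integral_dominated_convergence[where w="\<lambda>s. indicator {1..2} s *\<^sub>R (LINT w|lborel. norm (M w))"])
    show "AE s in lborel. (\<lambda>n. indicator {1..2} s *\<^sub>R F (real n * s)) \<longlonglongrightarrow> indicator {1..2} s *\<^sub>R c"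
    proof (rule AE_I2)
      fix s :: real
      show "(\<lambda>n. indicator {1..2} s *\<^sub>R F (real n * s)) \<longlonglongrightarrow> indicator {1..2} s *\<^sub>R c"
      proof (cases "s \<in> {1..2}")
        case True
        then have "filterlim (\<lambda>n. s * real n) at_top sequentially"
          by (intro filterlim_tendsto_pos_mult_at_top[OF tendsto_const _ filterlim_real_sequentially]) auto
        then have "(\<lambda>n. F (s * real n)) \<longlonglongrightarrow> c"
          using lim filterlim_compose unfolding F_def by blast
        then show ?thesis using True by (simp add: mult.commute)
      qed simp
    qed
    show "AE s in lborel. norm (indicator {1..2} s *\<^sub>R F (real n * s)) \<le> indicator {1..2} s *\<^sub>R (LINT w|lborel. norm (M w))" for n
      using F_bound by (auto simp: indicator_def)
  qed (use int_ind in auto)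
  moreover have "(LINT s|lborel. indicator {1..2::real} s *\<^sub>R c) = c"
    by simp
  moreover have "J \<longlonglongrightarrow> 0"
  proof -
    define K where "K = (\<lambda>(n::nat) w. LINT s|lborel. indicator {1..2::real} s *\<^sub>R exp (\<i> * of_real (real n * s * \<phi> w)))"
    have Km [measurable]: "K n \<in> borel_measurable borel" for n
    proof -
      have "(\<lambda>(w, s). indicator {1..2::real} s *\<^sub>R exp (\<i> * of_real (real n * s * \<phi> w))) \<in> borel_measurable (borel \<Otimes>\<^sub>M lborel)"
        by measurable
      then show ?thesis unfolding K_def by (rule lborel.borel_measurable_lebesgue_integral)
    qed
    have K_bound: "norm (K n w) \<le> 1" for n w
    proof -
      have "norm (K n w) \<le> (LINT s|lborel. norm (indicator {1..2::real} s *\<^sub>R exp (\<i> * of_real (real n * s * \<phi> w))))"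
        unfolding K_def by (rule integral_norm_bound)
      also have "\<dots> = (LINT s|lborel. indicator {1..2::real} s)"
        by (intro Bochner_Integration.integral_cong) (auto simp: indicator_def)
      also have "\<dots> = 1" by simp
      finally show ?thesis .
    qed
    have K_small: "norm (K n w) \<le> 2 / \<bar>\<phi> w\<bar> * inverse (real n)" if "\<phi> w \<noteq> 0" "n > 0" for n w
    proof -
      define b where "b = \<i> * of_real (real n * \<phi> w)"
      have b: "b \<noteq> 0" using that by (simp add: b_def)
      have e: "\<i> * of_real (real n * s * \<phi> w) = b * of_real s" for s by (simp add: b_def)
      have "K n w = exp (b * of_real 2) / b - exp (b * of_real 1) / b"
        unfolding K_def e
      proof (rule integral_FTC_Icc)
        show "((\<lambda>s. exp (b * of_real s) / b) has_vector_derivative exp (b * of_real s)) (at s within {1..2})" for s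
          using b by (intro has_vector_derivative_real_field[of "\<lambda>w. exp (b * w) / b"])
             (auto intro!: derivative_eq_intros)
      qed (auto intro!: continuous_intros)
      also have "norm \<dots> \<le> norm (exp (b * of_real 2) / b) + norm (exp (b * of_real 1) / b)"
        by (rule norm_triangle_ineq4)
      also have "\<dots> = 2 / norm b" by (simp add: norm_divide b_def)
      also have "\<dots> = 2 / \<bar>\<phi> w\<bar> * inverse (real n)" using that by (simp add: b_def norm_mult divide_simps)
      finally show ?thesis .
    qed
    have J_eq: "J n = (LINT w|lborel. K n w * M w)" for n
    proof -
      let ?f = "\<lambda>s w. (indicator {1..2::real} s *\<^sub>R exp (\<i> * of_real (real n * s * \<phi> w))) * M w"
      have "integrable (lborel \<Otimes>\<^sub>M lborel) (\<lambda>(s, w). ?f s w)"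
      proof (rule lborel_pair.Fubini_integrable)
        have E: "(LINT w|lborel. norm (?f s w)) = indicator {1..2} s *\<^sub>R (LINT w|lborel. norm (M w))" for s
          by (cases "s \<in> {1..2}") (simp_all add: norm_mult)
        show "integrable lborel (\<lambda>s. LINT w|lborel. norm (case (s, w) of (s, w) \<Rightarrow> ?f s w))"
          unfolding prod.case E by (rule int_ind)
        show "AE s in lborel. integrable lborel (\<lambda>w. case (s, w) of (s, w) \<Rightarrow> ?f s w)"
        proof (rule AE_I2)
          fix s
          show "integrable lborel (\<lambda>w. case (s, w) of (s, w) \<Rightarrow> ?f s w)"
            unfolding prod.case
            by (rule integrable_bounded_mult(1)[OF M, where b=1]) (auto simp: indicator_def)
        qed
      qed measurable
      from lborel_pair.Fubini_integral[OF this]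
      have "(LINT w|lborel. LINT s|lborel. ?f s w) = (LINT s|lborel. LINT w|lborel. ?f s w)" .
      moreover have "(LINT w|lborel. ?f s w) = indicator {1..2} s *\<^sub>R F (real n * s)" for s
        unfolding F_def by (simp add: mult.assoc)
      moreover have "(LINT s|lborel. ?f s w) = K n w * M w" for w
        unfolding K_def by (rule integral_mult_left_zero)
      ultimately show ?thesis unfolding J_def by (simp only:)
    qed
    \<comment> \<open>The decay of \<open>K n w\<close> degenerates near zeros of
      \<open>\<phi>\<close>. Pointwise convergence off a null set together with
      \<open>norm (K n w) \<le> 1\<close> avoids any estimate there.\<close>
    have "(\<lambda>n. LINT w|lborel. K n w * M w) \<longlonglongrightarrow> (LINT w|(lborel::'a measure). 0)"
    proof (rule integral_dominated_convergence[where w="\<lambda>w. norm (M w)"])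
      show "integrable lborel (\<lambda>w. norm (M w))" using M by simp
      show "AE w in lborel. (\<lambda>n. K n w * M w) \<longlonglongrightarrow> 0"
        using nz
      proof eventually_elim
        fix w assume w: "\<phi> w \<noteq> 0"
        have "(\<lambda>n. 2 / \<bar>\<phi> w\<bar> * inverse (real n)) \<longlonglongrightarrow> 2 / \<bar>\<phi> w\<bar> * 0"
          by (intro tendsto_intros lim_inverse_n)
        then have "(\<lambda>n. 2 / \<bar>\<phi> w\<bar> * inverse (real n)) \<longlonglongrightarrow> 0" by simp
        moreover have "\<forall>\<^sub>F n in sequentially. norm (K n w) \<le> 2 / \<bar>\<phi> w\<bar> * inverse (real n)"
          using eventually_gt_at_top[of 0] by eventually_elim (use K_small[OF w] in blast)
        ultimately have "(\<lambda>n. K n w) \<longlonglongrightarrow> 0" by (rule Lim_null_comparison[rotated])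
        then show "(\<lambda>n. K n w * M w) \<longlonglongrightarrow> 0" by (rule tendsto_mult_left_zero)
      qed
      show "AE w in lborel. norm (K n w * M w) \<le> norm (M w)" for n
        using K_bound[of n] by (auto simp: norm_mult intro!: AE_I2 mult_left_le_one_le)
    qed measurable
    then show ?thesis unfolding J_eq by simp
  qed
  ultimately show "c = 0" using LIMSEQ_unique by metis
qed

lemma bounded_times_null:
  fixes f g :: "real \<Rightarrow> complex"
  assumes "\<forall>\<^sub>F x in at_top. norm (f x) \<le> B" "(g \<longlongrightarrow> 0) at_top"
  shows "((\<lambda>x. f x * g x) \<longlongrightarrow> 0) at_top"
proof -
  have "((\<lambda>x. B * norm (g x)) \<longlongrightarrow> B * 0) at_top"
    by (intro tendsto_mult tendsto_const tendsto_norm_zero assms(2))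
  then have "((\<lambda>x. B * norm (g x)) \<longlongrightarrow> 0) at_top" by simp
  moreover have "\<forall>\<^sub>F x in at_top. norm (f x * g x) \<le> B * norm (g x)"
    using assms(1) by eventually_elim (simp add: norm_mult mult_right_mono)
  ultimately show ?thesis by (rule Lim_null_comparison[rotated])
qed

lemma inverse_mult_null: "((\<lambda>\<kappa>::real. b / \<kappa>) \<longlongrightarrow> 0) at_top"
  by (intro real_tendsto_divide_at_top[OF tendsto_const] filterlim_ident)

text \<open>Only the gradient kernel survives multiplication by the factor \<open>\<kappa>\<close>
  of the source: the last limit isolates its oscillating profile, while the terms involving
  \<open>gker\<close> or lacking the factor \<open>\<kappa>\<close> vanish.\<close>

lemma gker_limits:
  assumes "r > 0"
  shows "((\<lambda>\<kappa>. gker \<kappa> r) \<longlongrightarrow> 0) at_top" "((\<lambda>\<kappa>. of_real \<kappa> * gker \<kappa> r) \<longlongrightarrow> 0) at_top"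
    "((\<lambda>\<kappa>. gker' \<kappa> r) \<longlongrightarrow> 0) at_top"
    "((\<lambda>\<kappa>. of_real \<kappa> * gker' \<kappa> r - \<i> * exp (\<i> * of_real (\<kappa> * r)) / of_real (8 * pi * r)) \<longlongrightarrow> 0) at_top"
proof -
  show "((\<lambda>\<kappa>. gker \<kappa> r) \<longlongrightarrow> 0) at_top"
  proof (rule Lim_null_comparison[OF _ inverse_mult_null[of 1]])
    show "\<forall>\<^sub>F \<kappa> in at_top. norm (gker \<kappa> r) \<le> 1 / \<kappa>"
      using eventually_gt_at_top[of 0] by eventually_elim (use gker_bounds(1) assms in auto)
  qed
  show "((\<lambda>\<kappa>. gker' \<kappa> r) \<longlongrightarrow> 0) at_top"
  proof (rule Lim_null_comparison[OF _ inverse_mult_null[of "1 / r"]])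
    show "\<forall>\<^sub>F \<kappa> in at_top. norm (gker' \<kappa> r) \<le> 1 / r / \<kappa>"
      using eventually_gt_at_top[of 0]
    proof eventually_elim
      fix \<kappa> :: real assume "\<kappa> > 0"
      from gker'_bounds(2)[OF this, of r] assms show "norm (gker' \<kappa> r) \<le> 1 / r / \<kappa>" by (simp add: mult.commute)
    qed
  qed
  show "((\<lambda>\<kappa>. of_real \<kappa> * gker \<kappa> r) \<longlongrightarrow> 0) at_top"
  proof (rule Lim_null_comparison[OF _ inverse_mult_null[of "1 / r"]])
    show "\<forall>\<^sub>F \<kappa> in at_top. norm (of_real \<kappa> * gker \<kappa> r) \<le> 1 / r / \<kappa>"
      using eventually_gt_at_top[of 0]
    proof eventually_elim
      fix \<kappa> :: real assume \<kappa>: "\<kappa> > 0"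
      have "norm (of_real \<kappa> * gker \<kappa> r) \<le> \<kappa> * (1 / (\<kappa>^2 * r))"
        using mult_left_mono[OF gker_bounds(2)[OF \<kappa>, of r] less_imp_le[OF \<kappa>]] assms \<kappa> by (simp add: norm_mult)
      also have "\<dots> = 1 / r / \<kappa>" using \<kappa> assms by (simp add: field_simps power2_eq_square)
      finally show "norm (of_real \<kappa> * gker \<kappa> r) \<le> 1 / r / \<kappa>" .
    qed
  qed
  show "((\<lambda>\<kappa>. of_real \<kappa> * gker' \<kappa> r - \<i> * exp (\<i> * of_real (\<kappa> * r)) / of_real (8 * pi * r)) \<longlongrightarrow> 0) at_top"
  proof (rule Lim_null_comparison[OF _ inverse_mult_null[of "2 / (r * r)"]])
    show "\<forall>\<^sub>F \<kappa> in at_top. norm (of_real \<kappa> * gker' \<kappa> r - \<i> * exp (\<i> * of_real (\<kappa> * r)) / of_real (8 * pi * r)) \<le> 2 / (r * r) / \<kappa>"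
      using eventually_gt_at_top[of 0]
    proof eventually_elim
      fix \<kappa> :: real assume \<kappa>: "\<kappa> > 0"
      define e1 where "e1 = exp (\<i> * of_real (\<kappa> * r))"
      define e2 where "e2 = exp (- \<kappa> * r)"
      \<comment> \<open>The middle bound is \<open>x * exp (- x) \<le> 1\<close> with
        \<open>x = \<kappa> * r\<close>, from \<open>1 + x \<le> exp x\<close>.\<close>
      have e2: "0 \<le> e2" "e2 * (\<kappa> * r) \<le> 1" "e2 \<le> 1"
      proof -
        have "1 + \<kappa> * r \<le> exp (\<kappa> * r)" by (rule exp_ge_add_one_self)
        then have "e2 * (1 + \<kappa> * r) \<le> e2 * exp (\<kappa> * r)" by (intro mult_left_mono) (auto simp: e2_def)
        also have "\<dots> = 1" by (simp add: e2_def exp_minus field_simps)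
        finally show "e2 * (\<kappa> * r) \<le> 1" using \<kappa> assms by (simp add: e2_def algebra_simps) (smt (verit) exp_gt_zero)
        show "0 \<le> e2" "e2 \<le> 1" using \<kappa> assms by (auto simp: e2_def)
      qed
      have n1: "norm e1 = 1" by (simp add: e1_def)
      have "of_real \<kappa> * gker' \<kappa> r - \<i> * e1 / of_real (8 * pi * r)
          = (of_real (e2 * (\<kappa> * r)) - (e1 - of_real e2)) / of_real (8 * pi * \<kappa> * r^2)"
        using \<kappa> assms unfolding gker'_def e1_def[symmetric] e2_def[symmetric]
        by (simp add: divide_simps power2_eq_square) (simp add: algebra_simps)
      also have "norm \<dots> = norm (of_real (e2 * (\<kappa> * r)) - (e1 - of_real e2)) / (8 * pi * \<kappa> * r^2)"
        using \<kappa> by (simp add: norm_divide norm_mult norm_power)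
      also have "\<dots> \<le> 3 / (4 * \<kappa> * r^2)"
      proof (intro frac_le mult_right_mono)
        have "norm (of_real (e2 * (\<kappa> * r)) - (e1 - of_real e2)) \<le> norm (complex_of_real (e2 * (\<kappa> * r))) + norm (e1 - of_real e2)"
          by (rule norm_triangle_ineq4)
        also have "norm (e1 - of_real e2) \<le> norm e1 + norm (complex_of_real e2)" by (rule norm_triangle_ineq4)
        also have "norm (complex_of_real (e2 * (\<kappa> * r))) + (norm e1 + norm (complex_of_real e2)) \<le> 1 + (1 + 1)"
          using e2 n1 \<kappa> assms unfolding norm_of_real by (intro add_mono) auto
        finally show "norm (of_real (e2 * (\<kappa> * r)) - (e1 - of_real e2)) \<le> 3" by simp
      qed (use \<kappa> assms pi_8_ge in auto)
      also have "\<dots> \<le> 2 / (r * r) / \<kappa>" using \<kappa> assms by (simp add: field_simps power2_eq_square)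
      finally show "norm (of_real \<kappa> * gker' \<kappa> r - \<i> * exp (\<i> * of_real (\<kappa> * r)) / of_real (8 * pi * r)) \<le> 2 / (r * r) / \<kappa>"
        by (simp add: e1_def)
    qed
  qed
qed

section \<open>High-frequency asymptotics of the scattering amplitude\<close>

definition FT :: "(real^3 \<Rightarrow> complex) \<Rightarrow> real^3 \<Rightarrow> complex"
  where "FT f \<xi> = (LINT x|lborel. exp (- \<i> * of_real (\<xi> \<bullet> x)) * f x)"

text \<open>Outgoing and incoming directions \<open>\<omega>\<close>, \<open>\<theta>\<close> with \<open>\<kappa> (\<omega> - \<theta>) = \<xi>\<close>: if the unit vector \<open>\<eta>\<close> is orthogonal
  to \<open>\<xi>\<close>, then \<open>half_cos \<xi> \<kappa>\<close> is the cosine of half the angle between them.\<close>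

definition half_cos :: "real^3 \<Rightarrow> real \<Rightarrow> real"
  where "half_cos \<xi> \<kappa> = sqrt (1 - (norm \<xi> / (2 * \<kappa>))^2)"

definition out_dir :: "real^3 \<Rightarrow> real^3 \<Rightarrow> real \<Rightarrow> real^3"
  where "out_dir \<xi> \<eta> \<kappa> = half_cos \<xi> \<kappa> *\<^sub>R \<eta> + (1 / (2 * \<kappa>)) *\<^sub>R \<xi>"

definition in_dir :: "real^3 \<Rightarrow> real^3 \<Rightarrow> real \<Rightarrow> real^3"
  where "in_dir \<xi> \<eta> \<kappa> = half_cos \<xi> \<kappa> *\<^sub>R \<eta> - (1 / (2 * \<kappa>)) *\<^sub>R \<xi>"

text \<open>The last bound follows from \<open>1 - c \<le> (1 - c) * (1 + c) = 1 - c^2\<close> for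
  the half-angle cosine \<open>c\<close>. It is what permits replacing the phase
  \<open>\<kappa> c \<eta>\<close> by \<open>\<kappa> \<eta>\<close> up to a factor tending to
  1.\<close>

lemma half_cos_facts:
  assumes "\<kappa> > 0" "norm \<xi> \<le> 2 * \<kappa>"
  shows "half_cos \<xi> \<kappa> \<ge> 0" "half_cos \<xi> \<kappa> ^ 2 = 1 - (norm \<xi> / (2 * \<kappa>))^2" "half_cos \<xi> \<kappa> \<le> 1"
    "\<bar>\<kappa> * (1 - half_cos \<xi> \<kappa>)\<bar> \<le> norm \<xi> ^ 2 / \<kappa>"
proof -
  have q: "0 \<le> norm \<xi> / (2 * \<kappa>)" "norm \<xi> / (2 * \<kappa>) \<le> 1" using assms by (auto simp: divide_simps)
  then have q2: "(norm \<xi> / (2 * \<kappa>))^2 \<le> 1" by (simp add: power_le_one)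
  then show s0: "half_cos \<xi> \<kappa> \<ge> 0" and s2: "half_cos \<xi> \<kappa> ^ 2 = 1 - (norm \<xi> / (2 * \<kappa>))^2"
    unfolding half_cos_def by (auto intro: real_sqrt_pow2)
  show s1: "half_cos \<xi> \<kappa> \<le> 1" unfolding half_cos_def by simp
  have "(1 - half_cos \<xi> \<kappa>) * 1 \<le> (1 - half_cos \<xi> \<kappa>) * (1 + half_cos \<xi> \<kappa>)"
    using s0 s1 by (intro mult_left_mono) auto
  also have "\<dots> = (norm \<xi> / (2 * \<kappa>))^2" using s2 by (simp add: algebra_simps power2_eq_square)
  finally have "\<kappa> * (1 - half_cos \<xi> \<kappa>) \<le> \<kappa> * (norm \<xi> / (2 * \<kappa>))^2"
    using assms(1) by (intro mult_left_mono) auto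
  also have "\<dots> = norm \<xi> ^ 2 / \<kappa> / 4" using assms(1) by (simp add: power2_eq_square divide_simps)
  also have "\<dots> \<le> norm \<xi> ^ 2 / \<kappa>"
  proof -
    have "t / 4 \<le> t" if "t \<ge> 0" for t :: real using that by simp
    from this[of "norm \<xi> ^ 2 / \<kappa>"] show ?thesis using assms(1) zero_le_power2 less_imp_le by (auto simp only: zero_le_divide_iff)
  qed
  finally show "\<bar>\<kappa> * (1 - half_cos \<xi> \<kappa>)\<bar> \<le> norm \<xi> ^ 2 / \<kappa>" using assms(1) s1 by simp
qed

lemma dir_norm:
  assumes "\<kappa> > 0" "norm \<xi> \<le> 2 * \<kappa>" "norm \<eta> = 1" "\<eta> \<bullet> \<xi> = 0"
  shows "norm (out_dir \<xi> \<eta> \<kappa>) = 1" "norm (in_dir \<xi> \<eta> \<kappa>) = 1"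
proof -
  have \<eta>: "\<eta> \<bullet> \<eta> = 1" "\<xi> \<bullet> \<eta> = 0" using assms(3,4) by (simp_all add: norm_eq_1 inner_commute)
  have x: "\<xi> \<bullet> \<xi> = norm \<xi> ^ 2" by (simp add: power2_norm_eq_inner)
  have "out_dir \<xi> \<eta> \<kappa> \<bullet> out_dir \<xi> \<eta> \<kappa> = half_cos \<xi> \<kappa> ^ 2 + (norm \<xi> / (2 * \<kappa>))^2"
    unfolding out_dir_def
    by (simp add: inner_add_left inner_add_right \<eta> assms(4) x power2_eq_square)
  then show "norm (out_dir \<xi> \<eta> \<kappa>) = 1" using half_cos_facts(2)[OF assms(1,2)] by (simp add: norm_eq_1)
  have "in_dir \<xi> \<eta> \<kappa> \<bullet> in_dir \<xi> \<eta> \<kappa> = half_cos \<xi> \<kappa> ^ 2 + (norm \<xi> / (2 * \<kappa>))^2"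
    unfolding in_dir_def
    by (simp add: inner_diff_left inner_diff_right \<eta> assms(4) x power2_eq_square)
  then show "norm (in_dir \<xi> \<eta> \<kappa>) = 1" using half_cos_facts(2)[OF assms(1,2)] by (simp add: norm_eq_1)
qed

lemma half_cos_tendsto: "(half_cos \<xi> \<longlongrightarrow> 1) at_top"
  and half_cos_defect_tendsto: "((\<lambda>\<kappa>. \<kappa> * (1 - half_cos \<xi> \<kappa>)) \<longlongrightarrow> 0) at_top"
proof -
  have large: "\<forall>\<^sub>F \<kappa> in at_top. \<kappa> > 0 \<and> norm \<xi> \<le> 2 * \<kappa>"
    using eventually_gt_at_top[of 0] eventually_ge_at_top[of "norm \<xi>"] by eventually_elim auto
  show d: "((\<lambda>\<kappa>. \<kappa> * (1 - half_cos \<xi> \<kappa>)) \<longlongrightarrow> 0) at_top"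
    by (rule Lim_null_comparison[OF _ inverse_mult_null[of "norm \<xi> ^ 2"]])
       (use large in eventually_elim, use half_cos_facts(4) in auto)
  have "((\<lambda>\<kappa>. 1 / \<kappa> * (\<kappa> * (1 - half_cos \<xi> \<kappa>))) \<longlongrightarrow> 0 * 0) at_top"
    by (intro tendsto_mult inverse_mult_null d)
  moreover have "\<forall>\<^sub>F \<kappa> in at_top. 1 / \<kappa> * (\<kappa> * (1 - half_cos \<xi> \<kappa>)) = 1 - half_cos \<xi> \<kappa>"
    using eventually_gt_at_top[of 0] by eventually_elim simp
  ultimately have "((\<lambda>\<kappa>. 1 - half_cos \<xi> \<kappa>) \<longlongrightarrow> 0 * 0) at_top" by (rule Lim_transform_eventually)
  from tendsto_diff[OF tendsto_const[of 1] this] show "(half_cos \<xi> \<longlongrightarrow> 1) at_top" by simp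
qed

text \<open>For a unit vector \<open>\<eta>\<close> it is nonnegative and vanishes exactly when
  \<open>fst p\<close> lies on the ray from \<open>snd p\<close> in direction
  \<open>\<eta>\<close>.\<close>

definition ray_phase :: "real^3 \<Rightarrow> (real^3) \<times> (real^3) \<Rightarrow> real"
  where "ray_phase \<eta> p = norm (fst p - snd p) - \<eta> \<bullet> (fst p - snd p)"

text \<open>A zero is an equality case of Cauchy-Schwarz, so the difference of the two points is a
  multiple of \<open>\<eta>\<close> and orthogonal to any \<open>v\<close> orthogonal to
  \<open>\<eta>\<close>. Hence the zeros lie in a hyperplane of the product space, with normal
  \<open>(v, - v)\<close>.\<close>

lemma ray_phase_nonzero:
  assumes "norm \<eta> = 1"
  shows "AE p in lborel. ray_phase \<eta> p \<noteq> 0"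
proof -
  obtain v :: "real^3" where v: "v \<noteq> 0" "\<eta> \<bullet> v = 0"
    using orthogonal_to_vector_exists[of \<eta>] by (auto simp: orthogonal_def)
  have "negligible {p :: (real^3) \<times> (real^3). (v, - v) \<bullet> p = 0}"
    using v(1) by (intro negligible_hyperplane) (simp add: zero_prod_def)
  then have "AE p in lebesgue. p \<notin> {p :: (real^3) \<times> (real^3). (v, - v) \<bullet> p = 0}"
    unfolding negligible_iff_null_sets by (rule AE_not_in)
  then have "AE p in lborel. p \<notin> {p :: (real^3) \<times> (real^3). (v, - v) \<bullet> p = 0}"
    by (simp only: AE_completion_iff)
  then show ?thesis
  proof eventually_elim
    fix p :: "(real^3) \<times> (real^3)" assume p: "p \<notin> {p. (v, - v) \<bullet> p = 0}"
    show "ray_phase \<eta> p \<noteq> 0"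
    proof
      let ?z = "fst p - snd p"
      assume "ray_phase \<eta> p = 0"
      then have eq: "\<eta> \<bullet> ?z = norm \<eta> * norm ?z" using assms by (simp add: ray_phase_def)
      then have "norm \<eta> *\<^sub>R ?z = norm ?z *\<^sub>R \<eta>" by (simp add: norm_cauchy_schwarz_eq)
      then have "?z = norm ?z *\<^sub>R \<eta>" using assms by simp
      then have "v \<bullet> ?z = 0" by (metis inner_commute inner_scaleR_right mult_zero_right v(2))
      then have "(v, - v) \<bullet> p = 0" by (cases p) (simp add: inner_diff_right)
      then show False using p by simp
    qed
  qed
qed

section \<open>The second Born approximation\<close>

context potential
begin

lemma A_meas [measurable]: "(\<lambda>x. A x $ j) \<in> borel_measurable borel"
  and V_meas [measurable]: "V \<in> borel_measurable borel"
  using A_cont V_cont by (auto intro: borel_measurable_continuous_onI)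

lemma source_meas [measurable]: "source \<theta> \<kappa> \<in> borel_measurable borel"
  using source_cont by (rule borel_measurable_continuous_onI)

lemma source_eq:
  "source \<theta> \<kappa> y = ((\<Sum>j\<in>UNIV. A y $ j * (\<i> * of_real (\<kappa> * \<theta> $ j))) + V y) * plane_wave \<theta> \<kappa> y"
  unfolding source_def lower_order_def plane_wave_facts(3)
  by (simp add: distrib_right sum_distrib_right mult.assoc)

text \<open>At a maximum point of its norm, the fixed-point equation bounds the maximum
  \<open>m\<close> by \<open>4 * a * \<kappa> + m / 2\<close>, and the last term is
  absorbed.\<close>

lemma scat_density_bound:
  assumes \<kappa>: "\<kappa> \<ge> \<kappa>0" and \<theta>: "norm \<theta> = 1"
  shows "norm (scat_density \<theta> \<kappa> x) \<le> 8 * a * \<kappa>"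
proof -
  have \<kappa>1: "\<kappa> \<ge> 1" "\<kappa> > 0" using \<kappa>0(1)[OF \<kappa>] by auto
  let ?f = "scat_density \<theta> \<kappa>"
  have "\<exists>x0\<in>cball 0 R. \<forall>y\<in>cball 0 R. norm (?f y) \<le> norm (?f x0)"
    by (rule continuous_attains_sup)
       (use R_pos in \<open>auto intro!: continuous_intros continuous_on_subset[OF scat_density(1)[OF \<kappa>]]\<close>)
  then obtain x0 where x0: "\<And>y. y \<in> cball 0 R \<Longrightarrow> norm (?f y) \<le> norm (?f x0)" by blast
  define m where "m = norm (?f x0)"
  have m: "norm (?f y) \<le> m" for y
  proof (cases "y \<in> cball 0 R")
    case False
    then have "?f y = 0" using scat_density(2)[OF \<kappa>, of \<theta>] by (simp add: supported_in_ball_def)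
    then show ?thesis by (simp add: m_def)
  qed (use x0 in \<open>auto simp: m_def\<close>)
  have "m = norm (source \<theta> \<kappa> x0 - lower_order A V (R0 \<kappa> ?f) x0)"
    unfolding m_def by (subst scat_density(3)[OF \<kappa>]) (rule refl)
  also have "\<dots> \<le> norm (source \<theta> \<kappa> x0) + norm (lower_order A V (R0 \<kappa> ?f) x0)"
    by (rule norm_triangle_ineq4)
  also have "\<dots> \<le> 4 * a * \<kappa> + 4 * a * (m * PR / \<kappa>)"
    by (intro add_mono source_bound \<theta> \<kappa>1 lower_order_R0_bound scat_density[OF \<kappa>] m)
  also have "4 * a * (m * PR / \<kappa>) = (4 * a * PR / \<kappa>) * m" by (simp add: field_simps)
  also have "\<dots> \<le> 1 / 2 * m" using \<kappa>0(2)[OF \<kappa>] by (intro mult_right_mono) (auto simp: m_def)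
  finally have "m \<le> 8 * a * \<kappa>" by simp
  then show ?thesis using m order_trans by blast
qed

text \<open>Write \<open>T\<close> for \<open>lower_order A V\<close> after
  \<open>R0 \<kappa>\<close>. From \<open>f = s - T f\<close> it follows that
  \<open>f - (s - T s) = T (T f)\<close>. As \<open>f\<close> is \<open>O(\<kappa>)\<close> and each
  \<open>T\<close> gains \<open>1 / \<kappa>\<close>, the error is
  \<open>O(1 / \<kappa>)\<close>.\<close>

lemma scat_density_second_born:
  assumes \<kappa>: "\<kappa> \<ge> \<kappa>0" and \<theta>: "norm \<theta> = 1"
  shows "norm (scat_density \<theta> \<kappa> x - (source \<theta> \<kappa> x - lower_order A V (R0 \<kappa> (source \<theta> \<kappa>)) x))
    \<le> 128 * a^3 * PR^2 / \<kappa>"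
proof -
  have \<kappa>1: "\<kappa> \<ge> 1" "\<kappa> > 0" using \<kappa>0(1)[OF \<kappa>] by auto
  let ?f = "scat_density \<theta> \<kappa>"
  define g where "g = lower_order A V (R0 \<kappa> ?f)"
  have intf: "integrable lborel ?f" by (rule integrable_supported_in_ball[OF scat_density(1,2)[OF \<kappa>]])
  have ints: "integrable lborel (source \<theta> \<kappa>)" by (rule integrable_supported_in_ball[OF source_cont source_supp])
  have g_cont: "continuous_on UNIV g" unfolding g_def by (intro lower_order_R0_cont \<kappa>1 intf)
  have g_supp: "supported_in_ball R g" unfolding g_def by (rule lower_order_supp)
  have "norm (g x) \<le> 4 * a * ((8 * a * \<kappa>) * PR / \<kappa>)" for x
    unfolding g_def by (intro lower_order_R0_bound \<kappa>1 scat_density[OF \<kappa>] scat_density_bound[OF assms])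
  then have g_bound: "norm (g x) \<le> 32 * a^2 * PR" for x
    using \<kappa>1 by (simp add: power2_eq_square mult.assoc)
  have "g = (\<lambda>x. source \<theta> \<kappa> x - ?f x)"
  proof
    fix x
    have "?f x = source \<theta> \<kappa> x - g x" unfolding g_def by (rule scat_density(3)[OF \<kappa>])
    then show "g x = source \<theta> \<kappa> x - ?f x" by (simp add: algebra_simps)
  qed
  then have 1: "lower_order A V (R0 \<kappa> g) x = lower_order A V (R0 \<kappa> (source \<theta> \<kappa>)) x - lower_order A V (R0 \<kappa> ?f) x"
    using lower_order_R0_diff[OF \<kappa>1(2) ints intf] by simp
  have alg: "f - (s - p) = q" if "q = p - l" "f = s - l" for f s p q l :: complex
    using that by simp
  have "?f x - (source \<theta> \<kappa> x - lower_order A V (R0 \<kappa> (source \<theta> \<kappa>)) x) = lower_order A V (R0 \<kappa> g) x"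
    by (rule alg[OF 1 scat_density(3)[OF \<kappa>]])
  moreover have "norm (lower_order A V (R0 \<kappa> g) x) \<le> 4 * a * ((32 * a^2 * PR) * PR / \<kappa>)"
    by (intro lower_order_R0_bound \<kappa>1 g_cont g_supp g_bound)
  moreover have "4 * a * ((32 * a^2 * PR) * PR / \<kappa>) = 128 * a^3 * PR^2 / \<kappa>"
    by (simp add: power2_eq_square power3_eq_cube)
  ultimately show ?thesis by (simp only:)
qed

lemma A_meas_comp [measurable (raw)]: "f \<in> borel_measurable M \<Longrightarrow> (\<lambda>p. A (f p) $ j) \<in> borel_measurable M"
  and V_meas_comp [measurable (raw)]: "f \<in> borel_measurable M \<Longrightarrow> (\<lambda>p. V (f p)) \<in> borel_measurable M"
  using measurable_compose[OF _ A_meas] measurable_compose[OF _ V_meas] by blast+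

text \<open>With \<open>p = (x, y)\<close> this is \<open>A(x)\<close> paired with the unit vector
  along \<open>x - y\<close>: the factor produced when \<open>A \<cdot> \<nabla>\<close> acts on a
  radial kernel.\<close>

definition slope :: "(real^3) \<times> (real^3) \<Rightarrow> complex"
  where "slope p = (\<Sum>j\<in>UNIV. A (fst p) $ j * of_real ((fst p - snd p) \<bullet> axis j 1 / norm (fst p - snd p)))"

definition dominator :: "(real^3) \<times> (real^3) \<Rightarrow> real"
  where "dominator p = indicator (cball 0 R) (fst p) *
    (indicator (cball 0 R) (snd p) * (1 / norm (fst p - snd p)))"

definition second_born :: "real^3 \<Rightarrow> real^3 \<Rightarrow> real \<Rightarrow> (real^3) \<times> (real^3) \<Rightarrow> complex"
  where "second_born \<omega> \<theta> \<kappa> p = exp (- \<i> * of_real (\<kappa> * (\<omega> \<bullet> fst p))) *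
    (gker' \<kappa> (norm (fst p - snd p)) * slope p + V (fst p) * gker \<kappa> (norm (fst p - snd p))) *
    source \<theta> \<kappa> (snd p)"

text \<open>The limit profile of \<open>second_born\<close> after
  \<open>exp (\<i> \<kappa> ray_phase)\<close> is split off. The first \<open>\<i>\<close> comes
  from the gradient of the resolvent kernel, the second from the gradient of the plane wave; their
  factors \<open>1 / \<kappa>\<close> and \<open>\<kappa>\<close> cancel.\<close>

definition leading :: "real^3 \<Rightarrow> real^3 \<Rightarrow> (real^3) \<times> (real^3) \<Rightarrow> complex"
  where "leading \<xi> \<eta> p = exp (- \<i> * of_real (\<xi> \<bullet> (fst p + snd p) / 2)) *
    (\<i> / of_real (8 * pi * norm (fst p - snd p)) * slope p) *
    (\<i> * (\<Sum>k\<in>UNIV. A (snd p) $ k * of_real (\<eta> $ k)))"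

lemma product_measurable [measurable]:
  "slope \<in> borel_measurable (lborel \<Otimes>\<^sub>M lborel)"
  "dominator \<in> borel_measurable (lborel \<Otimes>\<^sub>M lborel)"
  "second_born \<omega> \<theta> \<kappa> \<in> borel_measurable (lborel \<Otimes>\<^sub>M lborel)"
  "leading \<xi> \<eta> \<in> borel_measurable (lborel \<Otimes>\<^sub>M lborel)"
proof -
  \<comment> \<open>Both product sigma-algebras coincide; after rewriting, the measurability facts
    stated for \<open>borel\<close> apply.\<close>
  have eq: "borel_measurable (lborel \<Otimes>\<^sub>M lborel) = (borel_measurable (borel \<Otimes>\<^sub>M borel) :: ((real^3) \<times> (real^3) \<Rightarrow> 'c::topological_space) set)"
    by (intro measurable_cong_sets sets_pair_measure_cong) auto
  have [measurable]: "(\<lambda>p. indicator (cball (0::real^3) R) (fst p) :: real) \<in> borel_measurable (borel \<Otimes>\<^sub>M borel)"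
    "(\<lambda>p. indicator (cball (0::real^3) R) (snd p) :: real) \<in> borel_measurable (borel \<Otimes>\<^sub>M borel)"
    by (intro measurable_compose[OF measurable_fst] measurable_compose[OF measurable_snd] borel_measurable_indicator; simp)+
  have [measurable]: "(\<lambda>p. source \<theta> \<kappa> (snd p)) \<in> borel_measurable (borel \<Otimes>\<^sub>M borel)"
    by (rule measurable_compose[OF measurable_snd source_meas])
  have [measurable]: "slope \<in> borel_measurable (borel \<Otimes>\<^sub>M borel)"
    unfolding slope_def by measurable
  then show "slope \<in> borel_measurable (lborel \<Otimes>\<^sub>M lborel)" unfolding eq .
  show "dominator \<in> borel_measurable (lborel \<Otimes>\<^sub>M lborel)"
    unfolding dominator_def eq by measurable
  show "second_born \<omega> \<theta> \<kappa> \<in> borel_measurable (lborel \<Otimes>\<^sub>M lborel)"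
    unfolding second_born_def eq by measurable
  show "leading \<xi> \<eta> \<in> borel_measurable (lborel \<Otimes>\<^sub>M lborel)"
    unfolding leading_def eq by measurable
qed

text \<open>The inner integral of \<open>1 / |x - y|\<close> over the ball is at most
  \<open>PR\<close> for every \<open>x\<close> in the ball, so the iterated integral is
  finite.\<close>

lemma dominator_integrable: "integrable (lborel \<Otimes>\<^sub>M lborel) dominator"
proof (rule lborel_pair.Fubini_integrable)
  let ?I = "\<lambda>x. LINT y|lborel. indicator (cball 0 R) y * (1 / norm (x - y))"
  have I_nonneg: "?I x \<ge> 0" for x by (intro Bochner_Integration.integral_nonneg) auto
  have dom: "dominator (x, y) = indicator (cball 0 R) x * (indicator (cball 0 R) y * (1 / norm (x - y)))" for x y
    by (simp add: dominator_def)
  have eq: "(LINT y|lborel. norm (dominator (x, y))) = indicator (cball 0 R) x * ?I x" for x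
    by (cases "x \<in> cball 0 R") (simp_all add: dom abs_mult)
  have "(\<lambda>(x, y). norm (dominator (x, y))) \<in> borel_measurable (lborel \<Otimes>\<^sub>M lborel)"
    by measurable
  then have [measurable]: "(\<lambda>x. LINT y|lborel. norm (dominator (x, y))) \<in> borel_measurable lborel"
    by (rule lborel.borel_measurable_lebesgue_integral)
  show "integrable lborel (\<lambda>x. LINT y|lborel. norm (dominator (x, y)))"
  proof (rule Bochner_Integration.integrable_bound)
    show "integrable lborel (\<lambda>x::real^3. indicator (cball 0 R) x *\<^sub>R PR)"
      by (intro borel_integrable_compact) auto
    show "AE x in lborel. norm (LINT y|lborel. norm (dominator (x, y))) \<le> norm (indicator (cball 0 R) x *\<^sub>R PR)"
      unfolding eq
    proof (rule AE_I2)
      fix x :: "real^3"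
      show "norm (indicator (cball 0 R) x * ?I x) \<le> norm (indicator (cball 0 R) x *\<^sub>R PR)"
      proof (cases "x \<in> cball 0 R")
        case True
        then have "?I x \<le> PR" using newton_kernel_local(2)[of x R] by simp
        then show ?thesis using True I_nonneg[of x] by (simp only: indicator_simps) simp
      qed simp
    qed
  qed measurable
  show "AE x in lborel. integrable lborel (\<lambda>y. dominator (x, y))"
  proof (rule AE_I2)
    fix x :: "real^3"
    show "integrable lborel (\<lambda>y. dominator (x, y))"
    proof (cases "x \<in> cball 0 R")
      case True
      then show ?thesis unfolding dom by (intro integrable_mult_right newton_kernel_local) simp
    qed (simp add: dom)
  qed
qed (rule product_measurable)

lemma slope_bound: "norm (slope p) \<le> 3 * a"
proof -
  have "norm (slope p) \<le> (\<Sum>j\<in>(UNIV::3 set). a * 1)"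
    unfolding slope_def
  proof (rule order_trans[OF norm_sum], rule sum_mono)
    fix j :: 3
    let ?z = "fst p - snd p"
    have "\<bar>?z \<bullet> axis j 1 / norm ?z\<bar> \<le> 1"
      using Cauchy_Schwarz_ineq2[of ?z "axis j 1"] by (cases "?z = 0") (auto simp: divide_simps)
    then show "norm (A (fst p) $ j * of_real (?z \<bullet> axis j 1 / norm ?z)) \<le> a * 1"
      unfolding norm_mult norm_of_real using A_bound a_pos by (intro mult_mono) auto
  qed
  then show ?thesis by simp
qed

text \<open>The kernel is at most \<open>4 * a / (\<kappa> * r)\<close> and the source at most
  \<open>4 * a * \<kappa>\<close>. The powers of \<open>\<kappa>\<close> cancel, which makes the
  majorant independent of \<open>\<kappa>\<close> as dominated convergence requires.\<close>

lemma second_born_bound: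
  assumes \<kappa>: "\<kappa> \<ge> 1" and \<theta>: "norm \<theta> = 1"
  shows "norm (second_born \<omega> \<theta> \<kappa> p) \<le> 16 * a^2 * dominator p"
proof (cases "fst p \<in> cball 0 R \<and> snd p \<in> cball 0 R")
  case False
  then consider "R < norm (fst p)" | "R < norm (snd p)" by auto
  then have "second_born \<omega> \<theta> \<kappa> p = 0"
  proof cases
    case 1
    then have "slope p = 0" "V (fst p) = 0"
      using A_supp V_supp by (auto simp: slope_def supported_in_ball_def)
    then show ?thesis by (simp add: second_born_def)
  next
    case 2
    then show ?thesis using source_supp[of \<theta> \<kappa>] by (simp add: second_born_def supported_in_ball_def)
  qed
  then show ?thesis by (simp add: dominator_def)
next
  case True
  let ?r = "norm (fst p - snd p)"
  have \<kappa>p: "\<kappa> > 0" using \<kappa> by simp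
  have "norm (gker' \<kappa> ?r * slope p + V (fst p) * gker \<kappa> ?r)
      \<le> norm (gker' \<kappa> ?r) * norm (slope p) + norm (V (fst p)) * norm (gker \<kappa> ?r)"
    by (simp only: norm_mult[symmetric] norm_triangle_ineq)
  also have "\<dots> \<le> (1 / (\<kappa> * ?r)) * (3 * a) + a * (1 / (\<kappa> * ?r))"
  proof (intro add_mono mult_mono)
    have "norm (gker \<kappa> ?r) \<le> 1 / (\<kappa>^2 * ?r)" using gker_bounds(2)[OF \<kappa>p] by simp
    also have "\<dots> \<le> 1 / (\<kappa> * ?r)"
      using \<kappa> self_le_power[of \<kappa> 2] by (cases "?r = 0") (auto intro!: divide_left_mono mult_right_mono)
    finally show "norm (gker \<kappa> ?r) \<le> 1 / (\<kappa> * ?r)" .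
  qed (use gker'_bounds(2)[OF \<kappa>p] slope_bound V_bound \<kappa>p a_pos in auto)
  also have "\<dots> = 4 * a / (\<kappa> * ?r)" by (simp add: add_divide_distrib[symmetric])
  finally have 1: "norm (gker' \<kappa> ?r * slope p + V (fst p) * gker \<kappa> ?r) \<le> 4 * a / (\<kappa> * ?r)" .
  have "norm (second_born \<omega> \<theta> \<kappa> p)
      = norm (gker' \<kappa> ?r * slope p + V (fst p) * gker \<kappa> ?r) * norm (source \<theta> \<kappa> (snd p))"
    by (simp add: second_born_def norm_mult)
  also have "\<dots> \<le> (4 * a / (\<kappa> * ?r)) * (4 * a * \<kappa>)"
    using 1 source_bound[OF \<theta> \<kappa>] a_pos \<kappa>p by (intro mult_mono) auto
  also have "\<dots> = 16 * a^2 * (1 / ?r)" using \<kappa>p by (simp add: power2_eq_square)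
  finally show ?thesis using True by (simp add: dominator_def)
qed

lemma leading_bound:
  assumes "norm \<eta> = 1"
  shows "norm (leading \<xi> \<eta> p) \<le> 9 * a^2 * dominator p"
proof (cases "fst p \<in> cball 0 R \<and> snd p \<in> cball 0 R")
  case False
  then consider "R < norm (fst p)" | "R < norm (snd p)" by auto
  then have "leading \<xi> \<eta> p = 0"
    using A_supp by cases (auto simp: leading_def slope_def supported_in_ball_def)
  then show ?thesis by (simp add: dominator_def)
next
  case True
  let ?r = "norm (fst p - snd p)"
  have "norm (\<Sum>k\<in>UNIV. A (snd p) $ k * of_real (\<eta> $ k)) \<le> (\<Sum>k\<in>(UNIV::3 set). a * 1)"
  proof (rule order_trans[OF norm_sum], rule sum_mono)
    fix k :: 3
    show "norm (A (snd p) $ k * of_real (\<eta> $ k)) \<le> a * 1"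
      unfolding norm_mult norm_of_real
      using A_bound a_pos component_le_norm_cart[of \<eta> k] assms by (intro mult_mono) auto
  qed
  then have 1: "norm (\<Sum>k\<in>UNIV. A (snd p) $ k * of_real (\<eta> $ k)) \<le> 3 * a" by simp
  have "1 / (8 * pi * ?r) \<le> 1 / (1 * ?r)"
    using pi_8_ge by (cases "?r = 0") (auto intro!: divide_left_mono mult_right_mono)
  then have 2: "1 / (8 * pi * ?r) \<le> 1 / ?r" by simp
  have "norm (leading \<xi> \<eta> p) = 1 / (8 * pi * ?r) * norm (slope p) * norm (\<Sum>k\<in>UNIV. A (snd p) $ k * of_real (\<eta> $ k))"
    unfolding leading_def norm_mult norm_divide norm_of_real by simp
  also have "\<dots> \<le> 1 / ?r * (3 * a) * (3 * a)"
    using 1 2 slope_bound[of p] a_pos by (intro mult_mono) auto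
  finally show ?thesis using True by (simp add: dominator_def power2_eq_square)
qed

lemma leading_integrable:
  assumes "norm \<eta> = 1"
  shows "integrable (lborel \<Otimes>\<^sub>M lborel) (leading \<xi> \<eta>)"
  by (rule Bochner_Integration.integrable_bound[OF integrable_mult_right[OF dominator_integrable, of "9 * a^2"]])
     (use leading_bound[OF assms] order_trans[OF norm_ge_zero leading_bound[OF assms]] in \<open>auto intro!: AE_I2 simp: abs_of_nonneg\<close>)

lemma second_born_integral:
  assumes \<kappa>: "\<kappa> \<ge> 1" and \<theta>: "norm \<theta> = 1"
  shows "integrable (lborel \<Otimes>\<^sub>M lborel) (second_born \<omega> \<theta> \<kappa>)"
    "(LINT x|lborel. exp (- \<i> * of_real (\<kappa> * (\<omega> \<bullet> x))) * lower_order A V (R0 \<kappa> (source \<theta> \<kappa>)) x)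
      = integral\<^sup>L (lborel \<Otimes>\<^sub>M lborel) (second_born \<omega> \<theta> \<kappa>)"
proof -
  show int: "integrable (lborel \<Otimes>\<^sub>M lborel) (second_born \<omega> \<theta> \<kappa>)"
    by (rule Bochner_Integration.integrable_bound[OF integrable_mult_right[OF dominator_integrable, of "16 * a^2"]])
       (use second_born_bound[OF assms] order_trans[OF norm_ge_zero second_born_bound[OF assms]]
         in \<open>auto intro!: AE_I2 simp: abs_of_nonneg\<close>)
  have \<kappa>p: "\<kappa> > 0" using \<kappa> by simp
  have ints: "integrable lborel (source \<theta> \<kappa>)" by (rule integrable_supported_in_ball[OF source_cont source_supp])
  have "exp (- \<i> * of_real (\<kappa> * (\<omega> \<bullet> x))) * lower_order A V (R0 \<kappa> (source \<theta> \<kappa>)) x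
      = (LINT y|lborel. second_born \<omega> \<theta> \<kappa> (x, y))" for x
  proof -
    let ?e = "exp (- \<i> * of_real (\<kappa> * (\<omega> \<bullet> x)))" and ?s = "source \<theta> \<kappa>"
    have "second_born \<omega> \<theta> \<kappa> (x, y) = ?e * ((\<Sum>j\<in>UNIV. A x $ j * (DG \<kappa> (x - y) (axis j 1) * ?s y)) + V x * (G0 x y \<kappa> * ?s y))" for y
      by (simp add: second_born_def slope_def DG_def G0_eq sum_distrib_left sum_distrib_right distrib_right distrib_left mult_ac)
    then have "(LINT y|lborel. second_born \<omega> \<theta> \<kappa> (x, y))
        = ?e * ((\<Sum>j\<in>UNIV. A x $ j * (LINT y|lborel. DG \<kappa> (x - y) (axis j 1) * ?s y)) + V x * (LINT y|lborel. G0 x y \<kappa> * ?s y))"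
      using DG_integrable[OF \<kappa>p ints] G0_integrable[OF \<kappa>p ints] by simp
    then show ?thesis
      unfolding lower_order_def R0_differentiable(2)[OF \<kappa>p ints] by (simp add: R0_def)
  qed
  then show "(LINT x|lborel. exp (- \<i> * of_real (\<kappa> * (\<omega> \<bullet> x))) * lower_order A V (R0 \<kappa> (source \<theta> \<kappa>)) x)
      = integral\<^sup>L (lborel \<Otimes>\<^sub>M lborel) (second_born \<omega> \<theta> \<kappa>)"
    using lborel_pair.integral_fst'[OF int] by (simp only:)
qed

end

section \<open>Limits along the chosen directions\<close>

lemma in_dir_tendsto: "((\<lambda>\<kappa>. in_dir \<xi> \<eta> \<kappa> $ j) \<longlongrightarrow> \<eta> $ j) at_top"
proof -
  have "((\<lambda>\<kappa>. half_cos \<xi> \<kappa> * \<eta> $ j - (\<xi> $ j / 2) / \<kappa>) \<longlongrightarrow> 1 * \<eta> $ j - 0) at_top"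
    by (intro tendsto_intros half_cos_tendsto inverse_mult_null)
  then show ?thesis by (simp add: in_dir_def)
qed

text \<open>The product splits into a part independent of \<open>\<kappa>\<close>, the oscillation
  with the limiting direction \<open>\<eta>\<close>, and a correction tending to 1. For
  \<open>x = y\<close> the last two disappear, so the first Born term sees exactly the frequency
  \<open>\<xi>\<close>.\<close>

lemma wave_phase:
  assumes "\<kappa> > 0"
  shows "exp (- \<i> * of_real (\<kappa> * (out_dir \<xi> \<eta> \<kappa> \<bullet> x))) * plane_wave (in_dir \<xi> \<eta> \<kappa>) \<kappa> y
    = exp (- \<i> * of_real (\<xi> \<bullet> (x + y) / 2)) * exp (- \<i> * of_real (\<kappa> * (\<eta> \<bullet> (x - y))))
      * exp (\<i> * of_real (\<kappa> * (1 - half_cos \<xi> \<kappa>) * (\<eta> \<bullet> (x - y))))"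
proof -
  have 1: "\<kappa> * (out_dir \<xi> \<eta> \<kappa> \<bullet> x) = \<kappa> * half_cos \<xi> \<kappa> * (\<eta> \<bullet> x) + \<xi> \<bullet> x / 2"
    using assms by (simp add: out_dir_def inner_add_left field_simps)
  have 2: "\<kappa> * (y \<bullet> in_dir \<xi> \<eta> \<kappa>) = \<kappa> * half_cos \<xi> \<kappa> * (\<eta> \<bullet> y) - \<xi> \<bullet> y / 2"
    using assms by (simp add: in_dir_def inner_diff_right inner_commute[of y] field_simps)
  have "- (\<kappa> * (out_dir \<xi> \<eta> \<kappa> \<bullet> x)) + \<kappa> * (y \<bullet> in_dir \<xi> \<eta> \<kappa>)
      = - (\<xi> \<bullet> (x + y) / 2) + - (\<kappa> * (\<eta> \<bullet> (x - y))) + \<kappa> * (1 - half_cos \<xi> \<kappa>) * (\<eta> \<bullet> (x - y))"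
    unfolding 1 2 by (simp add: inner_add_right inner_diff_right algebra_simps add_divide_distrib)
  then have "\<i> * of_real (- (\<kappa> * (out_dir \<xi> \<eta> \<kappa> \<bullet> x)) + \<kappa> * (y \<bullet> in_dir \<xi> \<eta> \<kappa>))
      = \<i> * of_real (- (\<xi> \<bullet> (x + y) / 2) + - (\<kappa> * (\<eta> \<bullet> (x - y))) + \<kappa> * (1 - half_cos \<xi> \<kappa>) * (\<eta> \<bullet> (x - y)))"
    by (rule arg_cong)
  then show ?thesis
    unfolding plane_wave_def exp_add[symmetric] of_real_add of_real_minus distrib_left
    by (simp only: mult_minus_left mult_minus_right)
qed

lemma wave_phase_diag:
  assumes "\<kappa> > 0"
  shows "exp (- \<i> * of_real (\<kappa> * (out_dir \<xi> \<eta> \<kappa> \<bullet> y))) * plane_wave (in_dir \<xi> \<eta> \<kappa>) \<kappa> y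
    = exp (- \<i> * of_real (\<xi> \<bullet> y))"
proof -
  have "\<xi> \<bullet> (y + y) / 2 = \<xi> \<bullet> y" unfolding inner_add_right by simp
  then show ?thesis unfolding wave_phase[OF assms] by simp
qed

context potential
begin

lemma second_born_tendsto:
  assumes "fst p \<noteq> snd p"
  shows "((\<lambda>\<kappa>. second_born (out_dir \<xi> \<eta> \<kappa>) (in_dir \<xi> \<eta> \<kappa>) \<kappa> p
    - exp (\<i> * of_real (\<kappa> * ray_phase \<eta> p)) * leading \<xi> \<eta> p) \<longlongrightarrow> 0) at_top"
proof -
  obtain x y where p: "p = (x, y)" by (cases p)
  define z where "z = x - y"
  define r where "r = norm z"
  have r: "r > 0" using assms by (simp add: r_def z_def p)
  define \<alpha> where "\<alpha> = slope p"
  define v where "v = V x"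
  define w where "w = V y"
  define E0 where "E0 = exp (- \<i> * of_real (\<xi> \<bullet> (x + y) / 2))"
  define e where "e = (\<lambda>\<kappa>. exp (- \<i> * of_real (\<kappa> * (\<eta> \<bullet> z))))"
  define d where "d = (\<lambda>\<kappa>. exp (\<i> * of_real (\<kappa> * (1 - half_cos \<xi> \<kappa>) * (\<eta> \<bullet> z))))"
  define \<beta> where "\<beta> = (\<lambda>\<kappa>. \<Sum>j\<in>UNIV. A y $ j * (\<i> * of_real (in_dir \<xi> \<eta> \<kappa> $ j)))"
  define \<beta>0 where "\<beta>0 = (\<Sum>j\<in>UNIV. A y $ j * (\<i> * of_real (\<eta> $ j)))"
  define L where "L = (\<lambda>\<kappa>. \<i> * exp (\<i> * of_real (\<kappa> * r)) / of_real (8 * pi * r))"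
  let ?g = "\<lambda>\<kappa>. gker \<kappa> r" and ?g' = "\<lambda>\<kappa>. gker' \<kappa> r"
  have \<beta>_lim: "(\<beta> \<longlongrightarrow> \<beta>0) at_top"
    unfolding \<beta>_def \<beta>0_def by (intro tendsto_intros in_dir_tendsto)
  have d_lim: "(d \<longlongrightarrow> 1) at_top"
  proof -
    have "(d \<longlongrightarrow> exp (\<i> * of_real (0 * (\<eta> \<bullet> z)))) at_top"
      unfolding d_def by (intro tendsto_intros half_cos_defect_tendsto)
    then show ?thesis by simp
  qed
  have L_bound: "\<forall>\<^sub>F \<kappa> in at_top. norm (\<alpha> * L \<kappa>) \<le> norm \<alpha> * (1 / (8 * pi * r))"
    using r by (intro always_eventually allI) (simp add: L_def norm_mult norm_divide)
  \<comment> \<open>The difference, without its common phase, is arranged so that each summand has a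
    null factor. Since \<open>L\<close> oscillates and is merely bounded, the second summand needs
    \<open>bounded_times_null\<close> instead of a product of limits.\<close>
  have bracket: "((\<lambda>\<kappa>. (d \<kappa> * \<beta> \<kappa> * \<alpha>) * (of_real \<kappa> * ?g' \<kappa> - L \<kappa>) + (\<alpha> * L \<kappa>) * (d \<kappa> * \<beta> \<kappa> - \<beta>0)
      + (d \<kappa> * \<alpha> * w) * ?g' \<kappa> + (d \<kappa> * v * \<beta> \<kappa>) * (of_real \<kappa> * ?g \<kappa>) + (d \<kappa> * v * w) * ?g \<kappa>) \<longlongrightarrow> 0) at_top"
  proof -
    have 1: "((\<lambda>\<kappa>. of_real \<kappa> * ?g' \<kappa> - L \<kappa>) \<longlongrightarrow> 0) at_top"
      unfolding L_def by (rule gker_limits(4)[OF r])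
    have "((\<lambda>\<kappa>. d \<kappa> * \<beta> \<kappa> - \<beta>0) \<longlongrightarrow> 1 * \<beta>0 - \<beta>0) at_top"
      by (intro tendsto_intros d_lim \<beta>_lim)
    then have 2: "((\<lambda>\<kappa>. (\<alpha> * L \<kappa>) * (d \<kappa> * \<beta> \<kappa> - \<beta>0)) \<longlongrightarrow> 0) at_top"
      using bounded_times_null[OF L_bound] by simp
    have "((\<lambda>\<kappa>. (d \<kappa> * \<beta> \<kappa> * \<alpha>) * (of_real \<kappa> * ?g' \<kappa> - L \<kappa>) + (\<alpha> * L \<kappa>) * (d \<kappa> * \<beta> \<kappa> - \<beta>0)
      + (d \<kappa> * \<alpha> * w) * ?g' \<kappa> + (d \<kappa> * v * \<beta> \<kappa>) * (of_real \<kappa> * ?g \<kappa>) + (d \<kappa> * v * w) * ?g \<kappa>) \<longlongrightarrow>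
      (1 * \<beta>0 * \<alpha>) * 0 + 0 + (1 * \<alpha> * w) * 0 + (1 * v * \<beta>0) * 0 + (1 * v * w) * 0) at_top"
      by (intro tendsto_add tendsto_mult d_lim \<beta>_lim tendsto_const 1 2 gker_limits[OF r])
    then show ?thesis by simp
  qed
  have E_bound: "\<forall>\<^sub>F \<kappa> in at_top. norm (E0 * e \<kappa>) \<le> 1"
    by (intro always_eventually allI) (simp add: E0_def e_def norm_mult)
  have eq: "\<forall>\<^sub>F \<kappa> in at_top. (E0 * e \<kappa>) * ((d \<kappa> * \<beta> \<kappa> * \<alpha>) * (of_real \<kappa> * ?g' \<kappa> - L \<kappa>) + (\<alpha> * L \<kappa>) * (d \<kappa> * \<beta> \<kappa> - \<beta>0)
      + (d \<kappa> * \<alpha> * w) * ?g' \<kappa> + (d \<kappa> * v * \<beta> \<kappa>) * (of_real \<kappa> * ?g \<kappa>) + (d \<kappa> * v * w) * ?g \<kappa>)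
      = second_born (out_dir \<xi> \<eta> \<kappa>) (in_dir \<xi> \<eta> \<kappa>) \<kappa> p - exp (\<i> * of_real (\<kappa> * ray_phase \<eta> p)) * leading \<xi> \<eta> p"
    using eventually_gt_at_top[of 0]
  proof eventually_elim
    fix \<kappa> :: real assume \<kappa>: "\<kappa> > 0"
    have "source (in_dir \<xi> \<eta> \<kappa>) \<kappa> y = (of_real \<kappa> * \<beta> \<kappa> + w) * plane_wave (in_dir \<xi> \<eta> \<kappa>) \<kappa> y"
      unfolding source_eq \<beta>_def w_def sum_distrib_left by (simp add: mult_ac)
    then have "second_born (out_dir \<xi> \<eta> \<kappa>) (in_dir \<xi> \<eta> \<kappa>) \<kappa> p
        = (exp (- \<i> * of_real (\<kappa> * (out_dir \<xi> \<eta> \<kappa> \<bullet> x))) * plane_wave (in_dir \<xi> \<eta> \<kappa>) \<kappa> y)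
          * ((?g' \<kappa> * \<alpha> + v * ?g \<kappa>) * (of_real \<kappa> * \<beta> \<kappa> + w))"
      by (simp add: second_born_def p \<alpha>_def v_def r_def z_def mult_ac)
    also have "\<dots> = (E0 * e \<kappa> * d \<kappa>) * ((?g' \<kappa> * \<alpha> + v * ?g \<kappa>) * (of_real \<kappa> * \<beta> \<kappa> + w))"
      unfolding wave_phase[OF \<kappa>] E0_def e_def d_def z_def ..
    finally have sb: "second_born (out_dir \<xi> \<eta> \<kappa>) (in_dir \<xi> \<eta> \<kappa>) \<kappa> p
        = (E0 * e \<kappa> * d \<kappa>) * ((?g' \<kappa> * \<alpha> + v * ?g \<kappa>) * (of_real \<kappa> * \<beta> \<kappa> + w))" .
    have ph: "exp (\<i> * of_real (\<kappa> * ray_phase \<eta> p)) = exp (\<i> * of_real (\<kappa> * r)) * e \<kappa>"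
    proof -
      have "\<i> * of_real (\<kappa> * ray_phase \<eta> p) = \<i> * of_real (\<kappa> * r) + - \<i> * of_real (\<kappa> * (\<eta> \<bullet> z))"
        by (simp add: ray_phase_def p r_def z_def algebra_simps)
      then show ?thesis unfolding e_def exp_add[symmetric] by (rule arg_cong)
    qed
    have b0: "\<i> * (\<Sum>k\<in>UNIV. A y $ k * of_real (\<eta> $ k)) = \<beta>0"
      unfolding \<beta>0_def sum_distrib_left by (simp add: mult_ac)
    have "leading \<xi> \<eta> p = E0 * (\<i> / of_real (8 * pi * r) * \<alpha>) * \<beta>0"
      unfolding leading_def \<alpha>_def b0[symmetric] by (simp add: p E0_def r_def z_def)
    then have ld: "exp (\<i> * of_real (\<kappa> * ray_phase \<eta> p)) * leading \<xi> \<eta> p = E0 * e \<kappa> * (\<alpha> * L \<kappa> * \<beta>0)"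
      unfolding ph L_def by (simp add: mult_ac)
    show "(E0 * e \<kappa>) * ((d \<kappa> * \<beta> \<kappa> * \<alpha>) * (of_real \<kappa> * ?g' \<kappa> - L \<kappa>) + (\<alpha> * L \<kappa>) * (d \<kappa> * \<beta> \<kappa> - \<beta>0)
      + (d \<kappa> * \<alpha> * w) * ?g' \<kappa> + (d \<kappa> * v * \<beta> \<kappa>) * (of_real \<kappa> * ?g \<kappa>) + (d \<kappa> * v * w) * ?g \<kappa>)
      = second_born (out_dir \<xi> \<eta> \<kappa>) (in_dir \<xi> \<eta> \<kappa>) \<kappa> p - exp (\<i> * of_real (\<kappa> * ray_phase \<eta> p)) * leading \<xi> \<eta> p"
      unfolding sb ld by (simp only: algebra_simps)
  qed
  show ?thesis
    by (rule Lim_transform_eventually[OF bounded_times_null[OF E_bound bracket] eq])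
qed

text \<open>On the diagonal both phases combine to the Fourier character at \<open>\<xi>\<close>,
  and \<open>\<kappa> * in_dir\<close> is \<open>\<kappa> * half_cos\<close> times
  \<open>\<eta>\<close> minus \<open>\<xi> / 2\<close>. The second part gives the term with
  \<open>- \<i> / 2\<close>, independent of \<open>\<kappa>\<close>.\<close>

lemma born_term:
  assumes "\<kappa> > 0"
  shows "(LINT y|lborel. exp (- \<i> * of_real (\<kappa> * (out_dir \<xi> \<eta> \<kappa> \<bullet> y))) * source (in_dir \<xi> \<eta> \<kappa>) \<kappa> y)
    = \<i> * of_real (\<kappa> * half_cos \<xi> \<kappa>) * (\<Sum>j\<in>UNIV. of_real (\<eta> $ j) * FT (\<lambda>x. A x $ j) \<xi>)
      + (FT V \<xi> - \<i> / 2 * (\<Sum>j\<in>UNIV. of_real (\<xi> $ j) * FT (\<lambda>x. A x $ j) \<xi>))"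
proof -
  let ?E = "\<lambda>y. exp (- \<i> * of_real (\<xi> \<bullet> y))"
  let ?c = "\<lambda>j. \<i> * of_real (\<kappa> * in_dir \<xi> \<eta> \<kappa> $ j)"
  have cE: "continuous_on UNIV ?E" by (intro continuous_intros)
  have iA: "integrable lborel (\<lambda>y. ?E y * A y $ j)" for j
    by (rule integrable_supported_in_ball[OF _ supported_in_ball_mult(1)[OF A_supp]]) (intro continuous_intros A_cont)
  have iV: "integrable lborel (\<lambda>y. ?E y * V y)"
    by (rule integrable_supported_in_ball[OF _ supported_in_ball_mult(1)[OF V_supp]]) (intro continuous_intros V_cont)
  have "exp (- \<i> * of_real (\<kappa> * (out_dir \<xi> \<eta> \<kappa> \<bullet> y))) * source (in_dir \<xi> \<eta> \<kappa>) \<kappa> y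
      = (\<Sum>j\<in>UNIV. ?c j * (?E y * A y $ j)) + ?E y * V y" for y
  proof -
    have "exp (- \<i> * of_real (\<kappa> * (out_dir \<xi> \<eta> \<kappa> \<bullet> y))) * source (in_dir \<xi> \<eta> \<kappa>) \<kappa> y
      = (exp (- \<i> * of_real (\<kappa> * (out_dir \<xi> \<eta> \<kappa> \<bullet> y))) * plane_wave (in_dir \<xi> \<eta> \<kappa>) \<kappa> y) *
        ((\<Sum>j\<in>UNIV. A y $ j * ?c j) + V y)"
      unfolding source_eq by (simp only: mult_ac)
    then show ?thesis unfolding wave_phase_diag[OF assms] by (simp add: distrib_left sum_distrib_left mult_ac)
  qed
  then have born: "(LINT y|lborel. exp (- \<i> * of_real (\<kappa> * (out_dir \<xi> \<eta> \<kappa> \<bullet> y))) * source (in_dir \<xi> \<eta> \<kappa>) \<kappa> y)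
      = (\<Sum>j\<in>UNIV. ?c j * FT (\<lambda>x. A x $ j) \<xi>) + FT V \<xi>"
    using iA iV by (simp add: FT_def)
  have c: "?c j = \<i> * of_real (\<kappa> * half_cos \<xi> \<kappa>) * of_real (\<eta> $ j) - \<i> / 2 * of_real (\<xi> $ j)" for j
    using assms by (simp add: in_dir_def field_simps)
  show ?thesis
    unfolding born c by (simp add: sum_subtractf left_diff_distrib sum_distrib_left mult.assoc)
qed

text \<open>Two errors are added: the amplitude against first Born minus second Born, of order
  \<open>1 / \<kappa>\<close>, and the second Born integral against its oscillatory model, which
  vanishes by dominated convergence.\<close>

lemma amplitude_asymptotics:
  assumes "norm \<eta> = 1" "\<eta> \<bullet> \<xi> = 0"
  shows "((\<lambda>\<kappa>. scattering_amplitude A V (out_dir \<xi> \<eta> \<kappa>) (in_dir \<xi> \<eta> \<kappa>) \<kappa>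
      - (\<i> * of_real (\<kappa> * half_cos \<xi> \<kappa>) * (\<Sum>j\<in>UNIV. of_real (\<eta> $ j) * FT (\<lambda>x. A x $ j) \<xi>)
        + (FT V \<xi> - \<i> / 2 * (\<Sum>j\<in>UNIV. of_real (\<xi> $ j) * FT (\<lambda>x. A x $ j) \<xi>)))
      + (LINT p|(lborel \<Otimes>\<^sub>M lborel). exp (\<i> * of_real (\<kappa> * ray_phase \<eta> p)) * leading \<xi> \<eta> p)) \<longlongrightarrow> 0) at_top"
proof -
  have large: "\<forall>\<^sub>F \<kappa> in at_top. \<kappa> \<ge> \<kappa>0 \<and> \<kappa> > 0 \<and> norm \<xi> \<le> 2 * \<kappa>"
    using eventually_ge_at_top[of \<kappa>0] eventually_gt_at_top[of 0] eventually_ge_at_top[of "norm \<xi>"]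
    by eventually_elim auto
  define F where "F = (\<lambda>\<kappa>. LINT p|(lborel \<Otimes>\<^sub>M lborel). exp (\<i> * of_real (\<kappa> * ray_phase \<eta> p)) * leading \<xi> \<eta> p)"
  define S where "S = (\<lambda>\<kappa>. integral\<^sup>L (lborel \<Otimes>\<^sub>M lborel) (second_born (out_dir \<xi> \<eta> \<kappa>) (in_dir \<xi> \<eta> \<kappa>) \<kappa>))"
  define Born where "Born = (\<lambda>\<kappa>. \<i> * of_real (\<kappa> * half_cos \<xi> \<kappa>) * (\<Sum>j\<in>UNIV. of_real (\<eta> $ j) * FT (\<lambda>x. A x $ j) \<xi>)
        + (FT V \<xi> - \<i> / 2 * (\<Sum>j\<in>UNIV. of_real (\<xi> $ j) * FT (\<lambda>x. A x $ j) \<xi>)))"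
  define amp where "amp = (\<lambda>\<kappa>. scattering_amplitude A V (out_dir \<xi> \<eta> \<kappa>) (in_dir \<xi> \<eta> \<kappa>) \<kappa>)"
  have ray_meas [measurable]: "ray_phase \<eta> \<in> borel_measurable (lborel \<Otimes>\<^sub>M lborel)"
    unfolding ray_phase_def by measurable
  have int_lead: "integrable (lborel \<Otimes>\<^sub>M lborel) (\<lambda>p. exp (\<i> * of_real (\<kappa> * ray_phase \<eta> p)) * leading \<xi> \<eta> p)" for \<kappa>
    by (rule integrable_bounded_mult(1)[OF leading_integrable[OF assms(1)], where b=1]) auto
  have SF: "((\<lambda>\<kappa>. S \<kappa> - F \<kappa>) \<longlongrightarrow> 0) at_top"
  proof -
    have T1: "((\<lambda>\<kappa>. LINT p|(lborel \<Otimes>\<^sub>M lborel). (second_born (out_dir \<xi> \<eta> \<kappa>) (in_dir \<xi> \<eta> \<kappa>) \<kappa> p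
        - exp (\<i> * of_real (\<kappa> * ray_phase \<eta> p)) * leading \<xi> \<eta> p)) \<longlongrightarrow> (LINT p|((lborel :: (real^3) measure) \<Otimes>\<^sub>M (lborel :: (real^3) measure)). 0)) at_top"
    \<comment> \<open>The constant is \<open>16 + 9\<close>, from \<open>second_born_bound\<close>
      and \<open>leading_bound\<close>.\<close>
    proof (rule integral_dominated_convergence_at_top[where w="\<lambda>p. 25 * a^2 * dominator p"])
      show "integrable (lborel \<Otimes>\<^sub>M lborel) (\<lambda>p. 25 * a^2 * dominator p)"
        by (intro integrable_mult_right dominator_integrable)
      have "AE p in lborel. ray_phase \<eta> p \<noteq> 0" by (rule ray_phase_nonzero[OF assms(1)])
      then have "AE p in lborel \<Otimes>\<^sub>M lborel. ray_phase \<eta> p \<noteq> 0" by (simp only: lborel_prod)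
      then show "AE p in lborel \<Otimes>\<^sub>M lborel. ((\<lambda>\<kappa>. second_born (out_dir \<xi> \<eta> \<kappa>) (in_dir \<xi> \<eta> \<kappa>) \<kappa> p
        - exp (\<i> * of_real (\<kappa> * ray_phase \<eta> p)) * leading \<xi> \<eta> p) \<longlongrightarrow> 0) at_top"
      proof eventually_elim
        fix p assume "ray_phase \<eta> p \<noteq> 0"
        then have "fst p \<noteq> snd p" by (auto simp: ray_phase_def)
        then show "((\<lambda>\<kappa>. second_born (out_dir \<xi> \<eta> \<kappa>) (in_dir \<xi> \<eta> \<kappa>) \<kappa> p
          - exp (\<i> * of_real (\<kappa> * ray_phase \<eta> p)) * leading \<xi> \<eta> p) \<longlongrightarrow> 0) at_top"
          by (rule second_born_tendsto)
      qed
      show "\<forall>\<^sub>F \<kappa> in at_top. AE p in lborel \<Otimes>\<^sub>M lborel. norm (second_born (out_dir \<xi> \<eta> \<kappa>) (in_dir \<xi> \<eta> \<kappa>) \<kappa> p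
        - exp (\<i> * of_real (\<kappa> * ray_phase \<eta> p)) * leading \<xi> \<eta> p) \<le> 25 * a^2 * dominator p"
        using large
      proof eventually_elim
        fix \<kappa> assume \<kappa>: "\<kappa> \<ge> \<kappa>0 \<and> \<kappa> > 0 \<and> norm \<xi> \<le> 2 * \<kappa>"
        then have "\<kappa> \<ge> 1" "norm (in_dir \<xi> \<eta> \<kappa>) = 1"
          using \<kappa>0(1) dir_norm(2)[of \<kappa> \<xi> \<eta>] assms by auto
        show "AE p in lborel \<Otimes>\<^sub>M lborel. norm (second_born (out_dir \<xi> \<eta> \<kappa>) (in_dir \<xi> \<eta> \<kappa>) \<kappa> p
        - exp (\<i> * of_real (\<kappa> * ray_phase \<eta> p)) * leading \<xi> \<eta> p) \<le> 25 * a^2 * dominator p"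
        proof (rule AE_I2)
          fix p
          have "norm (second_born (out_dir \<xi> \<eta> \<kappa>) (in_dir \<xi> \<eta> \<kappa>) \<kappa> p - exp (\<i> * of_real (\<kappa> * ray_phase \<eta> p)) * leading \<xi> \<eta> p)
            \<le> norm (second_born (out_dir \<xi> \<eta> \<kappa>) (in_dir \<xi> \<eta> \<kappa>) \<kappa> p) + norm (exp (\<i> * of_real (\<kappa> * ray_phase \<eta> p)) * leading \<xi> \<eta> p)"
            by (rule norm_triangle_ineq4)
          also have "norm (exp (\<i> * of_real (\<kappa> * ray_phase \<eta> p)) * leading \<xi> \<eta> p) = norm (leading \<xi> \<eta> p)"
            by (simp add: norm_mult)
          also have "norm (second_born (out_dir \<xi> \<eta> \<kappa>) (in_dir \<xi> \<eta> \<kappa>) \<kappa> p) + norm (leading \<xi> \<eta> p)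
              \<le> 16 * a^2 * dominator p + 9 * a^2 * dominator p"
            by (intro add_mono second_born_bound leading_bound assms) fact+
          finally show "norm (second_born (out_dir \<xi> \<eta> \<kappa>) (in_dir \<xi> \<eta> \<kappa>) \<kappa> p - exp (\<i> * of_real (\<kappa> * ray_phase \<eta> p)) * leading \<xi> \<eta> p)
            \<le> 25 * a^2 * dominator p" by (simp add: mult_ac)
        qed
      qed
    qed measurable
    have T2: "\<forall>\<^sub>F \<kappa> in at_top. (LINT p|(lborel \<Otimes>\<^sub>M lborel). (second_born (out_dir \<xi> \<eta> \<kappa>) (in_dir \<xi> \<eta> \<kappa>) \<kappa> p
        - exp (\<i> * of_real (\<kappa> * ray_phase \<eta> p)) * leading \<xi> \<eta> p)) = S \<kappa> - F \<kappa>"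
      using large
    proof eventually_elim
      fix \<kappa> assume \<kappa>: "\<kappa> \<ge> \<kappa>0 \<and> \<kappa> > 0 \<and> norm \<xi> \<le> 2 * \<kappa>"
      then have "\<kappa> \<ge> 1" "norm (in_dir \<xi> \<eta> \<kappa>) = 1"
        using \<kappa>0(1) dir_norm(2)[of \<kappa> \<xi> \<eta>] assms by auto
      then show "(LINT p|(lborel \<Otimes>\<^sub>M lborel). (second_born (out_dir \<xi> \<eta> \<kappa>) (in_dir \<xi> \<eta> \<kappa>) \<kappa> p
        - exp (\<i> * of_real (\<kappa> * ray_phase \<eta> p)) * leading \<xi> \<eta> p)) = S \<kappa> - F \<kappa>"
        unfolding S_def F_def
        by (intro Bochner_Integration.integral_diff second_born_integral(1) int_lead)
    qed
    from Lim_transform_eventually[OF T1 T2] show ?thesis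
      unfolding Bochner_Integration.integral_zero .
  qed
  \<comment> \<open>The constant of \<open>scat_density_second_born\<close>; integrating over the
    support multiplies it by the volume of the ball.\<close>
  define K where "K = 128 * a^3 * PR^2"
  have err: "((\<lambda>\<kappa>. amp \<kappa> - (Born \<kappa> - S \<kappa>)) \<longlongrightarrow> 0) at_top"
  proof (rule Lim_null_comparison[OF _ inverse_mult_null[of "K * measure lborel (cball (0::real^3) R)"]])
    show "\<forall>\<^sub>F \<kappa> in at_top. norm (amp \<kappa> - (Born \<kappa> - S \<kappa>)) \<le> K * measure lborel (cball (0::real^3) R) / \<kappa>"
      using large
    proof eventually_elim
      fix \<kappa> assume "\<kappa> \<ge> \<kappa>0 \<and> \<kappa> > 0 \<and> norm \<xi> \<le> 2 * \<kappa>"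
      then have \<kappa>: "\<kappa> \<ge> \<kappa>0" "\<kappa> > 0" "\<kappa> \<ge> 1" and \<theta>: "norm (in_dir \<xi> \<eta> \<kappa>) = 1"
        using \<kappa>0(1) dir_norm(2)[of \<kappa> \<xi> \<eta>] assms by auto
      let ?\<omega> = "out_dir \<xi> \<eta> \<kappa>" and ?\<theta> = "in_dir \<xi> \<eta> \<kappa>"
      let ?e = "\<lambda>y. exp (- \<i> * of_real (\<kappa> * (?\<omega> \<bullet> y)))"
      let ?f = "scat_density ?\<theta> \<kappa>" and ?s = "source ?\<theta> \<kappa>" and ?l = "lower_order A V (R0 \<kappa> (source ?\<theta> \<kappa>))"
      have ints: "integrable lborel ?s" by (rule integrable_supported_in_ball[OF source_cont source_supp])
      have ce: "continuous_on UNIV ?e" by (intro continuous_intros)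
      have l_cont: "continuous_on UNIV ?l" by (rule lower_order_R0_cont[OF \<kappa>(2) ints])
      have i1: "integrable lborel (\<lambda>y. ?e y * ?f y)"
        by (rule integrable_supported_in_ball[OF _ supported_in_ball_mult(1)[OF scat_density(2)[OF \<kappa>(1)]]])
           (intro continuous_on_mult ce scat_density(1)[OF \<kappa>(1)])
      have i2: "integrable lborel (\<lambda>y. ?e y * ?s y)"
        by (rule integrable_supported_in_ball[OF _ supported_in_ball_mult(1)[OF source_supp]])
           (intro continuous_on_mult ce source_cont)
      have i3: "integrable lborel (\<lambda>y. ?e y * ?l y)"
        by (rule integrable_supported_in_ball[OF _ supported_in_ball_mult(1)[OF lower_order_supp]])
           (intro continuous_on_mult ce l_cont)
      have e1: "Born \<kappa> = (LINT y|lborel. ?e y * ?s y)"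
        unfolding Born_def by (rule born_term[OF \<kappa>(2), symmetric])
      have e2: "S \<kappa> = (LINT y|lborel. ?e y * ?l y)"
        unfolding S_def by (rule second_born_integral(2)[OF \<kappa>(3) \<theta>, symmetric])
      have e3: "amp \<kappa> = (LINT y|lborel. ?e y * ?f y)"
        unfolding amp_def by (rule scattering_amplitude_eq[OF \<kappa>(1) \<theta>])
      have "amp \<kappa> - (Born \<kappa> - S \<kappa>) = (LINT y|lborel. ?e y * ?f y) - ((LINT y|lborel. ?e y * ?s y) - (LINT y|lborel. ?e y * ?l y))"
        by (simp only: e1 e2 e3)
      also have "\<dots> = (LINT y|lborel. ?e y * ?f y - (?e y * ?s y - ?e y * ?l y))"
        by (simp only: Bochner_Integration.integral_diff[OF i1 Bochner_Integration.integrable_diff[OF i2 i3]]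
            Bochner_Integration.integral_diff[OF i2 i3])
      also have "\<dots> = (LINT y|lborel. ?e y * (?f y - (?s y - ?l y)))"
        by (simp only: right_diff_distrib)
      finally have eqn: "amp \<kappa> - (Born \<kappa> - S \<kappa>) = (LINT y|lborel. ?e y * (?f y - (?s y - ?l y)))" .
      have "norm (amp \<kappa> - (Born \<kappa> - S \<kappa>)) \<le> (LINT y|lborel. norm (?e y * (?f y - (?s y - ?l y))))"
        unfolding eqn by (rule integral_norm_bound)
      also have "\<dots> \<le> (LINT y|lborel. K / \<kappa> * indicator (cball 0 R) (y::real^3))"
      proof (rule integral_mono)
        show "integrable lborel (\<lambda>y. norm (?e y * (?f y - (?s y - ?l y))))"
          unfolding right_diff_distrib by (intro integrable_norm Bochner_Integration.integrable_diff i1 i2 i3)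
        show "integrable lborel (\<lambda>y::real^3. K / \<kappa> * indicator (cball 0 R) y)"
          by (intro integrable_mult_right integrable_real_indicator emeasure_bounded_finite) auto
        fix y
        show "norm (?e y * (?f y - (?s y - ?l y))) \<le> K / \<kappa> * indicator (cball 0 R) y"
        proof (cases "y \<in> cball 0 R")
          case True
          then show ?thesis using scat_density_second_born[OF \<kappa>(1) \<theta>, of y]
            by (simp add: norm_mult K_def)
        next
          case False
          then have "?f y = 0" "?s y = 0" "?l y = 0"
            using scat_density(2)[OF \<kappa>(1)] source_supp lower_order_supp by (auto simp: supported_in_ball_def)
          then show ?thesis using False by simp
        qed
      qed
      also have "\<dots> = K * measure lborel (cball (0::real^3) R) / \<kappa>" by simp
      finally show "norm (amp \<kappa> - (Born \<kappa> - S \<kappa>)) \<le> K * measure lborel (cball (0::real^3) R) / \<kappa>" .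
    qed
  qed
  have split: "(amp \<kappa> - (Born \<kappa> - S \<kappa>)) - (S \<kappa> - F \<kappa>) = amp \<kappa> - Born \<kappa> + F \<kappa>" for \<kappa>
    by simp
  have "((\<lambda>\<kappa>. amp \<kappa> - Born \<kappa> + F \<kappa>) \<longlongrightarrow> 0 - 0) at_top"
    unfolding split[symmetric] by (intro tendsto_diff err SF)
  then show ?thesis unfolding amp_def Born_def F_def by (simp only: diff_zero)
qed

end

section \<open>Recovery of the coefficients\<close>

lemma ex_potential:
  assumes "Ck 1 A" "Ck 1 V" "compactly_supported A" "compactly_supported V"
  obtains R a where "potential A V R a"
proof -
  obtain RA RV where RA: "supported_in_ball RA A" and RV: "supported_in_ball RV V"
    using assms(3,4) by (auto simp: compactly_supported_iff)
  define R where "R = max 1 (max RA RV)"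
  have R: "supported_in_ball R A" "supported_in_ball R V"
    using supported_in_ball_mono[OF RA, of R] supported_in_ball_mono[OF RV, of R] by (auto simp: R_def)
  note cA = Ck_1D(1)[OF assms(1)] and cV = Ck_1D(1)[OF assms(2)]
  obtain BA where BA: "BA > 0" "\<And>x. norm (A x) \<le> BA * indicator (cball 0 R) x"
    using bounded_supported_in_ball[OF cA R(1)] by blast
  obtain BV where BV: "BV > 0" "\<And>x. norm (V x) \<le> BV * indicator (cball 0 R) x"
    using bounded_supported_in_ball[OF cV R(2)] by blast
  have ind: "b * indicator (cball 0 R) x \<le> b" if "b > 0" for b :: real and x :: "real^3"
    using that by (auto simp: indicator_def)
  have "potential A V R (BA + BV)"
  proof
    fix x :: "real^3" and j :: 3
    show "continuous_on UNIV (\<lambda>x. A x $ j)" by (intro continuous_intros cA)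
    show "continuous_on UNIV V" by (rule cV)
    show "supported_in_ball R (\<lambda>x. A x $ j)" "supported_in_ball R V"
      using R by (auto simp: supported_in_ball_def)
    show "norm (A x $ j) \<le> BA + BV"
      using Finite_Cartesian_Product.norm_nth_le[of "A x" j] BA(2)[of x] ind[OF BA(1), of x] BV(1) by linarith
    show "norm (V x) \<le> BA + BV" using BV(2)[of x] ind[OF BV(1), of x] BA(1) by linarith
    show "R > 0" by (simp add: R_def less_max_iff_disj)
    show "BA + BV > 0" using BA(1) BV(1) by simp
  qed
  then show thesis by (rule that)
qed

lemma FT_partial:
  assumes "\<And>x. f differentiable (at x)" "continuous_on UNIV f" "continuous_on UNIV (partial j f)"
    "supported_in_ball R f"
  shows "FT (partial j f) \<xi> = \<i> * of_real (\<xi> $ j) * FT f \<xi>"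
proof -
  \<comment> \<open>The Fourier character is a plane wave with spectral parameter
    \<open>- 1\<close>, so the derivative formulas for plane waves apply to it.\<close>
  let ?e = "plane_wave \<xi> (- 1)" and ?e' = "\<lambda>x. \<i> * of_real (- 1 * \<xi> $ j) * plane_wave \<xi> (- 1) x"
  have e: "exp (- \<i> * of_real (\<xi> \<bullet> x)) = ?e x" for x
    by (simp add: plane_wave_def inner_commute)
  have "partial j ?e = ?e'" by (rule ext) (rule plane_wave_facts(3))
  then have d: "dir_deriv j ?e ?e'"
    using dir_deriv_partial[OF plane_wave_facts(1), of j \<xi> "- 1"] by simp
  have "(LINT x|lborel. ?e x * partial j f x) = - (LINT x|lborel. ?e' x * f x)"
    by (rule integral_by_parts[OF d _ _ dir_deriv_partial[OF assms(1)] assms(2,3,4)])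
       (intro continuous_intros plane_wave_facts)+
  also have "\<dots> = \<i> * of_real (\<xi> $ j) * (LINT x|lborel. ?e x * f x)"
    by (simp add: mult.assoc)
  finally show ?thesis unfolding FT_def e .
qed

lemma FT_linear:
  assumes "integrable lborel f" "integrable lborel g"
  shows "FT (\<lambda>x. f x + c * g x) \<xi> = FT f \<xi> + c * FT g \<xi>"
proof -
  have "integrable lborel (\<lambda>x. exp (- \<i> * of_real (\<xi> \<bullet> x)) * h x)" if "integrable lborel h" for h
    by (rule integrable_bounded_mult(1)[OF that, where b=1]) auto
  from this[OF assms(1)] this[OF assms(2)] show ?thesis
    by (simp add: FT_def distrib_left mult.left_commute)
qed

text \<open>With \<open>d\<close> and \<open>c\<close> the differences of the two Fourier quantities
  and \<open>F\<close> the difference of the oscillatory integrals, the expression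
  \<open>\<i> \<kappa> half_cos d + c - F\<close> tends to 0. The order matters: \<open>d\<close>
  must vanish before the convergence of \<open>F\<close> can be inferred.\<close>

lemma asymptotics_determine_FT:
  assumes P: "potential A V R a" and Q: "potential A' V' R' a'"
    and \<eta>: "norm \<eta> = 1" "\<eta> \<bullet> \<xi> = 0"
    and eq: "\<forall>\<^sub>F \<kappa> in at_top. \<forall>\<omega>\<in>sphere 0 1. \<forall>\<theta>\<in>sphere 0 1.
       norm (scattering_amplitude A V \<omega> \<theta> \<kappa> - scattering_amplitude A' V' \<omega> \<theta> \<kappa>) \<le> C / \<kappa>^3"
  shows "(\<Sum>j\<in>UNIV. of_real (\<eta> $ j) * FT (\<lambda>x. A x $ j) \<xi>) = (\<Sum>j\<in>UNIV. of_real (\<eta> $ j) * FT (\<lambda>x. A' x $ j) \<xi>)"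
    (is "?D = ?D'")
    and "FT V \<xi> - \<i> / 2 * (\<Sum>j\<in>UNIV. of_real (\<xi> $ j) * FT (\<lambda>x. A x $ j) \<xi>)
      = FT V' \<xi> - \<i> / 2 * (\<Sum>j\<in>UNIV. of_real (\<xi> $ j) * FT (\<lambda>x. A' x $ j) \<xi>)" (is "?Q = ?Q'")
proof -
  interpret P: potential A V R a by (rule P)
  interpret Q: potential A' V' R' a' by (rule Q)
  define M where "M = (\<lambda>p. P.leading \<xi> \<eta> p - Q.leading \<xi> \<eta> p)"
  have M: "integrable lborel M"
    unfolding M_def lborel_prod[symmetric]
    by (intro Bochner_Integration.integrable_diff P.leading_integrable Q.leading_integrable \<eta>)
  define F where "F = (\<lambda>\<kappa>. LINT p|lborel. exp (\<i> * of_real (\<kappa> * ray_phase \<eta> p)) * M p)"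
  have ray_meas [measurable]: "ray_phase \<eta> \<in> borel_measurable borel"
    unfolding ray_phase_def by (intro borel_measurable_continuous_onI continuous_intros)
  have F_eq: "(LINT p|(lborel \<Otimes>\<^sub>M lborel). exp (\<i> * of_real (\<kappa> * ray_phase \<eta> p)) * P.leading \<xi> \<eta> p)
      - (LINT p|(lborel \<Otimes>\<^sub>M lborel). exp (\<i> * of_real (\<kappa> * ray_phase \<eta> p)) * Q.leading \<xi> \<eta> p) = F \<kappa>" for \<kappa>
  proof -
    have "integrable lborel (\<lambda>p. exp (\<i> * of_real (\<kappa> * ray_phase \<eta> p)) * P.leading \<xi> \<eta> p)"
      "integrable lborel (\<lambda>p. exp (\<i> * of_real (\<kappa> * ray_phase \<eta> p)) * Q.leading \<xi> \<eta> p)"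
      by (rule integrable_bounded_mult(1)[OF P.leading_integrable[OF \<eta>(1), unfolded lborel_prod], where b=1]
            integrable_bounded_mult(1)[OF Q.leading_integrable[OF \<eta>(1), unfolded lborel_prod], where b=1]; simp)+
    then show ?thesis
      unfolding F_def M_def lborel_prod by (simp add: right_diff_distrib)
  qed
  have F_bound: "norm (F \<kappa>) \<le> (LINT p|lborel. norm (M p))" for \<kappa>
    unfolding F_def using integrable_bounded_mult(2)[OF M, of "\<lambda>p. exp (\<i> * of_real (\<kappa> * ray_phase \<eta> p))" 1] by simp
  let ?amp = "\<lambda>A V \<kappa>. scattering_amplitude A V (out_dir \<xi> \<eta> \<kappa>) (in_dir \<xi> \<eta> \<kappa>) \<kappa>"
  have amp: "((\<lambda>\<kappa>. ?amp A V \<kappa> - ?amp A' V' \<kappa>) \<longlongrightarrow> 0) at_top"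
  proof (rule Lim_null_comparison[OF _ inverse_mult_null[of "\<bar>C\<bar>"]])
    show "\<forall>\<^sub>F \<kappa> in at_top. norm (?amp A V \<kappa> - ?amp A' V' \<kappa>) \<le> \<bar>C\<bar> / \<kappa>"
      using eq eventually_ge_at_top[of 1] eventually_ge_at_top[of "norm \<xi>"]
    proof eventually_elim
      fix \<kappa> :: real
      assume H: "\<forall>\<omega>\<in>sphere 0 1. \<forall>\<theta>\<in>sphere 0 1.
        norm (scattering_amplitude A V \<omega> \<theta> \<kappa> - scattering_amplitude A' V' \<omega> \<theta> \<kappa>) \<le> C / \<kappa>^3"
        and \<kappa>: "1 \<le> \<kappa>" "norm \<xi> \<le> \<kappa>"
      have "norm (?amp A V \<kappa> - ?amp A' V' \<kappa>) \<le> C / \<kappa>^3"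
        using H dir_norm[of \<kappa> \<xi> \<eta>] \<kappa> \<eta> by simp
      also have "\<dots> \<le> \<bar>C\<bar> / \<kappa>^3" using \<kappa> by (intro divide_right_mono) auto
      also have "\<dots> \<le> \<bar>C\<bar> / \<kappa>" using \<kappa> self_le_power[of \<kappa> 3] by (intro divide_left_mono) auto
      finally show "norm (?amp A V \<kappa> - ?amp A' V' \<kappa>) \<le> \<bar>C\<bar> / \<kappa>" .
    qed
  qed
  define d where "d = ?D - ?D'"
  define c where "c = ?Q - ?Q'"
  have main: "((\<lambda>\<kappa>. \<i> * of_real (\<kappa> * half_cos \<xi> \<kappa>) * d + c - F \<kappa>) \<longlongrightarrow> 0) at_top"
  proof -
    have alg: "u * (D - D') + (q - q') - (G - G') = (x - x') - ((x - (u * D + q) + G) - (x' - (u * D' + q') + G'))"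
      for u D D' q q' G G' x x' :: complex
      by (simp add: algebra_simps)
    note T = tendsto_diff[OF amp tendsto_diff[OF P.amplitude_asymptotics[OF \<eta>] Q.amplitude_asymptotics[OF \<eta>]]]
    have zero: "0 - (0 - 0) = (0::complex)" by simp
    show ?thesis
      by (rule Lim_transform_eventually[OF tendsto_eq_rhs[OF T zero]])
         (intro always_eventually allI, unfold d_def c_def F_eq[symmetric], rule alg[symmetric])
  qed
  have "d = 0"
  proof -
    have small: "((\<lambda>\<kappa>. complex_of_real (1 / \<kappa>)) \<longlongrightarrow> 0) at_top"
      using tendsto_of_real[OF inverse_mult_null[of 1], where 'a=complex] by simp
    have F0: "((\<lambda>\<kappa>. F \<kappa> * of_real (1 / \<kappa>)) \<longlongrightarrow> 0) at_top"
      by (rule bounded_times_null[OF always_eventually[OF allI[OF F_bound]] small])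
    \<comment> \<open>Divide by \<open>\<kappa>\<close>: the boundedness of \<open>F\<close> removes
      everything except \<open>\<i> d\<close>.\<close>
    have "((\<lambda>\<kappa>. (\<i> * of_real (\<kappa> * half_cos \<xi> \<kappa>) * d + c - F \<kappa>) * of_real (1 / \<kappa>) - c * of_real (1 / \<kappa>) + F \<kappa> * of_real (1 / \<kappa>))
        \<longlongrightarrow> 0 * 0 - c * 0 + 0) at_top"
      by (intro tendsto_intros main small F0)
    moreover have "\<forall>\<^sub>F \<kappa> in at_top. (\<i> * of_real (\<kappa> * half_cos \<xi> \<kappa>) * d + c - F \<kappa>) * of_real (1 / \<kappa>) - c * of_real (1 / \<kappa>) + F \<kappa> * of_real (1 / \<kappa>)
        = \<i> * of_real (half_cos \<xi> \<kappa>) * d"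
      using eventually_gt_at_top[of 0] by eventually_elim (simp add: field_simps)
    ultimately have "((\<lambda>\<kappa>. \<i> * of_real (half_cos \<xi> \<kappa>) * d) \<longlongrightarrow> 0 * 0 - c * 0 + 0) at_top"
      by (rule Lim_transform_eventually)
    moreover have "((\<lambda>\<kappa>. \<i> * of_real (half_cos \<xi> \<kappa>) * d) \<longlongrightarrow> \<i> * of_real 1 * d) at_top"
      by (intro tendsto_intros half_cos_tendsto)
    ultimately have "\<i> * of_real 1 * d = 0 * 0 - c * 0 + 0"
      by (intro tendsto_unique[of at_top]) auto
    then show ?thesis by simp
  qed
  then show "?D = ?D'" by (simp add: d_def)
  have "((\<lambda>\<kappa>. c - (\<i> * of_real (\<kappa> * half_cos \<xi> \<kappa>) * d + c - F \<kappa>)) \<longlongrightarrow> c - 0) at_top"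
    by (intro tendsto_diff tendsto_const main)
  \<comment> \<open>With \<open>d = 0\<close> the oscillatory integral is known to converge, as
    \<open>oscillatory_integral_limit_zero\<close> demands.\<close>
  then have "(F \<longlongrightarrow> c) at_top" using \<open>d = 0\<close> by simp
  then have "c = 0"
    using oscillatory_integral_limit_zero[OF M ray_meas ray_phase_nonzero[OF \<eta>(1)]] unfolding F_def by blast
  then show "?Q = ?Q'" by (simp add: c_def)
qed

text \<open>At fixed \<open>\<xi>\<close>, letting \<open>\<eta>\<close> range over the unit vectors
  orthogonal to \<open>\<xi>\<close> shows that the transform of the difference field is parallel to
  \<open>\<xi>\<close>; its curl therefore vanishes on the Fourier side. The second Fourier identity
  is the one for \<open>V - 1/2 div A\<close>.\<close>

theorem theorem1p1:
  shows "\<exists>k0::nat. \<forall>k\<ge>k0. \<forall>(A :: real^3 \<Rightarrow> complex^3) (A' :: real^3 \<Rightarrow> complex^3)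
            (V :: real^3 \<Rightarrow> complex) (V' :: real^3 \<Rightarrow> complex).
    Ck k A \<and> Ck k A' \<and> Ck k V \<and> Ck k V' \<and>
    compactly_supported A \<and> compactly_supported A' \<and>
    compactly_supported V \<and> compactly_supported V' \<and>
    (\<exists>C. \<forall>\<^sub>F \<kappa> in at_top. \<forall>\<omega>\<in>sphere 0 1. \<forall>\<theta>\<in>sphere 0 1.
       norm (scattering_amplitude A V \<omega> \<theta> \<kappa> - scattering_amplitude A' V' \<omega> \<theta> \<kappa>) \<le> C / \<kappa>^3)
    \<longrightarrow> (\<forall>x. curl A x = curl A' x) \<and>
        (\<forall>x. V x - 1/2 * divergence A x = V' x - 1/2 * divergence A' x)"
proof (rule exI[of _ 1], intro allI impI)
  fix k :: nat and A A' :: "real^3 \<Rightarrow> complex^3" and V V' :: "real^3 \<Rightarrow> complex"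
  assume "1 \<le> k"
  assume H: "Ck k A \<and> Ck k A' \<and> Ck k V \<and> Ck k V' \<and>
    compactly_supported A \<and> compactly_supported A' \<and>
    compactly_supported V \<and> compactly_supported V' \<and>
    (\<exists>C. \<forall>\<^sub>F \<kappa> in at_top. \<forall>\<omega>\<in>sphere 0 1. \<forall>\<theta>\<in>sphere 0 1.
       norm (scattering_amplitude A V \<omega> \<theta> \<kappa> - scattering_amplitude A' V' \<omega> \<theta> \<kappa>) \<le> C / \<kappa>^3)"
  then have C1: "Ck 1 A" "Ck 1 A'" "Ck 1 V" "Ck 1 V'"
    using Ck_mono[OF _ \<open>1 \<le> k\<close>] by blast+
  obtain C where C: "\<forall>\<^sub>F \<kappa> in at_top. \<forall>\<omega>\<in>sphere 0 1. \<forall>\<theta>\<in>sphere 0 1.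
       norm (scattering_amplitude A V \<omega> \<theta> \<kappa> - scattering_amplitude A' V' \<omega> \<theta> \<kappa>) \<le> C / \<kappa>^3"
    using H by blast
  obtain R a where P: "potential A V R a" using ex_potential[of A V] C1 H by blast
  obtain R' a' where Q: "potential A' V' R' a'" using ex_potential[of A' V'] C1 H by blast
  define S where "S = max R R'"
  define b where "b = (\<lambda>j x. A x $ j - A' x $ j)"
  define q where "q = (\<lambda>x. V x - V' x)"
  have comp: "continuous_on UNIV (\<lambda>x. B x $ j)" "(\<lambda>x. B x $ j) differentiable (at x)"
    "continuous_on UNIV (partial i (\<lambda>x. B x $ j))"
    if "Ck 1 B" for B :: "real^3 \<Rightarrow> complex^3" and i j x
  proof -
    have "Ck 1 (\<lambda>x. B x $ j)" by (rule Ck_bounded_linear[OF bounded_linear_vec_nth that])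
    from Ck_1D[OF this] show "continuous_on UNIV (\<lambda>x. B x $ j)" "(\<lambda>x. B x $ j) differentiable (at x)"
      "continuous_on UNIV (partial i (\<lambda>x. B x $ j))" by blast+
  qed
  have b_diff: "b j differentiable (at x)" for j x
    unfolding b_def by (intro differentiable_diff comp(2) C1)
  have b_partial: "partial i (b j) = (\<lambda>x. partial i (\<lambda>y. A y $ j) x - partial i (\<lambda>y. A' y $ j) x)" for i j
  proof
    fix x
    show "partial i (b j) x = partial i (\<lambda>y. A y $ j) x - partial i (\<lambda>y. A' y $ j) x"
      using has_derivative_imp_partial[OF has_derivative_diff[OF
            comp(2)[OF C1(1), unfolded frechet_derivative_works] comp(2)[OF C1(2), unfolded frechet_derivative_works]]]
      unfolding b_def partial_def by blast
  qed
  have b_cont: "continuous_on UNIV (b j)" for j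
    unfolding b_def by (intro continuous_on_diff comp(1) C1)
  have bp_cont: "continuous_on UNIV (partial i (b j))" for i j
    unfolding b_partial by (intro continuous_on_diff comp(3) C1)
  have b_supp: "supported_in_ball S (b j)" and q_supp: "supported_in_ball S q" for j
    using potential.A_supp[OF P, of j] potential.A_supp[OF Q, of j] potential.V_supp[OF P] potential.V_supp[OF Q]
    by (auto simp: supported_in_ball_def S_def b_def q_def)
  have q_cont: "continuous_on UNIV q"
    unfolding q_def by (intro continuous_on_diff Ck_1D(1) C1)
  have bp_supp: "supported_in_ball S (partial i (b j))" for i j
    by (rule dir_deriv_supported[OF dir_deriv_partial[OF b_diff] b_supp])
  have bp_int: "integrable lborel (partial i (b j))" for i j
    by (rule integrable_supported_in_ball[OF bp_cont bp_supp])
  have q_int: "integrable lborel q" by (rule integrable_supported_in_ball[OF q_cont q_supp])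
  have FT_bp: "FT (partial i (b j)) \<xi> = \<i> * of_real (\<xi> $ i) * FT (b j) \<xi>" for i j \<xi>
    by (rule FT_partial[OF b_diff b_cont bp_cont b_supp])
  have FT_b: "FT (b j) \<xi> = FT (\<lambda>x. A x $ j) \<xi> - FT (\<lambda>x. A' x $ j) \<xi>" for j \<xi>
    using FT_linear[of "\<lambda>x. A x $ j" "\<lambda>x. A' x $ j" "- 1" \<xi>]
      integrable_supported_in_ball[OF potential.A_cont[OF P] potential.A_supp[OF P], of j]
      integrable_supported_in_ball[OF potential.A_cont[OF Q] potential.A_supp[OF Q], of j]
    by (simp add: b_def)
  have FT_q: "FT q \<xi> = FT V \<xi> - FT V' \<xi>" for \<xi>
    using FT_linear[of V V' "- 1" \<xi>]
      integrable_supported_in_ball[OF potential.V_cont[OF P] potential.V_supp[OF P]]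
      integrable_supported_in_ball[OF potential.V_cont[OF Q] potential.V_supp[OF Q]]
    by (simp add: q_def)
  have orth: "(\<Sum>j\<in>UNIV. of_real (v $ j) * FT (b j) \<xi>) = 0" if v: "v \<bullet> \<xi> = 0" for v \<xi> :: "real^3"
  proof (cases "v = 0")
    case False
    define \<eta> where "\<eta> = v /\<^sub>R norm v"
    have "norm \<eta> = 1" "\<eta> \<bullet> \<xi> = 0" using False v by (simp_all add: \<eta>_def)
    from asymptotics_determine_FT(1)[OF P Q this C]
    have "(\<Sum>j\<in>UNIV. of_real (\<eta> $ j) * FT (b j) \<xi>) = 0"
      by (simp add: FT_b right_diff_distrib sum_subtractf)
    then have "of_real (norm v) * (\<Sum>j\<in>UNIV. of_real (\<eta> $ j) * FT (b j) \<xi>) = 0" by simp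
    moreover have "of_real (norm v) * (of_real (\<eta> $ j) * FT (b j) \<xi>) = of_real (v $ j) * FT (b j) \<xi>" for j
      using False by (simp add: \<eta>_def)
    ultimately show ?thesis by (simp add: sum_distrib_left)
  qed simp
  have curl0: "partial i (b j) x - partial j (b i) x = 0" if "i \<noteq> j" for i j x
  proof -
    \<comment> \<open>Differences and sums are written with an explicit scalar factor to match
      \<open>FT_linear\<close>; the factors \<open>1 *\<close> in \<open>div0\<close> serve the same
      purpose.\<close>
    have "partial i (b j) x + (- 1) * partial j (b i) x = 0"
    proof (rule fourier_injective[of "\<lambda>x. partial i (b j) x + (- 1) * partial j (b i) x" S])
      fix \<xi> :: "real^3"
      \<comment> \<open>This vector is orthogonal to \<open>\<xi>\<close> by antisymmetry, and
        pairing it with the transform of \<open>b\<close> gives entry \<open>(i, j)\<close> of the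
        curl up to the factor \<open>\<i>\<close>.\<close>
      define v where "v = (\<xi> $ i) *\<^sub>R axis j 1 - (\<xi> $ j) *\<^sub>R (axis i 1 :: real^3)"
      have "v \<bullet> \<xi> = 0" by (simp add: v_def inner_diff_left inner_axis' mult.commute)
      from orth[OF this] have "of_real (\<xi> $ i) * FT (b j) \<xi> - of_real (\<xi> $ j) * FT (b i) \<xi> = 0"
      proof -
        have "of_real (v $ l) * FT (b l) \<xi> = (if l = j then of_real (\<xi> $ i) * FT (b j) \<xi> else 0)
            - (if l = i then of_real (\<xi> $ j) * FT (b i) \<xi> else 0)" for l
          using that by (auto simp: v_def axis_def)
        then have "(\<Sum>l\<in>UNIV. of_real (v $ l) * FT (b l) \<xi>) = of_real (\<xi> $ i) * FT (b j) \<xi> - of_real (\<xi> $ j) * FT (b i) \<xi>"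
          by (simp add: sum_subtractf)
        then show ?thesis using orth[OF \<open>v \<bullet> \<xi> = 0\<close>] by simp
      qed
      then have "\<i> * (of_real (\<xi> $ i) * FT (b j) \<xi> - of_real (\<xi> $ j) * FT (b i) \<xi>) = 0" by simp
      then have "FT (\<lambda>x. partial i (b j) x + (- 1) * partial j (b i) x) \<xi> = 0"
        unfolding FT_linear[OF bp_int bp_int] FT_bp by (simp add: algebra_simps)
      then show "(LINT x|lborel. exp (- \<i> * of_real (\<xi> \<bullet> x)) * (partial i (b j) x + (- 1) * partial j (b i) x)) = 0"
        by (simp only: FT_def)
    qed (intro continuous_on_add continuous_on_mult continuous_on_const bp_cont
          supported_in_ball_add supported_in_ball_mult(1) bp_supp)+
    then show ?thesis by simp
  qed
  have div0: "q x + (- 1/2) * (partial 1 (b 1) x + 1 * (partial 2 (b 2) x + 1 * partial 3 (b 3) x)) = 0" for x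
  proof (rule fourier_injective[of "\<lambda>x. q x + (- 1/2) * (partial 1 (b 1) x + 1 * (partial 2 (b 2) x + 1 * partial 3 (b 3) x))" S])
    fix \<xi> :: "real^3"
    \<comment> \<open>Any unit vector orthogonal to \<open>\<xi>\<close> serves here, because the
      identity to be extracted does not involve \<open>\<eta>\<close>.\<close>
    obtain y :: "real^3" where y: "y \<noteq> 0" "orthogonal \<xi> y"
      using orthogonal_to_vector_exists[of \<xi>] by auto
    define \<eta> where "\<eta> = y /\<^sub>R norm y"
    have "norm \<eta> = 1" "\<eta> \<bullet> \<xi> = 0"
      using y by (simp_all add: \<eta>_def orthogonal_def inner_commute)
    from asymptotics_determine_FT(2)[OF P Q this C]
    have Q0: "FT q \<xi> - \<i> / 2 * (\<Sum>j\<in>UNIV. of_real (\<xi> $ j) * FT (b j) \<xi>) = 0"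
      by (simp add: FT_q FT_b right_diff_distrib sum_subtractf algebra_simps)
    have i2: "integrable lborel (\<lambda>x. partial 2 (b 2) x + 1 * partial 3 (b 3) x)"
      by (intro Bochner_Integration.integrable_add integrable_mult_right bp_int)
    have i1: "integrable lborel (\<lambda>x. partial 1 (b 1) x + 1 * (partial 2 (b 2) x + 1 * partial 3 (b 3) x))"
      by (intro Bochner_Integration.integrable_add integrable_mult_right bp_int)
    have "FT (\<lambda>x. q x + (- 1/2) * (partial 1 (b 1) x + 1 * (partial 2 (b 2) x + 1 * partial 3 (b 3) x))) \<xi> = 0"
      unfolding FT_linear[OF q_int i1] FT_linear[OF bp_int i2] FT_linear[OF bp_int bp_int] FT_bp
      using Q0 by (simp add: sum_3 algebra_simps)
    then show "(LINT x|lborel. exp (- \<i> * of_real (\<xi> \<bullet> x)) *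
        (q x + (- 1/2) * (partial 1 (b 1) x + 1 * (partial 2 (b 2) x + 1 * partial 3 (b 3) x)))) = 0"
      by (simp only: FT_def)
  qed (intro continuous_on_add continuous_on_mult continuous_on_const bp_cont q_cont
        supported_in_ball_add supported_in_ball_mult(1) bp_supp q_supp)+
  show "(\<forall>x. curl A x = curl A' x) \<and> (\<forall>x. V x - 1/2 * divergence A x = V' x - 1/2 * divergence A' x)"
  proof (intro conjI allI)
    fix x
    have "partial i (\<lambda>y. A y $ j) x - partial j (\<lambda>y. A y $ i) x
        = partial i (\<lambda>y. A' y $ j) x - partial j (\<lambda>y. A' y $ i) x" if "i \<noteq> j" for i j
      using curl0[OF that, of x] unfolding b_partial by (simp add: algebra_simps)
    then show "curl A x = curl A' x" by (simp add: curl_def)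
    show "V x - 1/2 * divergence A x = V' x - 1/2 * divergence A' x"
      using div0[of x] unfolding b_partial q_def divergence_def by (simp add: sum_3 algebra_simps)
  qed
qed

end
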